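(* Let $f(\tau)=\sum_{n\ge1}a_f(n)e^{2\pi i n\tau}$ be a holomorphic cusp form of weight $k$ for the full modular group $\mathrm{SL}_2(\mathbb{Z})$ with real Fourier coefficients $a_f(n)$, and let $L(s,f)$ be its associated $L$-function. Let $(c_j)_{j\in\mathbb{N}}$ be a sequence of non-zero real numbers with $\sum_{j=1}^\infty|c_j|<\infty$ and let $(\lambda_j)_{j\in\mathbb{N}}$ be a bounded sequence of distinct real numbers. Extend both sequences to $\mathbb{Z}\setminus\{0\}$ by $c_{-j}:=c_j$, $\lambda_{-j}:=-\lambda_j$. Let $z$ be a real number with $-\frac{\sqrt{\pi}}{3}\le z\le\frac{\sqrt{\pi}}{3}$. Define $$\tilde G_{z,f}(s):=\sum_{j\neq0}c_j\,(2\pi)^{-s-i\lambda_j}\Gamma(s+i\lambda_j)\,L(s+i\lambda_j,f)\left\{{}_1F_1\!\left(k-s-i\lambda_j;k;\tfrac{z^2}{4}\right)+{}_1F_1\!\left(k-\overline{s}+i\lambda_j;k;\tfrac{z^2}{4}\right)\right\},$$ and let $N_{f,z}(T)$ denote the number of zeros of $\tilde G_{z,f}$ of the form $s=\frac{k}{2}+it$ with $0\le t\le T$. Then there exists $d>0$ such that $$\limsup_{T\to\infty}\frac{N_{f,z}(T)}{\sqrt{T}}\ge d.$$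
   Context: $L(s,f)=\sum_{n\ge1}a_f(n)n^{-s}$ for $\mathrm{Re}(s)>\frac{k+1}{2}$, continued to an entire function satisfying $(2\pi)^{-s}\Gamma(s)L(s,f)=(-1)^{k/2}(2\pi)^{-(k-s)}\Gamma(k-s)L(k-s,f)$. ${}_1F_1(a;c;w)=\sum_{n\ge0}\frac{(a)_n}{(c)_n}\frac{w^n}{n!}$ is Kummer's confluent hypergeometric function. *)

theory Defs
  imports "HOL-Complex_Analysis.Complex_Analysis" "HOL-Library.Extended_Real"
begin

text \<open>Only the values \<open>b n\<close> with \<open>n \<ge> 1\<close> enter: the constant term of the expansion is zero.\<close>

definition has_cuspidal_expansion :: "(complex \<Rightarrow> complex) \<Rightarrow> (nat \<Rightarrow> complex) \<Rightarrow> bool" where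
  "has_cuspidal_expansion f b \<longleftrightarrow>
     (\<forall>\<tau>. Im \<tau> > 0 \<longrightarrow>
        (\<lambda>n. b (Suc n) * exp (2 * of_real pi * \<i> * of_nat (Suc n) * \<tau>)) sums f \<tau>)"

definition cusp_form :: "nat \<Rightarrow> (complex \<Rightarrow> complex) \<Rightarrow> bool" where
  "cusp_form k f \<longleftrightarrow>
     f holomorphic_on {\<tau>. Im \<tau> > 0} \<and>
     (\<forall>a b c d :: int. a * d - b * c = 1 \<longrightarrow>
        (\<forall>\<tau>. Im \<tau> > 0 \<longrightarrow>
           f ((of_int a * \<tau> + of_int b) / (of_int c * \<tau> + of_int d)) =
             (of_int c * \<tau> + of_int d) ^ k * f \<tau>)) \<and>
     (\<exists>b. has_cuspidal_expansion f b)"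

text \<open>The entire continuation of the Dirichlet series; it is unique by the identity theorem.\<close>

definition cusp_L :: "nat \<Rightarrow> (nat \<Rightarrow> complex) \<Rightarrow> complex \<Rightarrow> complex" where
  "cusp_L k b = (THE L. L holomorphic_on UNIV \<and>
     (\<forall>s. Re s > (real k + 1) / 2 \<longrightarrow>
        (\<lambda>n. b (Suc n) * of_nat (Suc n) powr (- s)) sums L s))"

definition kummer_1F1 :: "complex \<Rightarrow> complex \<Rightarrow> complex \<Rightarrow> complex" where
  "kummer_1F1 a c w = (\<Sum>n. pochhammer a n / pochhammer c n * (w ^ n / fact n))"

text \<open>Extensions of a sequence indexed by \<open>1, 2, \<dots>\<close> to the nonzero integers;
  the values at \<open>0\<close> are never used.\<close>

definition even_ext :: "(nat \<Rightarrow> real) \<Rightarrow> int \<Rightarrow> real" where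
  "even_ext c j = (if j < 0 then c (nat (- j)) else c (nat j))"

definition odd_ext :: "(nat \<Rightarrow> real) \<Rightarrow> int \<Rightarrow> real" where
  "odd_ext l j = (if j < 0 then - l (nat (- j)) else l (nat j))"

definition G_tilde ::
  "nat \<Rightarrow> (nat \<Rightarrow> complex) \<Rightarrow> (nat \<Rightarrow> real) \<Rightarrow> (nat \<Rightarrow> real) \<Rightarrow> real \<Rightarrow> complex \<Rightarrow> complex" where
  "G_tilde k b c l z s =
     (\<Sum>\<^sub>\<infinity>j\<in>{j. j \<noteq> 0}.
        let \<mu> = \<i> * of_real (odd_ext l j); w = of_real (z\<^sup>2 / 4) in
        of_real (even_ext c j) * of_real (2 * pi) powr (- s - \<mu>) * Gamma (s + \<mu>)
          * cusp_L k b (s + \<mu>)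
          * (kummer_1F1 (of_nat k - s - \<mu>) (of_nat k) w
             + kummer_1F1 (of_nat k - cnj s + \<mu>) (of_nat k) w))"

text \<open>Zeros are counted as points: \<open>G_tilde\<close> involves \<open>cnj s\<close>, so it is not holomorphic in general
  and has no orders of vanishing. The count is \<open>\<infinity>\<close> when the set is infinite, which is the case
  for instance if \<open>f = 0\<close>, or if the terms cancel (\<open>\<lambda>\<^sub>i = -\<lambda>\<^sub>j\<close>, \<open>c\<^sub>i = -c\<^sub>j\<close> is possible).\<close>

definition critical_zeros ::
  "nat \<Rightarrow> (nat \<Rightarrow> complex) \<Rightarrow> (nat \<Rightarrow> real) \<Rightarrow> (nat \<Rightarrow> real) \<Rightarrow> real \<Rightarrow> real \<Rightarrow> complex set" where
  "critical_zeros k b c l z T =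
     {s. G_tilde k b c l z s = 0 \<and> (\<exists>t. 0 \<le> t \<and> t \<le> T \<and> s = of_nat k / 2 + \<i> * of_real t)}"

definition N_zeros ::
  "nat \<Rightarrow> (nat \<Rightarrow> complex) \<Rightarrow> (nat \<Rightarrow> real) \<Rightarrow> (nat \<Rightarrow> real) \<Rightarrow> real \<Rightarrow> real \<Rightarrow> ereal" where
  "N_zeros k b c l z T =
     (if finite (critical_zeros k b c l z T)
      then ereal (real (card (critical_zeros k b c l z T))) else \<infinity>)"

end

theory Submission
  imports Defs "HOL-Probability.Probability" "HOL-Real_Asymp.Real_Asymp"
begin

text \<open>
  On the critical line the function is, up to a constant factor \<open>1\<close> or \<open>\<i>\<close>, a real even or odd function
  \<open>G(t) = \<Sum>\<^sub>j c\<^sub>j (H(t + \<lambda>\<^sub>j) + H(t - \<lambda>\<^sub>j))\<close>, where \<open>H\<close> is built from the product of \<open>\<Lambda>(k/2 + it)\<close>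
  and Kummer's function.  Fourier inversion expresses \<open>F(\<theta>) = \<integral> H(t) e\<^bsup>\<theta>t\<^esup> dt\<close> through values of \<open>f\<close> near the
  cusps \<open>\<plusminus>1\<close> as \<open>\<theta> \<rightarrow> \<pi>/2\<close>, so \<open>F(\<pi>/2 - \<delta>) = O(e\<^bsup>-1/\<delta>\<^esup>)\<close> also for \<open>\<delta>\<close> in small complex discs; the shifts only
  multiply \<open>F\<close> by bounded factors.  If \<open>G\<close> had fewer than \<open>d \<surd>T\<close> zeros up to every large \<open>T\<close>, the polynomials
  \<open>P(t) = \<Prod> (1 - t\<^sup>2/\<tau>\<^sup>2)\<close> over its sign changes \<open>\<tau> < N\<close> would be \<open>O(e\<^bsup>A \<surd>t\<^esup>)\<close> uniformly in \<open>N\<close> with small \<open>A\<close>.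
  Cauchy's estimates for the derivatives of the transform of \<open>G\<close> bound \<open>\<integral> G(t) P(t) e\<^bsup>\<theta>t\<^esup> dt\<close> by
  \<open>O(e\<^bsup>C A\<^sup>2/\<delta> - 1/\<delta>\<^esup>)\<close>, which tends to \<open>0\<close>, whereas the integrand essentially has constant sign.
\<close>

section \<open>Integration over products and averages over the circle\<close>

text \<open>The scale \<open>sqrt T\<close> is tied to the decay \<open>exp (- 1/\<delta>)\<close>:
  a product over zeros of density \<open>d * sqrt T\<close> grows like
  \<open>exp (A * sqrt t)\<close>, and inserting such growth under a transform that is small on
  discs of radius proportional to \<open>\<delta>\<close> costs a factor
  \<open>exp (const * A\<^sup>2/\<delta>)\<close>. Both exponents are multiples of
  \<open>1/\<delta>\<close>, so a small density loses. The density 1/40 gives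
  \<open>A = 9/40\<close>, and \<open>8 * A\<^sup>2 < 1/2\<close>.

  The obstacle is Kummer's factor. It is an average over a circle of radius R of exponentials in t
  with rate at most \<open>2 * w / R\<close>, where \<open>w = z\<^sup>2/4\<close>, weighted by
  \<open>exp R\<close>. A fixed R would move the argument of f away from the cusp by a fixed amount
  and destroy the decay, so R has to be proportional to \<open>1/\<delta>\<close>; then
  \<open>exp R\<close> itself competes with the decay. The range of z gives
  \<open>w \<le> pi/36\<close>, which makes \<open>R = pi / (9 * \<delta>)\<close> admissible: the
  decay \<open>4 * pi / 9\<close> minus the growth \<open>pi / 9\<close> leaves
  \<open>pi / 3 > 1\<close>.\<close>

lemma integral_product_swap_bounded:
  fixes K :: "real \<Rightarrow> real \<Rightarrow> complex"
  assumes sets [measurable_cong]: "sets M = sets borel" "sets N = sets borel"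
    and "sigma_finite_measure M" "sigma_finite_measure N"
    and [measurable]: "(\<lambda>(x, y). K x y) \<in> borel_measurable (borel \<Otimes>\<^sub>M borel)"
    and [measurable]: "integrable M b" "integrable N b'"
    and bound: "\<And>x y. norm (K x y) \<le> b x * b' y"
  shows "(\<integral>x. (\<integral>y. K x y \<partial>N) \<partial>M) = (\<integral>y. (\<integral>x. K x y \<partial>M) \<partial>N)"
proof -
  interpret M: sigma_finite_measure M by fact
  interpret N: sigma_finite_measure N by fact
  interpret pair_sigma_finite M N ..
  have meas: "(\<lambda>(x, y). K x y) \<in> borel_measurable (M \<Otimes>\<^sub>M N)" by measurable
  have b: "norm (K x y) \<le> \<bar>b x\<bar> * \<bar>b' y\<bar>" for x y
    by (rule order.trans[OF bound]) (simp flip: abs_mult)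
  have intN: "integrable N (\<lambda>y. K x y)" for x
    by (rule Bochner_Integration.integrable_bound[where f="\<lambda>y. \<bar>b x\<bar> * \<bar>b' y\<bar>"])
       (use b assms(7) in \<open>auto intro!: integrable_abs\<close>)
  have "integrable (M \<Otimes>\<^sub>M N) (\<lambda>(x, y). K x y)"
  proof (rule Fubini_integrable[OF meas])
    show "AE x in M. integrable N (\<lambda>y. case (x, y) of (x, y) \<Rightarrow> K x y)" using intN by simp
    show "integrable M (\<lambda>x. \<integral>y. norm (case (x, y) of (x, y) \<Rightarrow> K x y) \<partial>N)"
    proof (rule Bochner_Integration.integrable_bound[where f="\<lambda>x. \<bar>b x\<bar> * (\<integral>y. \<bar>b' y\<bar> \<partial>N)"])
      show "integrable M (\<lambda>x. \<bar>b x\<bar> * (\<integral>y. \<bar>b' y\<bar> \<partial>N))"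
        using assms(6) by (auto intro!: integrable_abs)
      show "AE x in M. norm (\<integral>y. norm (case (x, y) of (x, y) \<Rightarrow> K x y) \<partial>N) \<le> norm (\<bar>b x\<bar> * (\<integral>y. \<bar>b' y\<bar> \<partial>N))"
      proof (intro AE_I2)
        fix x
        have "(\<integral>y. norm (K x y) \<partial>N) \<le> (\<integral>y. \<bar>b x\<bar> * \<bar>b' y\<bar> \<partial>N)"
          using intN b assms(7) by (intro integral_mono) (auto intro!: integrable_abs integrable_norm)
        then show "norm (\<integral>y. norm (case (x, y) of (x, y) \<Rightarrow> K x y) \<partial>N) \<le> norm (\<bar>b x\<bar> * (\<integral>y. \<bar>b' y\<bar> \<partial>N))"
          by (auto simp: abs_mult)
      qed
    qed measurable
  qed
  then show ?thesis by (rule Fubini_integral[symmetric])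
qed

lemma continuous_on_integral_dominated:
  fixes K :: "real \<Rightarrow> real \<Rightarrow> complex"
  assumes "\<And>x. K x \<in> borel_measurable M" "integrable M b"
    and "\<And>x y. x \<in> S \<Longrightarrow> norm (K x y) \<le> b y"
    and "\<And>y. continuous_on S (\<lambda>x. K x y)"
  shows "continuous_on S (\<lambda>x. \<integral>y. K x y \<partial>M)"
  unfolding continuous_on_sequentially comp_def
proof (intro allI impI ballI)
  fix u a assume a: "a \<in> S" and "(\<forall>n. u n \<in> S) \<and> u \<longlonglongrightarrow> a"
  then have u: "\<And>n. u n \<in> S" "u \<longlonglongrightarrow> a" by auto
  have "(\<lambda>n. K (u n) y) \<longlonglongrightarrow> K a y" for y
    using assms(4)[of y] a u by (auto simp: continuous_on_sequentially comp_def)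
  then show "(\<lambda>n. \<integral>y. K (u n) y \<partial>M) \<longlonglongrightarrow> (\<integral>y. K a y \<partial>M)"
    using assms u by (intro integral_dominated_convergence[where w=b]) auto
qed

lemma cis_measurable [measurable]: "cis \<in> borel_measurable borel"
  by (intro borel_measurable_continuous_onI continuous_intros)

text \<open>The uniform probability measure on the angles: contour integrals over circles become
  averages, so Cauchy's estimates, Parseval and the interchanges of integrals all run over one
  finite measure.\<close>

definition circ :: "real measure" where
  "circ = uniform_measure lborel {0..2*pi}"

lemma sets_circ [simp, measurable_cong]: "sets circ = sets borel"
  by (simp add: circ_def)

lemma space_circ [simp]: "space circ = UNIV"
  by (simp add: circ_def)

interpretation circ: prob_space circ
  unfolding circ_def by (rule prob_space_uniform_measure) auto

lemma integrable_circ: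
  fixes f :: "real \<Rightarrow> complex"
  assumes "f \<in> borel_measurable borel" "\<And>x. norm (f x) \<le> B"
  shows "integrable circ f"
  using assms by (intro circ.integrable_const_bound[where B=B]) auto

lemma norm_integral_circ_le:
  fixes f :: "real \<Rightarrow> complex"
  assumes "f \<in> borel_measurable borel" "\<And>x. norm (f x) \<le> B"
  shows "norm (\<integral>x. f x \<partial>circ) \<le> B"
proof -
  have "norm (\<integral>x. f x \<partial>circ) \<le> (\<integral>x. norm (f x) \<partial>circ)"
    using integrable_circ[OF assms] by simp
  also have "\<dots> \<le> B"
    using integrable_circ[OF assms] assms by (intro circ.integral_le_const) auto
  finally show ?thesis .
qed

lemma integral_circ:
  fixes f :: "real \<Rightarrow> complex"
  assumes "f \<in> borel_measurable borel"
  shows "(\<integral>x. f x \<partial>circ) = (\<integral>x. indicator {0..2*pi} x *\<^sub>R f x \<partial>lborel) / (2*pi)"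
proof -
  have *: "indicator {0..2*pi} x / ennreal (2*pi) = ennreal (indicator {0..2*pi} x / (2*pi))" for x
    by (auto simp: indicator_def divide_ennreal[symmetric])
  have eq: "circ = density lborel (\<lambda>x. ennreal (indicator {0..2*pi} x / (2*pi)))"
    unfolding circ_def uniform_measure_def by (simp add: *)
  have "(\<integral>x. f x \<partial>circ) = (\<integral>x. (indicator {0..2*pi} x / (2*pi)) *\<^sub>R f x \<partial>lborel)"
    unfolding eq using assms by (subst integral_density) auto
  also have "\<dots> = (\<integral>x. (1/(2*pi)) *\<^sub>R (indicator {0..2*pi} x *\<^sub>R f x) \<partial>lborel)"
    by (simp add: field_simps)
  finally show ?thesis by (simp add: scaleR_conv_of_real divide_simps)
qed

lemma integral_circ_cis:
  fixes m :: int
  shows "(\<integral>x. cis (of_int m * x) \<partial>circ) = (if m = 0 then 1 else 0)"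
proof (cases "m = 0")
  case True
  then show ?thesis using circ.prob_space by simp
next
  case False
  have "(\<integral>x. indicator {0..2*pi} x *\<^sub>R cis (of_int m * x) \<partial>lborel)
     = cis (of_int m * (2*pi)) / (\<i> * of_int m) - cis (of_int m * 0) / (\<i> * of_int m)"
  proof (rule integral_FTC_Icc)
    fix x show "((\<lambda>x. cis (of_int m * x) / (\<i> * of_int m)) has_vector_derivative cis (of_int m * x)) (at x within {0..2*pi})"
      using False unfolding cis_conv_exp
      by (auto intro!: derivative_eq_intros has_vector_derivative_real_field simp: field_simps)
  qed (auto intro!: continuous_intros)
  also have "cis (of_int m * (2*pi)) = 1"
    by (metis cis_multiple_2pi Ints_of_int mult.commute)
  finally show ?thesis using False
    by (subst integral_circ) (auto intro!: borel_measurable_continuous_onI continuous_intros)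
qed

text \<open>Only the term \<open>j = n\<close> of the exponential series survives orthogonality. The
  formula serves twice: it writes \<open>(r * t) ^ n / fact n\<close> as a circle average in
  Cauchy's estimate, and it produces the factorials in Kummer's series.\<close>

lemma integral_circ_exp:
  "(\<integral>x. exp (z * cis x) * cis (- of_nat n * x) \<partial>circ) = z ^ n / fact n"
proof -
  have *: "(\<lambda>j. z ^ j / fact j * cis (of_int (int j - int n) * x)) sums (exp (z * cis x) * cis (- of_nat n * x))" for x
  proof -
    have "(\<lambda>j. (z * cis x) ^ j /\<^sub>R fact j * cis (- of_nat n * x)) sums (exp (z * cis x) * cis (- of_nat n * x))"
      by (intro sums_mult2 exp_converges)
    also have "(\<lambda>j. (z * cis x) ^ j /\<^sub>R fact j * cis (- of_nat n * x)) = (\<lambda>j. z ^ j / fact j * cis (of_int (int j - int n) * x))"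
      by (auto simp: scaleR_conv_of_real power_mult_distrib Complex.DeMoivre cis_mult field_simps fun_eq_iff)
    finally show ?thesis .
  qed
  have summ: "summable (\<lambda>j. norm z ^ j / fact j)"
    using summable_exp[of "norm z"] by (simp add: field_simps)
  have "(\<lambda>j. \<integral>x. z ^ j / fact j * cis (of_int (int j - int n) * x) \<partial>circ) sums
          (\<integral>x. (\<Sum>j. z ^ j / fact j * cis (of_int (int j - int n) * x)) \<partial>circ)"
  proof (rule sums_integral)
    fix j show "integrable circ (\<lambda>x. z ^ j / fact j * cis (of_int (int j - int n) * x))"
      by (rule integrable_circ[where B="norm z ^ j / fact j"])
         (auto intro!: borel_measurable_continuous_onI continuous_intros simp: norm_mult norm_divide norm_power)
  qed (use summ circ.prob_space in \<open>auto simp: norm_mult norm_divide norm_power\<close>)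
  also have "(\<lambda>x. \<Sum>j. z ^ j / fact j * cis (of_int (int j - int n) * x)) = (\<lambda>x. exp (z * cis x) * cis (- of_nat n * x))"
    using * by (auto simp: sums_iff)
  also have "(\<lambda>j. \<integral>x. z ^ j / fact j * cis (of_int (int j - int n) * x) \<partial>circ) = (\<lambda>j. if j = n then z ^ j / fact j else 0)"
    by (auto simp: integral_circ_cis simp del: of_int_diff)
  finally show ?thesis using sums_unique2[OF sums_single] by metis
qed

lemma integrable_exp_abs:
  assumes "e > 0"
  shows "integrable lborel (\<lambda>t::real. exp (- e * \<bar>t\<bar>))"
proof -
  have 1: "integrable lborel (\<lambda>t. indicator {0<..} t *\<^sub>R exp (- (t * e)))"
    using integrable_I0i_exp_mscale[OF assms] by (simp add: set_integrable_def)
  have 2: "integrable lborel (\<lambda>t. indicator {0<..} (-t) *\<^sub>R exp (- (- t * e)))"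
    using lborel_integrable_real_affine[OF 1, of "-1" 0] by simp
  have "integrable lborel (\<lambda>t. indicator {0<..} t *\<^sub>R exp (- (t * e)) + indicator {0<..} (-t) *\<^sub>R exp (- (- t * e)))"
    by (rule Bochner_Integration.integrable_add[OF 1 2])
  \<comment> \<open>The two open half-lines miss only the null set \<open>{0}\<close>.\<close>
  also have "?this \<longleftrightarrow> ?thesis"
    by (rule integrable_cong_AE) (auto intro!: AE_I'[of "{0::real}"] simp: indicator_def mult.commute)
  finally show ?thesis .
qed

section \<open>Functions with small exponential moments have many zeros\<close>

text \<open>Cauchy's estimate for the \<open>n\<close>-th derivative of the transform, the derivative being written as a circle average.\<close>

lemma integral_power_exp_le:
  fixes G :: "real \<Rightarrow> complex"
  assumes [measurable]: "G \<in> borel_measurable borel"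
    and G: "\<And>t. norm (G t) \<le> C * exp (- \<eta> * \<bar>t\<bar>)"
    and r: "r > 0" "\<bar>\<theta>\<bar> + r < \<eta>"
    and F: "\<And>\<zeta>. norm (\<zeta> - of_real \<theta>) \<le> r \<Longrightarrow> norm (\<integral>t. G t * exp (\<zeta> * of_real t) \<partial>lborel) \<le> M"
  shows "norm (\<integral>t. G t * of_real (t ^ n) * exp (of_real (\<theta> * t)) \<partial>lborel) \<le> M * fact n / r ^ n"
proof -
  define K where "K = (\<lambda>t \<phi>. G t * exp ((of_real \<theta> + of_real r * cis \<phi>) * of_real t) * cis (- of_nat n * \<phi>))"
  have C: "C \<ge> 0" using order_trans[OF norm_ge_zero G[of 0]] by simp
  have Kb: "norm (K t \<phi>) \<le> C * exp (- (\<eta> - \<bar>\<theta>\<bar> - r) * \<bar>t\<bar>) * 1" for t \<phi>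
  proof -
    have "(\<theta> + r * cos \<phi>) * t \<le> (\<bar>\<theta>\<bar> + r) * \<bar>t\<bar>"
    proof -
      have "\<bar>r * cos \<phi>\<bar> \<le> r" using r by (simp add: abs_mult mult_left_le)
      then have "\<bar>\<theta> + r * cos \<phi>\<bar> \<le> \<bar>\<theta>\<bar> + r" by linarith
      then have "\<bar>\<theta> + r * cos \<phi>\<bar> * \<bar>t\<bar> \<le> (\<bar>\<theta>\<bar> + r) * \<bar>t\<bar>" by (intro mult_right_mono) auto
      then show ?thesis by (metis abs_le_D1 abs_mult)
    qed
    then have "norm (K t \<phi>) \<le> C * exp (- \<eta> * \<bar>t\<bar>) * exp ((\<bar>\<theta>\<bar> + r) * \<bar>t\<bar>)"
      unfolding K_def using C G[of t] by (auto simp: norm_mult intro!: mult_mono)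
    then show ?thesis by (simp add: mult.assoc flip: exp_add) (simp add: algebra_simps)
  qed
  have Kt: "(\<integral>\<phi>. K t \<phi> \<partial>circ) = G t * exp (of_real (\<theta> * t)) * (of_real (r * t) ^ n / fact n)" for t
  proof -
    have "(\<integral>\<phi>. K t \<phi> \<partial>circ) = (\<integral>\<phi>. (G t * exp (of_real (\<theta> * t))) * (exp (of_real (r * t) * cis \<phi>) * cis (- of_nat n * \<phi>)) \<partial>circ)"
      by (simp add: K_def ring_distribs exp_add mult_ac)
    also have "\<dots> = (G t * exp (of_real (\<theta> * t))) * (\<integral>\<phi>. exp (of_real (r * t) * cis \<phi>) * cis (- of_nat n * \<phi>) \<partial>circ)"
      by (rule integral_mult_right_zero)
    finally show ?thesis by (simp only: integral_circ_exp)
  qed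
  have "(\<integral>t. (\<integral>\<phi>. K t \<phi> \<partial>circ) \<partial>lborel) = (\<integral>\<phi>. (\<integral>t. K t \<phi> \<partial>lborel) \<partial>circ)"
  proof (rule integral_product_swap_bounded[OF _ _ _ _ _ _ _ Kb])
    show "(\<lambda>(x, y). K x y) \<in> borel_measurable (borel \<Otimes>\<^sub>M borel)" unfolding K_def by measurable
    show "integrable lborel (\<lambda>t. C * exp (- (\<eta> - \<bar>\<theta>\<bar> - r) * \<bar>t\<bar>))"
      using r by (intro integrable_mult_right integrable_exp_abs) auto
    show "integrable circ (\<lambda>_. 1::real)" by simp
  qed (auto intro: lborel.sigma_finite_measure_axioms circ.sigma_finite_measure_axioms)
  also have "norm \<dots> \<le> M"
  proof (rule norm_integral_circ_le)
    show "(\<lambda>\<phi>. \<integral>t. K t \<phi> \<partial>lborel) \<in> borel_measurable borel" unfolding K_def by measurable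
    fix \<phi>
    have "(\<integral>t. K t \<phi> \<partial>lborel) = (\<integral>t. G t * exp ((of_real \<theta> + of_real r * cis \<phi>) * of_real t) \<partial>lborel) * cis (- of_nat n * \<phi>)"
      unfolding K_def by (rule integral_mult_left_zero)
    also have "norm \<dots> \<le> M * 1"
      unfolding norm_mult using r order.trans[OF norm_ge_zero F[of "of_real \<theta>"]]
      by (intro mult_mono F) (auto simp: norm_mult)
    finally show "norm (\<integral>t. K t \<phi> \<partial>lborel) \<le> M" by simp
  qed
  finally have "norm (\<integral>t. G t * exp (of_real (\<theta> * t)) * (of_real (r * t) ^ n / fact n) \<partial>lborel) \<le> M"
    by (simp only: Kt)
  also have "(\<lambda>t. G t * exp (of_real (\<theta> * t)) * (of_real (r * t) ^ n / fact n)) = (\<lambda>t. of_real (r ^ n / fact n) * (G t * of_real (t ^ n) * exp (of_real (\<theta> * t))))"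
    by (auto simp: field_simps power_mult_distrib)
  also have "(\<integral>t. of_real (r ^ n / fact n) * (G t * of_real (t ^ n) * exp (of_real (\<theta> * t))) \<partial>lborel) = 
      of_real (r ^ n / fact n) * (\<integral>t. G t * of_real (t ^ n) * exp (of_real (\<theta> * t)) \<partial>lborel)"
    by (rule integral_mult_right_zero)
  finally show ?thesis using r by (simp add: norm_mult norm_divide norm_power field_simps)
qed

lemma power_exp_le:
  fixes e :: real
  assumes "e > 0"
  obtains K where "K > 0" "\<And>y. y \<ge> 0 \<Longrightarrow> y ^ n \<le> K * exp (e * y)"
proof (rule that[of "fact n / e ^ n"])
  fix y :: real assume y: "y \<ge> 0"
  have "(e * y) ^ n / fact n \<le> (\<Sum>i<Suc n. (e * y) ^ i / fact i)"
    using assms y by (intro member_le_sum) auto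
  also have "\<dots> \<le> exp (e * y)"
    using assms y exp_lower_Taylor_quadratic sum_le_suminf[OF summable_exp_generic[of "e * y"], of "{..<Suc n}"]
    by (simp add: exp_def field_simps scaleR_conv_of_real)
  finally show "y ^ n \<le> fact n / e ^ n * exp (e * y)" using assms by (simp add: field_simps power_mult_distrib)
qed (use assms in auto)

lemma integrable_power_exp:
  fixes G :: "real \<Rightarrow> complex"
  assumes [measurable]: "G \<in> borel_measurable borel"
    and G: "\<And>t. norm (G t) \<le> C * exp (- \<eta> * \<bar>t\<bar>)"
    and r: "\<bar>Re \<theta>\<bar> < \<eta>"
  shows "integrable lborel (\<lambda>t. G t * of_real (t ^ n) * exp (\<theta> * of_real t))"
proof -
  \<comment> \<open>Half of the exponential margin absorbs the power; the other half keeps the bound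
    integrable.\<close>
  obtain K where K: "K > 0" "\<And>y. y \<ge> 0 \<Longrightarrow> y ^ n \<le> K * exp ((\<eta> - \<bar>Re \<theta>\<bar>) / 2 * y)"
    using power_exp_le[of "(\<eta> - \<bar>Re \<theta>\<bar>)/2" n] r by auto
  show ?thesis
  proof (rule Bochner_Integration.integrable_bound)
    show "integrable lborel (\<lambda>t. (C * K) * exp (- ((\<eta> - \<bar>Re \<theta>\<bar>) / 2) * \<bar>t\<bar>))"
      using r by (intro integrable_mult_right integrable_exp_abs) auto
    show "AE t in lborel. norm (G t * of_real (t ^ n) * exp (\<theta> * of_real t)) \<le> norm (C * K * exp (- ((\<eta> - \<bar>Re \<theta>\<bar>) / 2) * \<bar>t\<bar>))"
    proof (rule AE_I2)
      fix t :: real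
      have "Re \<theta> * t \<le> \<bar>Re \<theta>\<bar> * \<bar>t\<bar>" by (metis abs_ge_self abs_mult)
      moreover have "C \<ge> 0" using order_trans[OF norm_ge_zero G[of 0]] by simp
      moreover have "K \<ge> 0" using K by simp
      ultimately have "norm (G t * of_real (t ^ n) * exp (\<theta> * of_real t)) \<le> (C * exp (- \<eta> * \<bar>t\<bar>)) * (K * exp ((\<eta> - \<bar>Re \<theta>\<bar>) / 2 * \<bar>t\<bar>)) * exp (\<bar>Re \<theta>\<bar> * \<bar>t\<bar>)"
        unfolding norm_mult using G[of t] K(2)[of "\<bar>t\<bar>"] 
        by (intro mult_mono) (auto simp: norm_power power_abs)
      also have "\<dots> = C * K * exp (- ((\<eta> - \<bar>Re \<theta>\<bar>) / 2) * \<bar>t\<bar>)"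
        by (simp add: mult_ac flip: exp_add) (simp add: field_simps)
      finally show "norm (G t * of_real (t ^ n) * exp (\<theta> * of_real t)) \<le> norm (C * K * exp (- ((\<eta> - \<bar>Re \<theta>\<bar>) / 2) * \<bar>t\<bar>))"
        by simp
    qed
  qed measurable
qed

lemma integral_poly_exp_le:
  fixes G :: "real \<Rightarrow> complex" and p :: "real poly"
  assumes G_meas: "G \<in> borel_measurable borel"
    and G: "\<And>t. norm (G t) \<le> C * exp (- \<eta> * \<bar>t\<bar>)"
    and r: "r > 0" "\<bar>\<theta>\<bar> + r < \<eta>"
    and F: "\<And>\<zeta>. norm (\<zeta> - of_real \<theta>) \<le> r \<Longrightarrow> norm (\<integral>t. G t * exp (\<zeta> * of_real t) \<partial>lborel) \<le> M"
  shows "norm (\<integral>t. G t * of_real (poly p t) * exp (of_real (\<theta> * t)) \<partial>lborel)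
    \<le> M * (\<Sum>n\<le>degree p. \<bar>coeff p n\<bar> * fact n / r ^ n)"
proof -
  let ?I = "\<lambda>n. \<integral>t. G t * of_real (t ^ n) * exp (of_real (\<theta> * t)) \<partial>lborel"
  have int: "integrable lborel (\<lambda>t. G t * of_real (t ^ n) * exp (of_real (\<theta> * t)))" for n
    using integrable_power_exp[OF G_meas G, of "of_real \<theta>" n] r by simp
  have "(\<integral>t. G t * of_real (poly p t) * exp (of_real (\<theta> * t)) \<partial>lborel)
     = (\<integral>t. (\<Sum>n\<le>degree p. of_real (coeff p n) * (G t * of_real (t ^ n) * exp (of_real (\<theta> * t)))) \<partial>lborel)"
    by (simp add: poly_altdef sum_distrib_left sum_distrib_right mult_ac)
  also have "\<dots> = (\<Sum>n\<le>degree p. of_real (coeff p n) * ?I n)"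
    using int by (subst Bochner_Integration.integral_sum) (auto simp del: of_real_mult of_real_power intro!: integrable_mult_right)
  also have "norm \<dots> \<le> (\<Sum>n\<le>degree p. \<bar>coeff p n\<bar> * (M * fact n / r ^ n))"
  proof (rule sum_norm_le)
    fix n
    show "norm (of_real (coeff p n) * ?I n) \<le> \<bar>coeff p n\<bar> * (M * fact n / r ^ n)"
      unfolding norm_mult norm_of_real
      by (rule mult_left_mono[OF integral_power_exp_le[OF G_meas G r F]]) auto
  qed
  finally show ?thesis by (simp add: sum_distrib_left mult_ac)
qed

section \<open>Growth and coefficients of even polynomials with sparse zeros\<close>

lemma prod_poly_majorant:
  fixes Z :: "real set"
  defines "p \<equiv> (\<Prod>\<tau>\<in>Z. [:1, 0, - 1/\<tau>\<^sup>2:])" and "q \<equiv> (\<Prod>\<tau>\<in>Z. [:1, 0, 1/\<tau>\<^sup>2:])"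
  shows "\<bar>coeff p n\<bar> \<le> coeff q n"
  unfolding p_def q_def
proof (induction Z arbitrary: n rule: infinite_finite_induct)
  case (insert \<tau> Z)
  have "\<bar>coeff ([:1, 0, - 1/\<tau>\<^sup>2:] * (\<Prod>\<tau>\<in>Z. [:1, 0, - 1/\<tau>\<^sup>2:])) n\<bar> \<le> coeff ([:1, 0, 1/\<tau>\<^sup>2:] * (\<Prod>\<tau>\<in>Z. [:1, 0, 1/\<tau>\<^sup>2:])) n"
    unfolding coeff_mult
  proof (rule order.trans[OF sum_abs], rule sum_mono)
    fix i
    have *: "\<bar>coeff [:1, 0, - 1/\<tau>\<^sup>2:] i\<bar> \<le> coeff [:1, 0, 1/\<tau>\<^sup>2:] i"
      by (auto simp: coeff_pCons split: nat.splits)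
    then have "0 \<le> coeff [:1, 0, 1/\<tau>\<^sup>2:] i" by linarith
    with * show "\<bar>coeff [:1, 0, - 1/\<tau>\<^sup>2:] i * coeff (\<Prod>\<tau>\<in>Z. [:1, 0, - 1/\<tau>\<^sup>2:]) (n - i)\<bar>
        \<le> coeff [:1, 0, 1/\<tau>\<^sup>2:] i * coeff (\<Prod>\<tau>\<in>Z. [:1, 0, 1/\<tau>\<^sup>2:]) (n - i)"
      unfolding abs_mult by (rule mult_mono[OF _ insert.IH]) auto
  qed
  then show ?case using insert by simp
qed auto

text \<open>The majorant \<open>q\<close> has nonnegative coefficients, so each of them is at most
  \<open>B * exp (A * sqrt x) / x ^ n\<close> for every \<open>x > 0\<close>. A choice of x adapted
  to n beats the factorials of Cauchy's estimates and leaves a geometric series; the growth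
  \<open>exp (A * sqrt x)\<close> becomes the factor \<open>exp (A\<^sup>2 / r)\<close>.\<close>

lemma sum_coeff_fact_le:
  fixes p q :: "real poly"
  assumes maj: "\<And>n. \<bar>coeff p n\<bar> \<le> coeff q n"
    and q: "\<And>x. x \<ge> 0 \<Longrightarrow> poly q x \<le> B * exp (A * sqrt x)" and r: "r > 0"
  shows "(\<Sum>n\<le>degree p. \<bar>coeff p n\<bar> * fact n / r ^ n) \<le> 4 * B * exp (A\<^sup>2 / r)"
proof -
  have q0: "coeff q n \<ge> 0" for n using maj[of n] by linarith
  have c: "coeff q n * x ^ n \<le> B * exp (A * sqrt x)" if "x \<ge> 0" for n x
  proof (cases "n \<le> degree q")
    case True
    then have "coeff q n * x ^ n \<le> poly q x"
      unfolding poly_altdef using that q0 by (intro member_le_sum) auto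
    with q[OF that] show ?thesis by simp
  next
    case False
    have "0 \<le> poly q x" unfolding poly_altdef using that q0 by (intro sum_nonneg) auto
    with q[OF that] False show ?thesis by (simp add: coeff_eq_0)
  qed
  have B: "B \<ge> 0" using c[of 0 0] q0[of 0] by simp
  have t: "\<bar>coeff p n\<bar> * fact n / r ^ n \<le> B * exp (A\<^sup>2 / r) * (3/4) ^ n" for n
  proof -
    \<comment> \<open>Completing the square, the growth bound at this x exceeds
      \<open>exp (A\<^sup>2 / r)\<close> by at most \<open>exp n\<close>, while
      \<open>n ^ n / r ^ n\<close> is \<open>x ^ n / 4 ^ n\<close>. Since
      \<open>exp 1 \<le> 3\<close>, the ratio is 3/4, whose geometric sum is the 4 of the
      conclusion.\<close>
    define x where "x = 4 * real n / r"
    have x: "x \<ge> 0" using r by (simp add: x_def)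
    have "A * sqrt x \<le> A\<^sup>2 / r + real n"
    proof -
      have "0 \<le> (A / sqrt r - sqrt (real n))\<^sup>2" by simp
      also have "\<dots> = A\<^sup>2 / r + real n - 2 * A * sqrt (real n) / sqrt r"
        using r by (simp add: power2_diff power_divide)
      also have "2 * A * sqrt (real n) / sqrt r = A * sqrt x"
        unfolding x_def by (simp add: real_sqrt_divide real_sqrt_mult)
      finally show ?thesis by simp
    qed
    then have "coeff q n * x ^ n \<le> B * (exp (A\<^sup>2 / r) * exp (real n))"
      using c[OF x, of n] B by (smt (verit) exp_add exp_le_cancel_iff mult_left_mono)
    also have "\<dots> \<le> B * (exp (A\<^sup>2 / r) * 3 ^ n)"
    proof -
      have "exp (real n) = exp 1 ^ n" by (simp flip: exp_of_nat_mult)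
      also have "\<dots> \<le> 3 ^ n" by (intro power_mono exp_le) auto
      finally show ?thesis using B by (intro mult_left_mono) auto
    qed
    finally have 1: "\<bar>coeff p n\<bar> * x ^ n \<le> B * (exp (A\<^sup>2 / r) * 3 ^ n)"
      using maj[of n] x by (smt (verit) mult_right_mono zero_le_power)
    have "(fact n :: real) \<le> real n ^ n"
      using fact_le_power[of n, where 'a=real] by simp
    then have "\<bar>coeff p n\<bar> * fact n / r ^ n \<le> \<bar>coeff p n\<bar> * real n ^ n / r ^ n"
      using r by (intro divide_right_mono mult_left_mono) auto
    also have "\<dots> = \<bar>coeff p n\<bar> * x ^ n / 4 ^ n" by (simp add: x_def power_divide power_mult_distrib)
    also have "\<dots> \<le> B * (exp (A\<^sup>2 / r) * 3 ^ n) / 4 ^ n" using 1 by (intro divide_right_mono) auto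
    finally show ?thesis by (simp add: power_divide)
  qed
  have "(\<Sum>n\<le>degree p. \<bar>coeff p n\<bar> * fact n / r ^ n) \<le> (\<Sum>n\<le>degree p. B * exp (A\<^sup>2 / r) * (3/4) ^ n)"
    by (intro sum_mono t)
  also have "\<dots> = B * exp (A\<^sup>2 / r) * (\<Sum>n<Suc (degree p). (3/4) ^ n)" by (simp add: sum_distrib_left lessThan_Suc_atMost)
  also have "\<dots> \<le> B * exp (A\<^sup>2 / r) * (\<Sum>n. (3/4) ^ n)"
    using B by (intro mult_left_mono sum_le_suminf summable_geometric) auto
  also have "(\<Sum>n. (3/4) ^ n) = (4::real)" by (subst suminf_geometric) auto
  finally show ?thesis by simp
qed

text \<open>Euler's product for the sine at \<open>\<i> * y\<close> gives
  \<open>sinh (pi * y) / (pi * y)\<close> as the limit of the partial products. They increase, so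
  each is below the limit, and that is at most \<open>exp (pi * y)\<close>.\<close>

lemma prod_one_plus_div_square_le:
  fixes y :: real
  assumes y: "y \<ge> 0"
  shows "(\<Prod>k=1..n. 1 + y\<^sup>2 / (real k)\<^sup>2) \<le> exp (pi * y)"
proof (cases "y = 0")
  case False
  with y have y: "y > 0" by simp
  let ?P = "\<lambda>n. \<Prod>k=1..n. 1 + y\<^sup>2 / (real k)\<^sup>2"
  have "(\<lambda>n. of_real pi * (\<i> * of_real y) * (\<Prod>k=1..n. 1 - (\<i> * of_real y)\<^sup>2 / (of_nat k)\<^sup>2)) \<longlonglongrightarrow> sin (of_real pi * (\<i> * of_real y))"
    by (rule sin_product_formula_complex)
  also have "(\<lambda>n. of_real pi * (\<i> * of_real y) * (\<Prod>k=1..n. 1 - (\<i> * of_real y)\<^sup>2 / (of_nat k)\<^sup>2)) = (\<lambda>n. \<i> * of_real (pi * y * ?P n))"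
    by (simp add: power_mult_distrib mult_ac)
  also have "sin (of_real pi * (\<i> * of_real y)) = \<i> * of_real ((exp (pi * y) - exp (- (pi * y))) / 2)"
  proof -
    have "exp (of_real pi * of_real y :: complex) = of_real (exp (pi * y))"
      "exp (- (of_real pi * of_real y) :: complex) = of_real (exp (- (pi * y)))"
      by (simp_all flip: exp_of_real)
    then show ?thesis by (simp add: sin_exp_eq divide_simps mult_ac)
  qed
  finally have "(\<lambda>n. Im (\<i> * of_real (pi * y * ?P n))) \<longlonglongrightarrow> Im (\<i> * of_real ((exp (pi * y) - exp (- (pi * y))) / 2))"
    by (rule tendsto_Im)
  then have lim: "(\<lambda>n. pi * y * ?P n) \<longlonglongrightarrow> (exp (pi * y) - exp (- (pi * y))) / 2"
    by (simp only: Im_i_times Re_complex_of_real)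
  have "incseq (\<lambda>n. pi * y * ?P n)"
  proof (rule incseq_SucI)
    fix n
    have "?P n * 1 \<le> ?P n * (1 + y\<^sup>2 / (real (Suc n))\<^sup>2)"
      by (intro mult_left_mono prod_nonneg) auto
    then show "pi * y * ?P n \<le> pi * y * ?P (Suc n)" using y by (intro mult_left_mono) auto
  qed
  from incseq_le[OF this lim] have "pi * y * ?P n \<le> (exp (pi * y) - exp (- (pi * y))) / 2" .
  \<comment> \<open>This is \<open>sinh u \<le> u * exp u\<close> for \<open>u = pi * y\<close>,
    from \<open>exp (- 2 * u) \<ge> 1 - 2 * u\<close>.\<close>
  also have "\<dots> \<le> pi * y * exp (pi * y)"
  proof -
    have "exp (- (pi * y)) = exp (- (2 * (pi * y))) * exp (pi * y)" by (simp flip: exp_add)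
    also have "\<dots> \<ge> (1 - 2 * (pi * y)) * exp (pi * y)"
      using exp_ge_add_one_self[of "- (2 * (pi * y))"] by (intro mult_right_mono) auto
    finally show ?thesis by (simp add: field_simps)
  qed
  finally show ?thesis using y by simp
qed auto

text \<open>If \<open>\<tau>\<close> has rank n in Z, then \<open>n \<le> d * sqrt \<tau>\<close>,
  so \<open>x / \<tau> \<le> (d * sqrt x)\<^sup>2 / n\<^sup>2\<close>, and
  \<open>1 + x\<^sup>2/\<tau>\<^sup>2 \<le> (1 + x/\<tau>)\<^sup>2\<close> reduces the product to
  the square of the sinh product at \<open>y = d * sqrt x\<close>. That gives
  \<open>exp (2 * pi * y) \<le> exp (8 * y)\<close>; the finitely many points up to T0 account for
  the ninth d. One B serves all finite subsets, which is what permits truncating the zero set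
  later.\<close>

lemma prod_one_plus_square_growth:
  fixes Z :: "real set"
  assumes pos: "\<And>\<tau>. \<tau> \<in> Z \<Longrightarrow> \<tau> > 0" and d: "d > 0"
    and cnt: "\<And>T. T \<ge> T0 \<Longrightarrow> finite (Z \<inter> {..T}) \<and> real (card (Z \<inter> {..T})) \<le> d * sqrt T"
  obtains B where "B > 0"
    "\<And>Z' x. finite Z' \<Longrightarrow> Z' \<subseteq> Z \<Longrightarrow> x \<ge> 0 \<Longrightarrow> (\<Prod>\<tau>\<in>Z'. 1 + x\<^sup>2/\<tau>\<^sup>2) \<le> B * exp (9 * d * sqrt x)"
proof -
  define S where "S = Z \<inter> {..T0}"
  have S: "finite S" using cnt[of T0] by (simp add: S_def)
  \<comment> \<open>Each point of S is allowed the exponential rate e, and all of them together stay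
    below d.\<close>
  define e where "e = d / (card S + 1)"
  have e: "e > 0" using d by (simp add: e_def)
  have "\<exists>K. \<tau> \<in> S \<longrightarrow> K > 0 \<and> (\<forall>x\<ge>0. 1 + x\<^sup>2/\<tau>\<^sup>2 \<le> K * exp (e * sqrt x))" for \<tau>
  proof (cases "\<tau> \<in> S")
    case True
    then have \<tau>: "\<tau> > 0" using pos by (auto simp: S_def)
    obtain K where K: "K > 0" "\<And>y. y \<ge> 0 \<Longrightarrow> y ^ 4 \<le> K * exp (e * y)" using power_exp_le[OF e] by metis
    have "1 + x\<^sup>2/\<tau>\<^sup>2 \<le> (1 + K / \<tau>\<^sup>2) * exp (e * sqrt x)" if "x \<ge> 0" for x
    proof -
      have "x\<^sup>2 = sqrt x ^ 4" using that by (simp add: power4_eq_xxxx power2_eq_square)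
      then have "x\<^sup>2/\<tau>\<^sup>2 \<le> K * exp (e * sqrt x) / \<tau>\<^sup>2" using K(2)[of "sqrt x"] that by (intro divide_right_mono) auto
      moreover have "1 \<le> exp (e * sqrt x)" using e that by simp
      ultimately show ?thesis by (simp add: ring_distribs del: one_le_exp_iff)
    qed
    moreover have "1 + K / \<tau>\<^sup>2 > 0" using K \<tau> by (simp add: add_pos_pos)
    ultimately show ?thesis by blast
  qed auto
  then obtain K where K: "\<And>\<tau>. \<tau> \<in> S \<Longrightarrow> K \<tau> > 0" "\<And>\<tau> x. \<tau> \<in> S \<Longrightarrow> x \<ge> 0 \<Longrightarrow> 1 + x\<^sup>2/\<tau>\<^sup>2 \<le> K \<tau> * exp (e * sqrt x)"
    by metis
  define B where "B = (\<Prod>\<tau>\<in>S. K \<tau>)"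
  have Bpos: "B > 0" unfolding B_def using K by (intro prod_pos) auto
  \<comment> \<open>The rank of a point in Z, injective beyond T0: distinct ranks let the product be
    compared with one over an initial segment of the positive integers.\<close>
  define idx where "idx = (\<lambda>\<tau>. card (Z \<inter> {..\<tau>}))"
  have idx_mono: "idx \<tau> < idx \<tau>'" if "\<tau>' \<in> Z" "\<tau>' > T0" "\<tau> < \<tau>'" for \<tau> \<tau>'
  proof -
    have "\<tau>' \<in> Z \<inter> {..\<tau>'}" "\<tau>' \<notin> Z \<inter> {..\<tau>}" using that by auto
    moreover have "Z \<inter> {..\<tau>} \<subseteq> Z \<inter> {..\<tau>'}" using that by auto
    ultimately have "Z \<inter> {..\<tau>} \<subset> Z \<inter> {..\<tau>'}" by blast
    then show ?thesis
      unfolding idx_def using that cnt[of \<tau>'] by (intro psubset_card_mono) auto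
  qed
  show thesis
  proof (rule that[OF Bpos])
    fix Z' x assume fin: "finite Z'" and sub: "Z' \<subseteq> Z" and x: "(x::real) \<ge> 0"
    let ?f = "\<lambda>\<tau>::real. 1 + x\<^sup>2/\<tau>\<^sup>2"
    define L where "L = Z' - S"
    have L: "\<tau> \<in> Z" "\<tau> > T0" "\<tau> > 0" if "\<tau> \<in> L" for \<tau> using that sub pos by (auto simp: L_def S_def)
    have split: "(\<Prod>\<tau>\<in>Z'. ?f \<tau>) = (\<Prod>\<tau>\<in>Z' \<inter> S. ?f \<tau>) * (\<Prod>\<tau>\<in>L. ?f \<tau>)"
      using fin by (subst prod.union_disjoint[symmetric]) (auto simp: L_def intro!: prod.cong)
    have "(\<Prod>\<tau>\<in>Z' \<inter> S. ?f \<tau>) \<le> (\<Prod>\<tau>\<in>S. ?f \<tau>)"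
      using S by (intro prod_mono2) (auto intro!: add_nonneg_nonneg)
    also have "(\<Prod>\<tau>\<in>S. ?f \<tau>) \<le> (\<Prod>\<tau>\<in>S. K \<tau> * exp (e * sqrt x))"
      using K x by (intro prod_mono) (auto intro!: add_nonneg_nonneg)
    also have "\<dots> = B * exp (real (card S) * e * sqrt x)"
      by (simp add: prod.distrib B_def mult.assoc exp_of_nat_mult)
    also have "\<dots> \<le> B * exp (d * sqrt x)"
    proof -
      have "real (card S) * e \<le> d" using d by (simp add: e_def field_simps)
      then show ?thesis using Bpos x by (intro mult_left_mono) (auto intro!: mult_right_mono)
    qed
    finally have small: "(\<Prod>\<tau>\<in>Z' \<inter> S. ?f \<tau>) \<le> B * exp (d * sqrt x)" .
    have large: "(\<Prod>\<tau>\<in>L. ?f \<tau>) \<le> exp (8 * d * sqrt x)"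
    proof -
      define y where "y = d * sqrt x"
      have y: "y \<ge> 0" using d x by (simp add: y_def)
      define n where "n = Max (insert 0 (idx ` L))"
      have finL: "finite L" using fin by (simp add: L_def)
      have idxL: "idx ` L \<subseteq> {1..n}"
      proof -
        \<comment> \<open>Comparison with \<open>\<tau> - 1\<close> shows that the rank exceeds some
          natural number.\<close>
        have "idx \<tau> \<noteq> 0" if "\<tau> \<in> L" for \<tau>
          using idx_mono[of \<tau> "\<tau> - 1"] L that by auto
        moreover have "idx \<tau> \<le> n" if "\<tau> \<in> L" for \<tau> unfolding n_def using finL that by (intro Max_ge) auto
        ultimately show ?thesis by (auto simp: Suc_le_eq)
      qed
      have inj: "inj_on idx L"
      proof (rule linorder_inj_onI)
        fix \<tau> \<tau>' assume "\<tau> < \<tau>'" "\<tau> \<in> L" "\<tau>' \<in> L"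
        then show "idx \<tau> \<noteq> idx \<tau>'" using idx_mono[of \<tau>' \<tau>] L(1,2)[of \<tau>'] by simp
      qed auto
      have f: "?f \<tau> \<le> (1 + y\<^sup>2 / (real (idx \<tau>))\<^sup>2)\<^sup>2" if "\<tau> \<in> L" for \<tau>
      proof -
        note Lt = L[OF that]
        have i0: "real (idx \<tau>) > 0" using idxL that by auto
        have "real (idx \<tau>) \<le> d * sqrt \<tau>" using cnt[of \<tau>] Lt by (simp add: idx_def)
        then have "(real (idx \<tau>))\<^sup>2 \<le> d\<^sup>2 * \<tau>" using power_mono[of "real (idx \<tau>)" "d * sqrt \<tau>" 2] i0 Lt by (simp add: power_mult_distrib)
        then have "x / \<tau> \<le> y\<^sup>2 / (real (idx \<tau>))\<^sup>2"
          unfolding y_def using i0 Lt x mult_right_mono[of "(real (idx \<tau>))\<^sup>2" "d\<^sup>2 * \<tau>" x] by (simp add: power_mult_distrib field_simps)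
        then have "(1 + x / \<tau>)\<^sup>2 \<le> (1 + y\<^sup>2 / (real (idx \<tau>))\<^sup>2)\<^sup>2" using x Lt by (intro power_mono) auto
        moreover have "?f \<tau> \<le> (1 + x / \<tau>)\<^sup>2" using x Lt by (simp add: power2_sum power_divide)
        ultimately show ?thesis by linarith
      qed
      have "(\<Prod>\<tau>\<in>L. ?f \<tau>) \<le> (\<Prod>\<tau>\<in>L. (1 + y\<^sup>2 / (real (idx \<tau>))\<^sup>2)\<^sup>2)"
        using f by (intro prod_mono) (auto intro!: add_nonneg_nonneg)
      also have "\<dots> = (\<Prod>i\<in>idx ` L. (1 + y\<^sup>2 / (real i)\<^sup>2)\<^sup>2)"
        by (subst prod.reindex[OF inj]) simp
      also have "\<dots> \<le> (\<Prod>i=1..n. (1 + y\<^sup>2 / (real i)\<^sup>2)\<^sup>2)"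
        using idxL by (intro prod_mono2) (auto intro!: one_le_power)
      also have "\<dots> = (\<Prod>i=1..n. 1 + y\<^sup>2 / (real i)\<^sup>2)\<^sup>2" by (rule prod_power_distrib[symmetric])
      also have "\<dots> \<le> (exp (pi * y))\<^sup>2"
        using prod_one_plus_div_square_le[OF y] by (intro power_mono prod_nonneg) (auto intro!: add_nonneg_nonneg)
      also have "\<dots> = exp (2 * pi * y)" by (simp add: power2_eq_square flip: exp_add)
      also have "\<dots> \<le> exp (8 * y)"
        using y pi_less_4 by (simp add: mult_right_mono)
      finally show ?thesis by (simp add: y_def mult.assoc)
    qed
    have "(\<Prod>\<tau>\<in>Z'. ?f \<tau>) \<le> (B * exp (d * sqrt x)) * exp (8 * d * sqrt x)"
      unfolding split using Bpos by (intro mult_mono small large prod_nonneg) (auto intro!: add_nonneg_nonneg)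
    also have "\<dots> = B * exp (9 * d * sqrt x)"
      by (simp add: mult.assoc flip: exp_add)
    finally show "(\<Prod>\<tau>\<in>Z'. ?f \<tau>) \<le> B * exp (9 * d * sqrt x)" .
  qed
qed

section \<open>Sign changes of a continuous function, and elementary product inequalities\<close>

lemma constant_sign_interval:
  fixes G :: "real \<Rightarrow> real"
  assumes "continuous_on {a<..<b} G" "\<And>t. t \<in> {a<..<b} \<Longrightarrow> G t \<noteq> 0"
  obtains s where "s \<in> {1, -1}" "\<And>t. t \<in> {a<..<b} \<Longrightarrow> s * G t > 0"
proof -
  have con: "connected (G ` {a<..<b})" by (intro connected_continuous_image assms(1)) auto
  have *: False if "x \<in> {a<..<b}" "y \<in> {a<..<b}" "G x < 0" "0 < G y" for x y
  proof -
    have "0 \<in> G ` {a<..<b}"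
      by (rule connectedD_interval[OF con, of "G x" "G y"]) (use that in auto)
    then show False using assms(2) by force
  qed
  show thesis
  proof (cases "\<exists>t\<in>{a<..<b}. G t > 0")
    case True
    then obtain y where "y \<in> {a<..<b}" "G y > 0" by blast
    then have "1 * G t > 0" if "t \<in> {a<..<b}" for t
      using *[of t y] that assms(2)[OF that] by (cases "G t < 0") auto
    then show thesis using that[of 1] by blast
  next
    case False
    have "- 1 * G t > 0" if "t \<in> {a<..<b}" for t
      using that assms(2)[OF that] False by (metis linorder_neqE_linordered_idom mult_minus1 neg_0_less_iff_less)
    then show thesis using that[of "-1"] by blast
  qed
qed

text \<open>Induction on the number of zeros, removing the largest zero m: on the last interval the
  function times the factors found so far has constant sign, and the factor \<open>m - t\<close> is
  added exactly when that sign is wrong. So Z collects the sign changes and omits zeros without one;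
  no notion of multiplicity enters.\<close>

lemma sign_pattern:
  fixes G :: "real \<Rightarrow> real"
  assumes "finite S" "continuous_on {0<..<N} G" "{t\<in>{0<..<N}. G t = 0} = S"
  shows "\<exists>Z\<subseteq>S. \<exists>s\<in>{1,-1}. \<forall>t\<in>{0<..<N}. s * G t * (\<Prod>\<tau>\<in>Z. \<tau> - t) \<ge> 0"
  using assms
proof (induction "card S" arbitrary: S N)
  case 0
  then have "S = {}" by simp
  with 0 obtain s where "s \<in> {1, -1}" "\<And>t. t \<in> {0<..<N} \<Longrightarrow> s * G t > 0"
    using constant_sign_interval[of 0 N G] by blast
  then show ?case by (intro exI[of _ "{}"] conjI bexI[of _ s]) (auto intro: less_imp_le)
next
  case (Suc n)
  have Sne: "S \<noteq> {}" using Suc by auto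
  define m where "m = Max S"
  have m: "m \<in> S" "\<And>t. t \<in> S \<Longrightarrow> t \<le> m" unfolding m_def using Suc Sne by auto
  have mN: "0 < m" "m < N" "G m = 0" using m(1) Suc.prems(3) by auto
  have "\<exists>Z\<subseteq>S - {m}. \<exists>s\<in>{1,-1}. \<forall>t\<in>{0<..<m}. s * G t * (\<Prod>\<tau>\<in>Z. \<tau> - t) \<ge> 0"
  proof (rule Suc.hyps)
    show "n = card (S - {m})" using Suc m by simp
    show "continuous_on {0<..<m} G" using Suc.prems(2) by (rule continuous_on_subset) (use mN in auto)
    show "{t\<in>{0<..<m}. G t = 0} = S - {m}"
      using Suc.prems(3) m mN by (auto simp: order.order_iff_strict)
  qed (use Suc in auto)
  then obtain Z s where Z: "Z \<subseteq> S - {m}" "s \<in> {1,-1}" "\<And>t. t \<in> {0<..<m} \<Longrightarrow> s * G t * (\<Prod>\<tau>\<in>Z. \<tau> - t) \<ge> 0" by blast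
  have finZ: "finite Z" using Z Suc.prems finite_subset by blast
  have "continuous_on {m<..<N} G" using Suc.prems(2) by (rule continuous_on_subset) (use mN in auto)
  moreover have "G t \<noteq> 0" if "t \<in> {m<..<N}" for t using that m(2)[of t] Suc.prems(3) mN by force
  moreover have "(\<Prod>\<tau>\<in>Z. \<tau> - t) \<noteq> 0" if "t \<in> {m<..<N}" for t
    using that m(2) Z(1) by (subst prod_zero_iff[OF finZ]) force
  moreover have "s \<noteq> 0" using Z(2) by auto
  ultimately have "continuous_on {m<..<N} (\<lambda>t. s * G t * (\<Prod>\<tau>\<in>Z. \<tau> - t))"
     "\<And>t. t \<in> {m<..<N} \<Longrightarrow> s * G t * (\<Prod>\<tau>\<in>Z. \<tau> - t) \<noteq> 0"
    by (auto intro!: continuous_intros)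
  then obtain s' where s': "s' \<in> {1, -1}" "\<And>t. t \<in> {m<..<N} \<Longrightarrow> s' * (s * G t * (\<Prod>\<tau>\<in>Z. \<tau> - t)) > 0"
    using constant_sign_interval by blast
  show ?case
  proof (cases "s' = 1")
    case True
    have "s * G t * (\<Prod>\<tau>\<in>Z. \<tau> - t) \<ge> 0" if "t \<in> {0<..<N}" for t
      using that Z(3)[of t] s'(2)[of t] True mN by (cases t m rule: linorder_cases) (auto intro: less_imp_le)
    then show ?thesis using Z by blast
  next
    case False
    then have s'1: "s' = -1" using s' by simp
    have "s * G t * (\<Prod>\<tau>\<in>insert m Z. \<tau> - t) \<ge> 0" if "t \<in> {0<..<N}" for t
    proof -
      have eq: "s * G t * (\<Prod>\<tau>\<in>insert m Z. \<tau> - t) = (s * G t * (\<Prod>\<tau>\<in>Z. \<tau> - t)) * (m - t)"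
        using finZ Z by (subst prod.insert) (auto simp: mult_ac)
      show ?thesis unfolding eq
        using that Z(3)[of t] s'(2)[of t] s'1 mN
        by (cases t m rule: linorder_cases) (auto intro!: mult_nonneg_nonneg mult_nonpos_nonpos)
    qed
    then show ?thesis using Z m by (intro exI[of _ "insert m Z"]) blast
  qed
qed

lemma one_plus_sum_le_prod:
  fixes x :: "'a \<Rightarrow> real"
  assumes "finite Z" "\<And>i. i \<in> Z \<Longrightarrow> x i \<ge> 0"
  shows "1 + (\<Sum>i\<in>Z. x i) \<le> (\<Prod>i\<in>Z. 1 + x i)"
  using assms
proof (induction Z)
  case (insert i Z)
  have "(1 + (\<Sum>i\<in>Z. x i)) * (1 + x i) \<le> (\<Prod>i\<in>Z. 1 + x i) * (1 + x i)"
    using insert by (intro mult_right_mono) auto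
  moreover have "0 \<le> (\<Sum>i\<in>Z. x i) * x i" using insert by (intro mult_nonneg_nonneg sum_nonneg) auto
  ultimately show ?case using insert by (simp add: algebra_simps)
qed auto

lemma one_minus_sum_le_prod:
  fixes x :: "'a \<Rightarrow> real"
  assumes "finite Z" "\<And>i. i \<in> Z \<Longrightarrow> 0 \<le> x i \<and> x i \<le> 1"
  shows "1 - (\<Sum>i\<in>Z. x i) \<le> (\<Prod>i\<in>Z. 1 - x i)"
  using assms
proof (induction Z)
  case (insert i Z)
  have "(1 - (\<Sum>i\<in>Z. x i)) * (1 - x i) \<le> (\<Prod>i\<in>Z. 1 - x i) * (1 - x i)"
    using insert by (intro mult_right_mono) auto
  moreover have "0 \<le> (\<Sum>i\<in>Z. x i) * x i" using insert by (intro mult_nonneg_nonneg sum_nonneg) auto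
  ultimately show ?case using insert by (simp add: algebra_simps)
qed auto

text \<open>The transform bound makes the integral of
  \<open>G t * poly p t * exp (\<theta> * t)\<close> tend to 0 with \<open>\<delta>\<close>, while
  the lower bound comes from a fixed interval near 0 and depends neither on \<open>\<delta>\<close>
  nor on the truncation N. The order of the choices matters: B, \<open>\<rho>\<close> and
  \<open>\<mu>\<close> come from G and its zeros, then \<open>\<delta>\<close> is chosen, then N,
  and only then the polynomial.\<close>

lemma zeros_not_sparse:
  fixes G :: "real \<Rightarrow> real"
  assumes cont: "continuous_on UNIV G"
    and \<sigma>: "\<sigma> \<in> {1, -1}" and par: "\<And>t. G (- t) = \<sigma> * G t"
    and decay: "\<And>\<eta>. 0 < \<eta> \<Longrightarrow> \<eta> < pi/2 \<Longrightarrow> \<exists>C. \<forall>t. \<bar>G t\<bar> \<le> C * exp (- \<eta> * \<bar>t\<bar>)"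
    and \<delta>1: "\<delta>1 > 0"
    and small: "\<And>\<delta> \<zeta>. 0 < \<delta> \<Longrightarrow> \<delta> < \<delta>1 \<Longrightarrow> norm (\<zeta> - of_real (pi/2 - \<delta>)) \<le> \<delta>/8 \<Longrightarrow>
       norm (\<integral>t. complex_of_real (G t) * exp (\<zeta> * of_real t) \<partial>lborel) \<le> C1 * exp (- 1/\<delta>)"
    and cnt: "\<And>T. T \<ge> T0 \<Longrightarrow> finite {t\<in>{0..T}. G t = 0} \<and> real (card {t\<in>{0..T}. G t = 0}) \<le> 1/40 * sqrt T"
  shows False
proof -
  define d :: real where "d = 1/40"
  have [measurable]: "G \<in> borel_measurable borel" using cont by (rule borel_measurable_continuous_onI)
  define Z where "Z = {t. 0 < t \<and> G t = 0}"
  have Zfin: "finite (Z \<inter> {..T})" for T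
  proof (rule finite_subset)
    show "Z \<inter> {..T} \<subseteq> {t\<in>{0..max T T0}. G t = 0}" by (auto simp: Z_def)
  qed (use cnt[of "max T T0"] in auto)
  have Zcard: "finite (Z \<inter> {..T}) \<and> real (card (Z \<inter> {..T})) \<le> d * sqrt T" if "T \<ge> T0" for T
  proof -
    have "card (Z \<inter> {..T}) \<le> card {t\<in>{0..T}. G t = 0}"
      using cnt[OF that] by (intro card_mono) (auto simp: Z_def)
    then show ?thesis using cnt[OF that] Zfin[of T] unfolding d_def by (auto intro: order.trans)
  qed
  obtain B where B: "B > 0"
    "\<And>Z' x. finite Z' \<Longrightarrow> Z' \<subseteq> Z \<Longrightarrow> x \<ge> 0 \<Longrightarrow> (\<Prod>\<tau>\<in>Z'. 1 + x\<^sup>2/\<tau>\<^sup>2) \<le> B * exp (9 * d * sqrt x)"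
    by (rule prod_one_plus_square_growth[of Z d T0]) (use Zcard in \<open>auto simp: Z_def d_def\<close>)
  \<comment> \<open>The growth bound at \<open>x = 1\<close> also controls the sum of
    \<open>1/\<tau>\<^sup>2\<close>, uniformly over finite subsets.\<close>
  define S1 where "S1 = B * exp (9 * d)"
  have S1: "S1 > 0" using B by (simp add: S1_def)
  have S1_bound: "(\<Sum>\<tau>\<in>Z'. 1/\<tau>\<^sup>2) \<le> S1" if "finite Z'" "Z' \<subseteq> Z" for Z'
    using one_plus_sum_le_prod[of Z' "\<lambda>\<tau>. 1/\<tau>\<^sup>2"] B(2)[of Z' 1] that by (simp add: S1_def)
  define \<rho>0 where "\<rho>0 = Min (insert 1 (Z \<inter> {..1}))"
  have \<rho>0: "\<rho>0 > 0" "\<rho>0 \<le> 1" unfolding \<rho>0_def using Zfin[of 1] by (auto simp: Z_def)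
  have \<rho>0Z: "\<rho>0 \<le> \<tau>" if "\<tau> \<in> Z" for \<tau>
  proof (cases "\<tau> \<le> 1")
    case True
    then show ?thesis unfolding \<rho>0_def using Zfin[of 1] that by (intro Min_le) auto
  qed (use \<rho>0 in auto)
  \<comment> \<open>At most every positive zero, and small enough that the product is at least 1/2
    on \<open>{0..\<rho>}\<close> for every finite subset of Z.\<close>
  define \<rho> where "\<rho> = min \<rho>0 (sqrt (1 / (2 * S1)))"
  have \<rho>: "\<rho> > 0" "\<rho> \<le> 1" using \<rho>0 S1 by (auto simp: \<rho>_def)
  have \<rho>2: "\<rho>\<^sup>2 * S1 \<le> 1/2"
  proof -
    have "\<rho>\<^sup>2 \<le> (sqrt (1 / (2 * S1)))\<^sup>2" using \<rho> by (intro power_mono) (auto simp: \<rho>_def)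
    then show ?thesis using S1 by (simp add: field_simps)
  qed
  have \<rho>Z: "\<rho> \<le> \<tau>" if "\<tau> \<in> Z" for \<tau> using \<rho>0Z[OF that] by (simp add: \<rho>_def)
  have P_half: "1/2 \<le> (\<Prod>\<tau>\<in>Z'. 1 - t\<^sup>2/\<tau>\<^sup>2)" if "finite Z'" "Z' \<subseteq> Z" "0 \<le> t" "t \<le> \<rho>" for Z' t
  proof -
    have "1 - (\<Sum>\<tau>\<in>Z'. t\<^sup>2/\<tau>\<^sup>2) \<le> (\<Prod>\<tau>\<in>Z'. 1 - t\<^sup>2/\<tau>\<^sup>2)"
    proof (rule one_minus_sum_le_prod)
      fix \<tau> assume "\<tau> \<in> Z'"
      then have "t \<le> \<tau>" "\<tau> > 0" using \<rho>Z[of \<tau>] that \<rho> by auto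
      then show "0 \<le> t\<^sup>2/\<tau>\<^sup>2 \<and> t\<^sup>2/\<tau>\<^sup>2 \<le> 1" using that by (auto intro!: power_mono)
    qed fact
    moreover have "(\<Sum>\<tau>\<in>Z'. t\<^sup>2/\<tau>\<^sup>2) \<le> 1/2"
    proof -
      have "(\<Sum>\<tau>\<in>Z'. t\<^sup>2/\<tau>\<^sup>2) = t\<^sup>2 * (\<Sum>\<tau>\<in>Z'. 1/\<tau>\<^sup>2)" by (simp add: sum_distrib_left)
      also have "\<dots> \<le> \<rho>\<^sup>2 * S1"
        using that S1_bound[OF that(1,2)] by (intro mult_mono power_mono sum_nonneg) auto
      finally show ?thesis using \<rho>2 by linarith
    qed
    ultimately show ?thesis by linarith
  qed
  \<comment> \<open>Compact in \<open>{0<..<\<rho>}\<close>, where G has no zero, and away from 0,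
    where the weight \<open>exp t - exp (- t)\<close> vanishes. That weight is a lower bound for the
    symmetrised exponential in either parity.\<close>
  define I where "I = {\<rho>/3..2*\<rho>/3}"
  have "continuous_on I (\<lambda>t. \<bar>G t\<bar> * (exp t - exp (-t)) / 2)"
    by (intro continuous_intros continuous_on_subset[OF cont]) auto
  then obtain t0 where t0: "t0 \<in> I" "\<And>t. t \<in> I \<Longrightarrow> \<bar>G t0\<bar> * (exp t0 - exp (-t0)) / 2 \<le> \<bar>G t\<bar> * (exp t - exp (-t)) / 2"
    using continuous_attains_inf[of I] \<rho> unfolding I_def by fastforce
  define \<mu> where "\<mu> = \<bar>G t0\<bar> * (exp t0 - exp (-t0)) / 2"
  have \<mu>: "\<mu> > 0"
  proof -
    have "t0 > 0" "t0 < \<rho>" using t0 \<rho> by (auto simp: I_def)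
    then have "G t0 \<noteq> 0" using \<rho>Z[of t0] by (auto simp: Z_def)
    then show ?thesis using \<open>t0 > 0\<close> by (simp add: \<mu>_def)
  qed

  have "((\<lambda>\<delta>. 8 * \<bar>C1\<bar> * B * exp (- 1/(2*\<delta>))) \<longlongrightarrow> 0) (at_right 0)"
    by real_asymp
  then have "\<forall>\<^sub>F \<delta> in at_right 0. 8 * \<bar>C1\<bar> * B * exp (- 1/(2*\<delta>)) < \<mu> * \<rho> / 6"
    using \<mu> \<rho> by (intro order_tendstoD(2)) auto
  moreover have "\<forall>\<^sub>F \<delta> in at_right 0. 0 < \<delta> \<and> \<delta> < min \<delta>1 (1/4)"
    using \<delta>1 by (auto simp: eventually_at_right_field intro!: exI[of _ "min \<delta>1 (1/4)"])
  ultimately have "\<forall>\<^sub>F \<delta> in at_right 0. 8 * \<bar>C1\<bar> * B * exp (- 1/(2*\<delta>)) < \<mu> * \<rho> / 6 \<and> 0 < \<delta> \<and> \<delta> < min \<delta>1 (1/4)"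
    by eventually_elim auto
  then obtain \<delta> where \<delta>: "8 * \<bar>C1\<bar> * B * exp (- 1/(2*\<delta>)) < \<mu> * \<rho> / 6" "0 < \<delta>" "\<delta> < \<delta>1" "\<delta> < 1/4"
    using eventually_happens'[OF trivial_limit_at_right_real] by force
  define \<theta> where "\<theta> = pi/2 - \<delta>"
  \<comment> \<open>The gap \<open>\<eta> - \<theta> = \<delta>/2\<close> is shared out:
    \<open>\<delta>/4\<close> absorbs the growth of the polynomial, \<open>\<delta>/8\<close> makes
    the tail beyond N small, and \<open>\<delta>/8\<close> keeps that tail integrable.\<close>
  define \<eta> where "\<eta> = pi/2 - \<delta>/2"
  have \<theta>: "\<theta> \<ge> 1" "\<bar>\<theta>\<bar> + \<delta>/8 < \<eta>" "\<theta> + \<delta>/2 = \<eta>" using \<delta> pi_gt3 by (auto simp: \<theta>_def \<eta>_def)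
  obtain C where C: "\<And>t. \<bar>G t\<bar> \<le> C * exp (- \<eta> * \<bar>t\<bar>)"
    using decay[of \<eta>] \<delta> pi_gt3 unfolding \<eta>_def by fastforce
  have C0: "C \<ge> 0" using C[of 0] by simp
  define A where "A = 9 * d"
  define E where "E = 2 * C * B * exp (A\<^sup>2/\<delta>)"
  define J where "J = (\<integral>t. exp (- (\<delta>/8) * \<bar>t\<bar>) \<partial>lborel)"
  have E0: "E \<ge> 0" using C0 B by (simp add: E_def)
  \<comment> \<open>Beyond N nothing is known about signs, so N is taken large enough for the tail
    to be negligible against \<open>\<mu> * \<rho>\<close>. The constant E bounds the integrand for
    every N at once.\<close>
  have "((\<lambda>N. E * exp (- (\<delta>/8) * N) * J) \<longlongrightarrow> 0) at_top" using \<delta>(2) by real_asymp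
  then have "\<forall>\<^sub>F N in at_top. E * exp (- (\<delta>/8) * N) * J < \<mu> * \<rho> / 6"
    using \<mu> \<rho> by (intro order_tendstoD(2)) auto
  then have "\<forall>\<^sub>F N in at_top. E * exp (- (\<delta>/8) * N) * J < \<mu> * \<rho> / 6 \<and> N > \<rho>"
    using eventually_gt_at_top[of \<rho>] by eventually_elim auto
  then obtain N where N: "E * exp (- (\<delta>/8) * N) * J < \<mu> * \<rho> / 6" "N > \<rho>"
    by (metis (mono_tags, lifting) eventually_happens trivial_limit_at_top_linorder)

  have "finite {t\<in>{0<..<N}. G t = 0}"
    by (rule finite_subset[OF _ Zfin[of N]]) (auto simp: Z_def)
  from sign_pattern[OF this _ refl] obtain Z' s where Z's: "Z' \<subseteq> {t\<in>{0<..<N}. G t = 0}" "s \<in> {1,-1}"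
    "\<And>t. t \<in> {0<..<N} \<Longrightarrow> s * G t * (\<Prod>\<tau>\<in>Z'. \<tau> - t) \<ge> 0"
    using continuous_on_subset[OF cont] by blast
  have Z': "finite Z'" "Z' \<subseteq> Z" using Z's(1) Zfin[of N] finite_subset[of Z' "Z \<inter> {..N}"] by (force simp: Z_def)+
  have Z'pos: "\<tau> > 0" if "\<tau> \<in> Z'" for \<tau> using that Z' by (auto simp: Z_def)
  define p where "p = (\<Prod>\<tau>\<in>Z'. [:1, 0, - 1/\<tau>\<^sup>2:])"
  define q where "q = (\<Prod>\<tau>\<in>Z'. [:1, 0, 1/\<tau>\<^sup>2:])"
  have poly_p: "poly p t = (\<Prod>\<tau>\<in>Z'. 1 - t\<^sup>2/\<tau>\<^sup>2)" for t by (simp add: p_def poly_prod power2_eq_square)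
  have poly_q: "poly q t = (\<Prod>\<tau>\<in>Z'. 1 + t\<^sup>2/\<tau>\<^sup>2)" for t by (simp add: q_def poly_prod power2_eq_square)
  have q_le: "poly q t \<le> B * exp (A * sqrt t)" if "t \<ge> 0" for t
    unfolding poly_q A_def using B(2)[OF Z' that] by (simp add: mult.assoc)
  have p_even: "poly p (- t) = poly p t" for t by (simp add: poly_p)
  have p_le: "\<bar>poly p t\<bar> \<le> B * exp (A * sqrt \<bar>t\<bar>)" for t
  proof -
    have "\<bar>poly p t\<bar> = (\<Prod>\<tau>\<in>Z'. \<bar>1 - t\<^sup>2/\<tau>\<^sup>2\<bar>)" by (simp add: poly_p abs_prod)
    also have "\<dots> \<le> (\<Prod>\<tau>\<in>Z'. 1 + \<bar>t\<bar>\<^sup>2/\<tau>\<^sup>2)"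
      by (intro prod_mono) (auto simp: abs_le_iff)
    also have "\<dots> = poly q \<bar>t\<bar>" by (simp add: poly_q)
    finally show ?thesis using q_le[of "\<bar>t\<bar>"] by simp
  qed
  have sgn_p: "0 \<le> s * G t * poly p t" if "0 < t" "t < N" for t
  proof -
    have "poly p t = (\<Prod>\<tau>\<in>Z'. (\<tau> - t) * ((\<tau> + t)/\<tau>\<^sup>2))"
      unfolding poly_p using Z'pos by (intro prod.cong) (force simp: field_simps power2_eq_square)+
    also have "\<dots> = (\<Prod>\<tau>\<in>Z'. \<tau> - t) * (\<Prod>\<tau>\<in>Z'. (\<tau> + t)/\<tau>\<^sup>2)" by (rule prod.distrib)
    finally have "s * G t * poly p t = (s * G t * (\<Prod>\<tau>\<in>Z'. \<tau> - t)) * (\<Prod>\<tau>\<in>Z'. (\<tau> + t)/\<tau>\<^sup>2)" by simp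
    also have "\<dots> \<ge> 0"
      using that Z'pos by (intro mult_nonneg_nonneg[OF Z's(3) prod_nonneg]) (auto simp: less_imp_le)
    finally show ?thesis .
  qed

  \<comment> \<open>V is the integrand and U its symmetrisation, with twice the integral. U is even,
    so the sign information for \<open>t > 0\<close> suffices.\<close>
  define V where "V = (\<lambda>t. G t * poly p t * exp (\<theta> * t))"
  define U where "U = (\<lambda>t. G t * poly p t * (exp (\<theta> * t) + \<sigma> * exp (- \<theta> * t)))"
  have V_meas [measurable]: "V \<in> borel_measurable borel" unfolding V_def
    by (intro borel_measurable_continuous_onI continuous_intros cont)
  have V_b: "\<bar>V t\<bar> \<le> E/2 * exp (- (\<delta>/4) * \<bar>t\<bar>)" for t
  proof -
    have A: "A * sqrt \<bar>t\<bar> \<le> A\<^sup>2/\<delta> + \<delta>/4 * \<bar>t\<bar>"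
    proof -
      have "0 \<le> (A / sqrt \<delta> - sqrt \<delta> / 2 * sqrt \<bar>t\<bar>)\<^sup>2" by simp
      also have "\<dots> = A\<^sup>2/\<delta> + \<delta>/4 * \<bar>t\<bar> - A * sqrt \<bar>t\<bar>"
        using \<delta>(2) by (simp add: power2_diff power_divide power_mult_distrib)
      finally show ?thesis by simp
    qed
    have "\<bar>V t\<bar> = \<bar>G t\<bar> * \<bar>poly p t\<bar> * exp (\<theta> * t)" by (simp add: V_def abs_mult)
    also have "\<dots> \<le> (C * exp (- \<eta> * \<bar>t\<bar>)) * (B * exp (A\<^sup>2/\<delta> + \<delta>/4 * \<bar>t\<bar>)) * exp (\<theta> * \<bar>t\<bar>)"
    proof (intro mult_mono C)
      have "B * exp (A * sqrt \<bar>t\<bar>) \<le> B * exp (A\<^sup>2/\<delta> + \<delta>/4 * \<bar>t\<bar>)" using A B by simp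
      then show "\<bar>poly p t\<bar> \<le> B * exp (A\<^sup>2/\<delta> + \<delta>/4 * \<bar>t\<bar>)" using p_le[of t] by linarith
      show "exp (\<theta> * t) \<le> exp (\<theta> * \<bar>t\<bar>)" using \<theta> by simp
    qed (use C0 B in auto)
    also have "\<dots> = E/2 * (exp (- \<eta> * \<bar>t\<bar>) * exp (\<delta>/4 * \<bar>t\<bar>) * exp (\<theta> * \<bar>t\<bar>))"
      by (simp add: E_def exp_add)
    also have "exp (- \<eta> * \<bar>t\<bar>) * exp (\<delta>/4 * \<bar>t\<bar>) * exp (\<theta> * \<bar>t\<bar>) = exp (- (\<delta>/4) * \<bar>t\<bar>)"
      by (simp flip: exp_add \<theta>(3)) (simp add: algebra_simps)
    finally show ?thesis .
  qed
  have V_int: "integrable lborel V"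
    by (rule Bochner_Integration.integrable_bound[OF integrable_mult_right[OF integrable_exp_abs[of "\<delta>/4"], of "E/2"]])
       (use \<delta> V_b E0 in \<open>auto simp: abs_mult\<close>)
  have V_int': "integrable lborel (\<lambda>t. V (- t))"
    using lborel_integrable_real_affine[OF V_int, of "-1" 0] by simp
  have V_refl: "(\<integral>t. V (- t) \<partial>lborel) = (\<integral>t. V t \<partial>lborel)"
    using lborel_integral_real_affine[of "-1" V 0] by simp
  have U_V: "U t = V t + V (- t)" for t
    by (simp add: U_def V_def p_even par algebra_simps)
  have U_int: "integrable lborel U" unfolding U_V[abs_def] by (intro Bochner_Integration.integrable_add V_int V_int')
  have U_eq: "(\<integral>t. U t \<partial>lborel) = 2 * (\<integral>t. V t \<partial>lborel)"
    unfolding U_V[abs_def] using V_refl V_int V_int' by simp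
  have U_b: "\<bar>U t\<bar> \<le> E * exp (- (\<delta>/4) * \<bar>t\<bar>)" for t
    using V_b[of t] V_b[of "-t"] unfolding U_V by simp
  have U_even: "U (- t) = U t" for t by (simp add: U_V)
  have U_pos: "s * U t \<ge> \<mu> * indicator I t" if "0 < t" "t < N" for t
  proof -
    have "1 * t \<le> \<theta> * t" using \<theta>(1) that by (intro mult_right_mono) auto
    then have "exp t \<le> exp (\<theta> * t)" "exp (- \<theta> * t) \<le> exp (- t)" by simp_all
    moreover have "\<sigma> = 1 \<or> \<sigma> = -1" using \<sigma> by simp
    ultimately have e: "exp t - exp (- t) \<le> exp (\<theta> * t) + \<sigma> * exp (- \<theta> * t)"
      using exp_gt_zero[of "- \<theta> * t"] exp_gt_zero[of "- t"] by (elim disjE) (hypsubst, linarith)+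
    have e0: "exp t - exp (-t) \<ge> 0" using that by simp
    have sU: "s * U t = (s * G t * poly p t) * (exp (\<theta> * t) + \<sigma> * exp (- \<theta> * t))" by (simp add: U_def)
    show ?thesis
    proof (cases "t \<in> I")
      case False
      have "0 \<le> (s * G t * poly p t) * (exp (\<theta> * t) + \<sigma> * exp (- \<theta> * t))"
        by (rule mult_nonneg_nonneg[OF sgn_p[OF that] order.trans[OF e0 e]])
      with False show ?thesis unfolding sU by simp
    next
      case True
      then have "t \<le> \<rho>" using \<rho> by (auto simp: I_def)
      then have "1/2 \<le> poly p t" unfolding poly_p using P_half[OF Z'] that by simp
      then have "\<bar>G t\<bar> * (1/2) \<le> \<bar>G t\<bar> * \<bar>poly p t\<bar>" by (intro mult_left_mono) auto
      moreover have "s = 1 \<or> s = -1" using Z's(2) by simp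
      then have "\<bar>s * G t * poly p t\<bar> = \<bar>G t\<bar> * \<bar>poly p t\<bar>" by (elim disjE) (simp_all add: abs_mult)
      ultimately have "\<bar>G t\<bar> * (1/2) \<le> s * G t * poly p t" using sgn_p[OF that] by linarith
      then have "\<bar>G t\<bar> * (1/2) * (exp t - exp (- t)) \<le> s * U t"
        unfolding sU by (rule mult_mono[OF _ e sgn_p[OF that] e0])
      then show ?thesis using t0(2)[OF True] True by (simp add: \<mu>_def)
    qed
  qed
  have I0: "t \<notin> I" if "t \<le> 0 \<or> t \<ge> N" for t using that \<rho> N by (auto simp: I_def)
  have U_lower: "\<mu> * indicator I t - E * exp (- (\<delta>/8) * N) * exp (- (\<delta>/8) * \<bar>t\<bar>) \<le> s * U t" if "t \<noteq> 0" for t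
  proof (cases "\<bar>t\<bar> < N")
    case True
    have "s * U t \<ge> \<mu> * indicator I t"
    proof (cases "t > 0")
      case False
      then have "s * U (- t) \<ge> \<mu> * indicator I (- t)" using U_pos[of "-t"] that True by auto
      moreover have "\<mu> * indicator I (- t) \<ge> 0" using \<mu> by simp
      ultimately show ?thesis using I0[of t] False U_even by simp
    qed (use U_pos True in auto)
    moreover have "0 \<le> E * exp (- (\<delta>/8) * N) * exp (- (\<delta>/8) * \<bar>t\<bar>)" using E0 by simp
    ultimately show ?thesis by linarith
  next
    case False
    then have "t \<notin> I" using I0[of t] by linarith
    have "\<delta>/8 * N \<le> \<delta>/8 * \<bar>t\<bar>" using False \<delta> by (intro mult_left_mono) auto
    then have "exp (- (\<delta>/4) * \<bar>t\<bar>) \<le> exp (- (\<delta>/8) * N) * exp (- (\<delta>/8) * \<bar>t\<bar>)"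
      by (simp flip: exp_add)
    then have "E * exp (- (\<delta>/4) * \<bar>t\<bar>) \<le> E * (exp (- (\<delta>/8) * N) * exp (- (\<delta>/8) * \<bar>t\<bar>))"
      using E0 by (rule mult_left_mono)
    moreover have "\<bar>s * U t\<bar> = \<bar>U t\<bar>" using Z's(2) by (auto simp: abs_mult)
    ultimately show ?thesis using U_b[of t] \<open>t \<notin> I\<close> by (simp add: mult.assoc)
  qed
  have Iint: "integrable lborel (\<lambda>t. \<mu> * indicator I t :: real)"
    unfolding I_def by (intro integrable_mult_right integrable_real_indicator) (auto simp: emeasure_lborel_Icc_eq)
  have eint: "integrable lborel (\<lambda>t::real. E * exp (- (\<delta>/8) * N) * exp (- (\<delta>/8) * \<bar>t\<bar>))"
    by (rule integrable_mult_right[OF integrable_exp_abs]) (use \<delta>(2) in simp)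
  have "(\<integral>t. \<mu> * indicator I t - E * exp (- (\<delta>/8) * N) * exp (- (\<delta>/8) * \<bar>t\<bar>) \<partial>lborel) \<le> (\<integral>t. s * U t \<partial>lborel)"
  proof (rule integral_mono_AE)
    show "integrable lborel (\<lambda>t. \<mu> * indicator I t - E * exp (- (\<delta>/8) * N) * exp (- (\<delta>/8) * \<bar>t\<bar>))"
      by (rule Bochner_Integration.integrable_diff[OF Iint eint])
    show "integrable lborel (\<lambda>t. s * U t)" by (intro integrable_mult_right U_int)
    show "AE t in lborel. \<mu> * indicator I t - E * exp (- (\<delta>/8) * N) * exp (- (\<delta>/8) * \<bar>t\<bar>) \<le> s * U t"
      using AE_lborel_singleton[of "0::real"] by eventually_elim (rule U_lower)
  qed
  also have "(\<integral>t. \<mu> * indicator I t - E * exp (- (\<delta>/8) * N) * exp (- (\<delta>/8) * \<bar>t\<bar>) \<partial>lborel) = \<mu> * \<rho> / 3 - E * exp (- (\<delta>/8) * N) * J"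
  proof -
    have "measure lborel I = \<rho> / 3" using \<rho> by (simp add: I_def)
    then show ?thesis
      unfolding Bochner_Integration.integral_diff[OF Iint eint] by (simp add: J_def)
  qed
  also have "(\<integral>t. s * U t \<partial>lborel) \<le> \<bar>2 * (\<integral>t. V t \<partial>lborel)\<bar>"
  proof -
    have "s = 1 \<or> s = -1" using Z's(2) by simp
    then show ?thesis unfolding integral_mult_right_zero U_eq by (elim disjE) simp_all
  qed
  finally have ge: "\<mu> * \<rho> / 6 < 2 * \<bar>\<integral>t. V t \<partial>lborel\<bar>" using N(1) by linarith

  have "norm (\<integral>t. complex_of_real (G t) * of_real (poly p t) * exp (of_real (\<theta> * t)) \<partial>lborel)
     \<le> (\<bar>C1\<bar> * exp (- 1/\<delta>)) * (\<Sum>n\<le>degree p. \<bar>coeff p n\<bar> * fact n / (\<delta>/8) ^ n)"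
  proof (rule integral_poly_exp_le[where \<eta>=\<eta> and C=C])
    show "norm (\<integral>t. complex_of_real (G t) * exp (\<zeta> * complex_of_real t) \<partial>lborel) \<le> \<bar>C1\<bar> * exp (- 1/\<delta>)"
      if "norm (\<zeta> - of_real \<theta>) \<le> \<delta>/8" for \<zeta>
      using small[OF \<delta>(2,3), of \<zeta>] that unfolding \<theta>_def
      by (meson abs_ge_self exp_ge_zero mult_right_mono order_trans)
  qed (use C \<delta>(2) \<theta>(2) \<open>G \<in> borel_measurable borel\<close> in auto)
  also have "\<dots> \<le> (\<bar>C1\<bar> * exp (- 1/\<delta>)) * (4 * B * exp (A\<^sup>2 / (\<delta>/8)))"
  proof (rule mult_left_mono)
    show "(\<Sum>n\<le>degree p. \<bar>coeff p n\<bar> * fact n / (\<delta>/8) ^ n) \<le> 4 * B * exp (A\<^sup>2 / (\<delta>/8))"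
      by (rule sum_coeff_fact_le[of p q])
         (use q_le \<delta>(2) prod_poly_majorant[of Z'] in \<open>simp_all add: p_def q_def\<close>)
  qed simp
  also have "\<dots> = 4 * \<bar>C1\<bar> * B * exp (- 1/\<delta> + A\<^sup>2 / (\<delta>/8))" unfolding exp_add by simp
  also have "\<dots> \<le> 4 * \<bar>C1\<bar> * B * exp (- 1/(2*\<delta>))"
  proof (rule mult_left_mono)
    \<comment> \<open>With \<open>A = 9/40\<close> the left side is \<open>0.405 / \<delta>\<close>,
      so half of the exponent \<open>1/\<delta>\<close> survives.\<close>
    have "A\<^sup>2 / (\<delta>/8) \<le> 1 / (2 * \<delta>)" using \<delta>(2) by (simp add: A_def d_def power2_eq_square field_simps)
    then show "exp (- 1/\<delta> + A\<^sup>2 / (\<delta>/8)) \<le> exp (- 1/(2*\<delta>))" by simp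
    show "0 \<le> 4 * \<bar>C1\<bar> * B" using B(1) by simp
  qed
  also have "(\<lambda>t. of_real (G t) * of_real (poly p t) * exp (of_real (\<theta> * t)) :: complex) = (\<lambda>t. complex_of_real (V t))"
    by (simp add: V_def flip: exp_of_real)
  also have "norm (\<integral>t. complex_of_real (V t) \<partial>lborel) = \<bar>\<integral>t. V t \<partial>lborel\<bar>"
    by (simp only: integral_complex_of_real norm_of_real)
  finally have le: "\<bar>\<integral>t. V t \<partial>lborel\<bar> \<le> 4 * \<bar>C1\<bar> * B * exp (- 1/(2*\<delta>))" .
  have "\<mu> * \<rho> / 6 < 2 * \<bar>\<integral>t. V t \<partial>lborel\<bar>" by (rule ge)
  also have "\<dots> \<le> 2 * (4 * \<bar>C1\<bar> * B * exp (- 1/(2*\<delta>)))" by (rule mult_left_mono[OF le]) simp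
  also have "\<dots> = 8 * \<bar>C1\<bar> * B * exp (- 1/(2*\<delta>))" by (simp only: mult.assoc[symmetric])
  also note \<delta>(1)
  finally show False by (rule notE[OF less_irrefl])
qed

section \<open>Fourier inversion and contour shifts\<close>

lemma gaussian_fourier:
  "(\<integral>t. exp (\<i> * of_real (x * t)) * of_real (exp (- t\<^sup>2 / 2)) \<partial>lborel) = of_real (sqrt (2*pi) * exp (- x\<^sup>2 / 2))"
proof -
  have "complex_of_real (exp (- x\<^sup>2 / 2)) = char std_normal_distribution x"
    by (simp add: char_std_normal_distribution)
  also have "\<dots> = (\<integral>t. std_normal_density t *\<^sub>R exp (\<i> * of_real (x * t)) \<partial>lborel)"
    unfolding char_def by (subst integral_density) (auto simp: normal_density_nonneg)
  also have "\<dots> = (\<integral>t. of_real (1 / sqrt (2*pi)) * (exp (\<i> * of_real (x * t)) * of_real (exp (- t\<^sup>2 / 2))) \<partial>lborel)"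
    by (simp add: normal_density_def scaleR_conv_of_real mult_ac)
  also have "\<dots> = of_real (1 / sqrt (2*pi)) * (\<integral>t. exp (\<i> * of_real (x * t)) * of_real (exp (- t\<^sup>2 / 2)) \<partial>lborel)"
    by (rule integral_mult_right_zero)
  finally show ?thesis by (simp add: field_simps)
qed

lemma integrable_gaussian: "integrable lborel (\<lambda>t::real. exp (- t\<^sup>2 / 2))"
proof -
  have "integrable lborel (\<lambda>t. sqrt (2*pi) * (std_normal_density t * t ^ 0))"
    by (intro integrable_mult_right integrable_std_normal_moment)
  then show ?thesis by (simp add: normal_density_def)
qed

text \<open>Gaussian damping: after the interchange of integrals, the damped integral is an average
  of h against a Gaussian of width \<open>1 / c n\<close>, and dominated convergence applies to both
  forms. Inversion at one point is enough, since other points are reached by translating h.\<close>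

lemma fourier_inversion_at_0:
  fixes h :: "real \<Rightarrow> complex"
  assumes cont: "continuous_on UNIV h" and M: "\<And>x. norm (h x) \<le> M" and h_int: "integrable lborel h"
  defines "F \<equiv> (\<lambda>t. \<integral>x. h x * exp (\<i> * of_real (t * x)) \<partial>lborel)"
  assumes F_int: "integrable lborel F"
  shows "(\<integral>t. F t \<partial>lborel) = of_real (2 * pi) * h 0"
proof -
  have [measurable]: "h \<in> borel_measurable borel" using cont by (rule borel_measurable_continuous_onI)
  have [measurable]: "F \<in> borel_measurable borel" using F_int by simp
  define c where "c = (\<lambda>n::nat. real (Suc n))"
  have c: "c n > 0" for n by (simp add: c_def)
  define A where "A = (\<lambda>n. \<integral>t. F t * of_real (exp (- (t / c n)\<^sup>2 / 2)) \<partial>lborel)"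
  have "A \<longlonglongrightarrow> (\<integral>t. F t \<partial>lborel)" unfolding A_def
  proof (rule integral_dominated_convergence[where w="\<lambda>t. norm (F t)"])
    show "AE t in lborel. (\<lambda>n. F t * of_real (exp (- (t / c n)\<^sup>2 / 2))) \<longlonglongrightarrow> F t"
    proof (rule AE_I2)
      fix t
      have "(\<lambda>n. t / c n) \<longlonglongrightarrow> 0" unfolding c_def by real_asymp
      then have "(\<lambda>n. exp (- (t / c n)\<^sup>2 / 2)) \<longlonglongrightarrow> exp (- (0\<^sup>2) / 2)" by (intro tendsto_intros) auto
      then have "(\<lambda>n. exp (- (t / c n)\<^sup>2 / 2)) \<longlonglongrightarrow> 1" by (simp only: power_zero_numeral minus_zero div_0 exp_zero)
      then have "(\<lambda>n. F t * of_real (exp (- (t / c n)\<^sup>2 / 2))) \<longlonglongrightarrow> F t * of_real 1" by (intro tendsto_intros)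
      then show "(\<lambda>n. F t * of_real (exp (- (t / c n)\<^sup>2 / 2))) \<longlonglongrightarrow> F t" by simp
    qed
  qed (use F_int in \<open>auto simp: norm_mult intro!: mult_left_le\<close>)
  moreover have A_eq: "A n = of_real (sqrt (2*pi)) * (\<integral>u. h (u / c n) * of_real (exp (- u\<^sup>2 / 2)) \<partial>lborel)" for n
  proof -
    have "A n = (\<integral>t. (\<integral>x. h x * exp (\<i> * of_real (t * x)) * of_real (exp (- (t / c n)\<^sup>2 / 2)) \<partial>lborel) \<partial>lborel)"
      unfolding A_def F_def by simp
    also have "\<dots> = (\<integral>x. (\<integral>t. h x * exp (\<i> * of_real (t * x)) * of_real (exp (- (t / c n)\<^sup>2 / 2)) \<partial>lborel) \<partial>lborel)"
    proof (rule integral_product_swap_bounded[where b="\<lambda>t. exp (- (t / c n)\<^sup>2 / 2)" and b'="\<lambda>x. norm (h x)"])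
      have "integrable lborel (\<lambda>t. exp (- (0 + (1/c n) * t)\<^sup>2 / 2))"
        by (rule lborel_integrable_real_affine[OF integrable_gaussian]) (use c[of n] in auto)
      then show "integrable lborel (\<lambda>t. exp (- (t / c n)\<^sup>2 / 2))" by simp
    qed (use h_int in \<open>auto simp: norm_mult lborel.sigma_finite_measure_axioms\<close>)
    also have "\<dots> = (\<integral>x. of_real (c n) * (h x * of_real (sqrt (2*pi) * exp (- (x * c n)\<^sup>2 / 2))) \<partial>lborel)"
    proof (intro Bochner_Integration.integral_cong refl)
      fix x
      have "(\<integral>t. h x * exp (\<i> * of_real (t * x)) * of_real (exp (- (t / c n)\<^sup>2 / 2)) \<partial>lborel)
        = \<bar>c n\<bar> *\<^sub>R (\<integral>t. h x * exp (\<i> * of_real ((0 + c n * t) * x)) * of_real (exp (- ((0 + c n * t) / c n)\<^sup>2 / 2)) \<partial>lborel)"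
        by (rule lborel_integral_real_affine) (use c[of n] in auto)
      also have "(\<lambda>t. h x * exp (\<i> * of_real ((0 + c n * t) * x)) * of_real (exp (- ((0 + c n * t) / c n)\<^sup>2 / 2)))
        = (\<lambda>t. h x * (exp (\<i> * of_real ((x * c n) * t)) * of_real (exp (- t\<^sup>2 / 2))))"
        using c[of n] by (auto simp: mult_ac)
      also have "(\<integral>t. h x * (exp (\<i> * of_real ((x * c n) * t)) * of_real (exp (- t\<^sup>2 / 2))) \<partial>lborel) = h x * of_real (sqrt (2*pi) * exp (- (x * c n)\<^sup>2 / 2))"
        by (subst integral_mult_right_zero, subst gaussian_fourier) simp
      finally show "(\<integral>t. h x * exp (\<i> * of_real (t * x)) * of_real (exp (- (t / c n)\<^sup>2 / 2)) \<partial>lborel) = of_real (c n) * (h x * of_real (sqrt (2*pi) * exp (- (x * c n)\<^sup>2 / 2)))"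
        using c[of n] by (simp add: scaleR_conv_of_real)
    qed
    also have "\<dots> = of_real (c n) * (\<integral>x. h x * of_real (sqrt (2*pi) * exp (- (x * c n)\<^sup>2 / 2)) \<partial>lborel)"
      by (rule integral_mult_right_zero)
    also have "(\<integral>x. h x * of_real (sqrt (2*pi) * exp (- (x * c n)\<^sup>2 / 2)) \<partial>lborel)
       = \<bar>1 / c n\<bar> *\<^sub>R (\<integral>x. h (0 + 1 / c n * x) * of_real (sqrt (2*pi) * exp (- ((0 + 1 / c n * x) * c n)\<^sup>2 / 2)) \<partial>lborel)"
      by (rule lborel_integral_real_affine) (use c[of n] in auto)
    also have "(\<lambda>x. h (0 + 1 / c n * x) * of_real (sqrt (2*pi) * exp (- ((0 + 1 / c n * x) * c n)\<^sup>2 / 2)))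
       = (\<lambda>x. of_real (sqrt (2*pi)) * (h (x / c n) * of_real (exp (- x\<^sup>2 / 2))))"
      using c[of n] by (auto simp: mult_ac)
    also have "(\<integral>x. of_real (sqrt (2*pi)) * (h (x / c n) * of_real (exp (- x\<^sup>2 / 2))) \<partial>lborel) =
        of_real (sqrt (2*pi)) * (\<integral>x. h (x / c n) * of_real (exp (- x\<^sup>2 / 2)) \<partial>lborel)"
      by (rule integral_mult_right_zero)
    finally show ?thesis using c[of n] by (simp add: scaleR_conv_of_real field_simps)
  qed
  moreover have "A \<longlonglongrightarrow> of_real (sqrt (2*pi)) * (\<integral>u. h 0 * of_real (exp (- u\<^sup>2 / 2)) \<partial>lborel)"
    unfolding A_eq[abs_def]
  proof (intro tendsto_mult tendsto_const integral_dominated_convergence[where w="\<lambda>u. M * exp (- u\<^sup>2 / 2)"])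
    show "AE u in lborel. (\<lambda>n. h (u / c n) * of_real (exp (- u\<^sup>2 / 2))) \<longlonglongrightarrow> h 0 * of_real (exp (- u\<^sup>2 / 2))"
    proof (intro AE_I2 tendsto_mult tendsto_const)
      fix u
      have "(\<lambda>n. u / c n) \<longlonglongrightarrow> 0" unfolding c_def by real_asymp
      moreover have "isCont h 0" using cont by (simp add: continuous_on_eq_continuous_at)
      ultimately show "(\<lambda>n. h (u / c n)) \<longlonglongrightarrow> h 0" by (rule isCont_tendsto_compose[rotated])
    qed
  qed (use M integrable_gaussian in \<open>auto simp: norm_mult intro!: mult_right_mono integrable_mult_right\<close>)
  moreover have "(\<integral>u. h 0 * of_real (exp (- u\<^sup>2 / 2)) \<partial>lborel) = h 0 * of_real (sqrt (2*pi))"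
    using gaussian_fourier[of 0] by (subst integral_mult_right_zero) simp
  ultimately have "(\<integral>t. F t \<partial>lborel) = of_real (sqrt (2*pi)) * (h 0 * of_real (sqrt (2*pi)))"
    using LIMSEQ_unique by metis
  also have "\<dots> = of_real (sqrt (2*pi) * sqrt (2*pi)) * h 0" by (simp only: of_real_mult mult_ac)
  finally show ?thesis by simp
qed

text \<open>The strip is convex, so q has a primitive Q there. Integrals over long horizontal
  segments are differences of Q at the ends, and the change of Q along the two vertical sides, of
  fixed length, tends to 0 by the decay of q.\<close>

lemma integral_shift_strip:
  fixes q :: "complex \<Rightarrow> complex"
  assumes hol: "q holomorphic_on {X. \<bar>Im X\<bar> < b}" and \<eta>: "\<bar>\<eta>\<bar> < b"
    and decay: "\<And>X. \<bar>Im X\<bar> \<le> \<bar>\<eta>\<bar> \<Longrightarrow> norm (q X) \<le> K * exp (- \<bar>Re X\<bar>)"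
  shows "integrable lborel (\<lambda>x. q (of_real x + \<i> * of_real \<eta>))"
    and "(\<integral>x. q (of_real x + \<i> * of_real \<eta>) \<partial>lborel) = (\<integral>x. q (of_real x) \<partial>lborel)"
proof -
  let ?S = "{X. \<bar>Im X\<bar> < b}"
  have S: "convex ?S" "open ?S"
  proof -
    have "?S = {X. Im X < b} \<inter> {X. Im X > - b}" by auto
    then show "convex ?S" "open ?S"
      by (auto intro!: convex_Int convex_halfspace_Im_lt convex_halfspace_Im_gt open_Int open_halfspace_Im_lt open_halfspace_Im_gt)
  qed
  obtain Q where "\<And>X. X \<in> ?S \<Longrightarrow> (Q has_field_derivative q X) (at X within ?S)"
    using holomorphic_convex_primitive'[OF S hol] by metis
  then have Q: "(Q has_field_derivative q X) (at X)" if "X \<in> ?S" for X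
    using that S by (metis at_within_open)
  define u where "u = (\<lambda>y x. q (of_real x + \<i> * of_real y))"
  have cont: "continuous_on UNIV (u y)" if "\<bar>y\<bar> \<le> \<bar>\<eta>\<bar>" for y
    unfolding u_def using that \<eta>
    by (intro continuous_on_compose2[OF holomorphic_on_imp_continuous_on[OF hol]] continuous_intros) auto
  have ub: "norm (u y x) \<le> K * exp (- 1 * \<bar>x\<bar>)" if "\<bar>y\<bar> \<le> \<bar>\<eta>\<bar>" for x y
    using decay[of "of_real x + \<i> * of_real y"] that by (simp add: u_def)
  have meas: "u y \<in> borel_measurable borel" if "\<bar>y\<bar> \<le> \<bar>\<eta>\<bar>" for y
    using cont[OF that] by (rule borel_measurable_continuous_onI)
  have eint: "integrable lborel (\<lambda>x. K * exp (- 1 * \<bar>x\<bar>))" by (intro integrable_mult_right integrable_exp_abs) auto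
  have uint: "integrable lborel (u y)" if "\<bar>y\<bar> \<le> \<bar>\<eta>\<bar>" for y
    by (rule Bochner_Integration.integrable_bound[OF eint])
       (use meas[OF that] order.trans[OF ub[OF that] abs_ge_self] in auto)
  show "integrable lborel (\<lambda>x. q (of_real x + \<i> * of_real \<eta>))" using uint[of \<eta>] by (simp add: u_def)
  have lim: "(\<lambda>n. Q (of_real (real n) + \<i> * of_real y) - Q (of_real (- real n) + \<i> * of_real y)) \<longlonglongrightarrow> (\<integral>x. u y x \<partial>lborel)" if y: "\<bar>y\<bar> \<le> \<bar>\<eta>\<bar>" for y
  proof -
    have "(\<integral>x. indicator {- real n..real n} x *\<^sub>R u y x \<partial>lborel) = Q (of_real (real n) + \<i> * of_real y) - Q (of_real (- real n) + \<i> * of_real y)" for n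
    proof (rule integral_FTC_Icc)
      fix x
      have "(Q has_field_derivative q (of_real x + \<i> * of_real y)) (at (of_real x + \<i> * of_real y))"
        using Q y \<eta> by simp
      then have "((\<lambda>z. Q (z + \<i> * of_real y)) has_field_derivative u y x) (at (of_real x))"
        unfolding u_def by (simp add: DERIV_shift)
      then show "((\<lambda>x. Q (of_real x + \<i> * of_real y)) has_vector_derivative u y x) (at x within {- real n..real n})"
        by (rule has_vector_derivative_real_field)
    qed (use continuous_on_subset[OF cont[OF y]] in auto)
    moreover have "(\<lambda>n. \<integral>x. indicator {- real n..real n} x *\<^sub>R u y x \<partial>lborel) \<longlonglongrightarrow> (\<integral>x. u y x \<partial>lborel)"
    proof (rule integral_dominated_convergence[where w="\<lambda>x. norm (u y x)"])
      show "AE x in lborel. (\<lambda>n. indicator {- real n..real n} x *\<^sub>R u y x) \<longlonglongrightarrow> u y x"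
      proof (rule AE_I2)
        fix x :: real
        have "\<forall>\<^sub>F n in sequentially. real n \<ge> \<bar>x\<bar>" by real_asymp
        then have "\<forall>\<^sub>F n in sequentially. indicator {- real n..real n} x *\<^sub>R u y x = u y x"
          by eventually_elim (auto simp: indicator_def abs_le_iff)
        then show "(\<lambda>n. indicator {- real n..real n} x *\<^sub>R u y x) \<longlonglongrightarrow> u y x" by (rule tendsto_eventually)
      qed
    qed (use meas[OF y] uint[OF y] in \<open>auto simp: indicator_def\<close>)
    ultimately show ?thesis by simp
  qed
  have side: "norm (Q (of_real x + \<i> * of_real \<eta>) - Q (of_real x)) \<le> K * exp (- \<bar>x\<bar>) * \<bar>\<eta>\<bar>" for x
  proof -
    have seg: "Re X = x \<and> \<bar>Im X\<bar> \<le> \<bar>\<eta>\<bar>" if "X \<in> closed_segment (of_real x) (of_real x + \<i> * of_real \<eta>)" for X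
      using that by (auto simp: closed_segment_def algebra_simps abs_mult mult_left_le_one_le)
    have "norm (Q (of_real x + \<i> * of_real \<eta>) - Q (of_real x)) \<le> K * exp (- \<bar>x\<bar>) * norm (of_real x + \<i> * of_real \<eta> - of_real x)"
    proof (rule field_differentiable_bound[where f'=q and S="closed_segment (of_real x) (of_real x + \<i> * of_real \<eta>)"])
      fix X assume "X \<in> closed_segment (of_real x) (of_real x + \<i> * of_real \<eta>)"
      with seg[OF this] \<eta> show "(Q has_field_derivative q X) (at X within closed_segment (of_real x) (of_real x + \<i> * of_real \<eta>))"
        "norm (q X) \<le> K * exp (- \<bar>x\<bar>)"
        using Q[of X] decay[of X] by (auto intro: has_field_derivative_at_within)
    qed auto
    then show ?thesis by (simp add: norm_mult)
  qed
  have "(\<lambda>n. (Q (of_real (real n) + \<i> * of_real \<eta>) - Q (of_real (- real n) + \<i> * of_real \<eta>))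
      - (Q (of_real (real n) + \<i> * of_real 0) - Q (of_real (- real n) + \<i> * of_real 0))) \<longlonglongrightarrow> 0"
  proof (rule Lim_null_comparison)
    show "(\<lambda>n. 2 * (K * exp (- real n) * \<bar>\<eta>\<bar>)) \<longlonglongrightarrow> 0" by real_asymp
    show "\<forall>\<^sub>F n in sequentially. norm ((Q (of_real (real n) + \<i> * of_real \<eta>) - Q (of_real (- real n) + \<i> * of_real \<eta>))
      - (Q (of_real (real n) + \<i> * of_real 0) - Q (of_real (- real n) + \<i> * of_real 0))) \<le> 2 * (K * exp (- real n) * \<bar>\<eta>\<bar>)"
    proof (rule always_eventually, rule allI)
      fix n
      have eq: "(Q (of_real (real n) + \<i> * of_real \<eta>) - Q (of_real (- real n) + \<i> * of_real \<eta>))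
      - (Q (of_real (real n) + \<i> * of_real 0) - Q (of_real (- real n) + \<i> * of_real 0)) = 
        (Q (of_real (real n) + \<i> * of_real \<eta>) - Q (of_real (real n))) - (Q (of_real (- real n) + \<i> * of_real \<eta>) - Q (of_real (- real n)))"
        by simp
      show "norm ((Q (of_real (real n) + \<i> * of_real \<eta>) - Q (of_real (- real n) + \<i> * of_real \<eta>))
      - (Q (of_real (real n) + \<i> * of_real 0) - Q (of_real (- real n) + \<i> * of_real 0))) \<le> 2 * (K * exp (- real n) * \<bar>\<eta>\<bar>)"
        unfolding eq by (rule order.trans[OF norm_triangle_ineq4]) (use side[of "real n"] side[of "- real n"] in simp)
    qed
  qed
  moreover have "(\<lambda>n. (Q (of_real (real n) + \<i> * of_real \<eta>) - Q (of_real (- real n) + \<i> * of_real \<eta>))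
      - (Q (of_real (real n) + \<i> * of_real 0) - Q (of_real (- real n) + \<i> * of_real 0))) \<longlonglongrightarrow> (\<integral>x. u \<eta> x \<partial>lborel) - (\<integral>x. u 0 x \<partial>lborel)"
    by (intro tendsto_diff lim) auto
  ultimately have "(\<integral>x. u \<eta> x \<partial>lborel) - (\<integral>x. u 0 x \<partial>lborel) = 0" by (rule LIMSEQ_unique[symmetric])
  then show "(\<integral>x. q (of_real x + \<i> * of_real \<eta>) \<partial>lborel) = (\<integral>x. q (of_real x) \<partial>lborel)" by (simp add: u_def)
qed

section \<open>Cusp forms\<close>

locale cusp =
  fixes k :: nat and f :: "complex \<Rightarrow> complex" and a :: "nat \<Rightarrow> real"
  assumes form: "cusp_form k f" and expansion: "has_cuspidal_expansion f (\<lambda>n. complex_of_real (a n))"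
begin

lemma f_holomorphic: "f holomorphic_on {\<tau>. Im \<tau> > 0}"
  using form by (simp add: cusp_form_def)

lemma f_transform:
  fixes p q r s :: int
  assumes "p * s - q * r = 1" "Im \<tau> > 0"
  shows "f ((of_int p * \<tau> + of_int q) / (of_int r * \<tau> + of_int s)) = (of_int r * \<tau> + of_int s) ^ k * f \<tau>"
  using form assms unfolding cusp_form_def by blast

lemma f_plus_1: "Im \<tau> > 0 \<Longrightarrow> f (\<tau> + 1) = f \<tau>"
  using f_transform[of 1 1 1 0 \<tau>] by simp

lemma f_minus_1: "Im \<tau> > 0 \<Longrightarrow> f (\<tau> - 1) = f \<tau>"
  using f_plus_1[of "\<tau> - 1"] by simp

lemma f_inversion: "Im \<tau> > 0 \<Longrightarrow> f (- 1 / \<tau>) = \<tau> ^ k * f \<tau>"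
  using f_transform[of 0 0 "-1" 1 \<tau>] by simp

lemma f_sums: "Im \<tau> > 0 \<Longrightarrow> (\<lambda>n. of_real (a (Suc n)) * exp (2 * of_real pi * \<i> * of_nat (Suc n) * \<tau>)) sums f \<tau>"
  using expansion unfolding has_cuspidal_expansion_def by blast

lemma norm_exp_2pi_i: "norm (exp (2 * of_real pi * \<i> * of_nat n * \<tau>)) = exp (- 2 * pi * real n * Im \<tau>)"
  by simp

text \<open>At height \<open>y/2\<close> the terms of the expansion tend to 0, hence are bounded,
  and the other half of the height gives a geometric series. The exponent carries n while the
  coefficient has index \<open>Suc n\<close>: the missing factor is what is pulled out as the decay
  \<open>exp (- 2 * pi * Im \<tau>)\<close> of f.\<close>

lemma summable_coeffs:
  assumes "y > 0"
  shows "summable (\<lambda>n. \<bar>a (Suc n)\<bar> * exp (- 2 * pi * real n * y))"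
proof -
  have "(\<lambda>n. of_real (a (Suc n)) * exp (2 * of_real pi * \<i> * of_nat (Suc n) * (\<i> * of_real (y/2)))) \<longlonglongrightarrow> 0"
    using f_sums[of "\<i> * of_real (y/2)"] assms by (intro summable_LIMSEQ_zero) (auto simp: sums_iff)
  then have "Bseq (\<lambda>n. of_real (a (Suc n)) * exp (2 * of_real pi * \<i> * of_nat (Suc n) * (\<i> * of_real (y/2))))"
    by (intro convergent_imp_Bseq) (auto simp: convergent_def)
  then obtain M where M: "\<And>n. norm (complex_of_real (a (Suc n)) * exp (2 * of_real pi * \<i> * of_nat (Suc n) * (\<i> * of_real (y/2)))) \<le> M"
    unfolding Bseq_def by blast
  have *: "\<bar>a (Suc n)\<bar> * exp (- 2 * pi * real n * y) \<le> M * exp (pi * y) * exp (- pi * y) ^ n" for n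
  proof -
    have "\<bar>a (Suc n)\<bar> * exp (- pi * real (Suc n) * y) \<le> M"
      using M[of n] by (simp only: norm_mult norm_of_real norm_exp_2pi_i) (simp add: algebra_simps)
    then have "\<bar>a (Suc n)\<bar> * exp (- pi * real (Suc n) * y) * (exp (pi * y) * exp (- pi * real n * y)) \<le> M * (exp (pi * y) * exp (- pi * real n * y))"
      by (rule mult_right_mono) auto
    also have "\<bar>a (Suc n)\<bar> * exp (- pi * real (Suc n) * y) * (exp (pi * y) * exp (- pi * real n * y)) = \<bar>a (Suc n)\<bar> * exp (- 2 * pi * real n * y)"
      by (simp add: mult.assoc flip: exp_add) (simp add: algebra_simps)
    also have "exp (- pi * real n * y) = exp (- pi * y) ^ n" by (simp add: mult_ac flip: exp_of_nat_mult)
    finally show ?thesis by (simp add: mult_ac)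
  qed
  have "summable (\<lambda>n. M * exp (pi * y) * exp (- pi * y) ^ n)"
    using assms by (intro summable_mult summable_geometric) auto
  then show ?thesis by (rule summable_comparison_test') (use * in \<open>auto simp: abs_mult\<close>)
qed

lemma f_exp_decay:
  assumes "y0 > 0"
  obtains C where "C \<ge> 0" "\<And>\<tau>. Im \<tau> \<ge> y0 \<Longrightarrow> norm (f \<tau>) \<le> C * exp (- 2 * pi * Im \<tau>)"
proof
  let ?C = "\<Sum>n. \<bar>a (Suc n)\<bar> * exp (- 2 * pi * real n * y0)"
  show "?C \<ge> 0" by (intro suminf_nonneg summable_coeffs assms) auto
  fix \<tau> assume \<tau>: "Im \<tau> \<ge> y0"
  have b: "norm (of_real (a (Suc n)) * exp (2 * of_real pi * \<i> * of_nat (Suc n) * \<tau>)) \<le> \<bar>a (Suc n)\<bar> * exp (- 2 * pi * real n * y0) * exp (- 2 * pi * Im \<tau>)" for n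
  proof -
    have "norm (of_real (a (Suc n)) * exp (2 * of_real pi * \<i> * of_nat (Suc n) * \<tau>)) = \<bar>a (Suc n)\<bar> * (exp (- 2 * pi * real n * Im \<tau>) * exp (- 2 * pi * Im \<tau>))"
      unfolding norm_mult norm_of_real norm_exp_2pi_i by (simp add: algebra_simps flip: exp_add)
    also have "\<dots> \<le> \<bar>a (Suc n)\<bar> * (exp (- 2 * pi * real n * y0) * exp (- 2 * pi * Im \<tau>))"
      using \<tau> by (intro mult_left_mono mult_right_mono) (auto intro!: mult_left_mono)
    finally show ?thesis by (simp add: mult_ac)
  qed
  have s: "(\<lambda>n. of_real (a (Suc n)) * exp (2 * of_real pi * \<i> * of_nat (Suc n) * \<tau>)) sums f \<tau>" using \<tau> assms by (intro f_sums) auto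
  have s2: "summable (\<lambda>n. \<bar>a (Suc n)\<bar> * exp (- 2 * pi * real n * y0) * exp (- 2 * pi * Im \<tau>))"
    by (intro summable_mult2 summable_coeffs assms)
  have "norm (f \<tau>) \<le> (\<Sum>n. \<bar>a (Suc n)\<bar> * exp (- 2 * pi * real n * y0) * exp (- 2 * pi * Im \<tau>))"
    unfolding sums_unique[OF s] by (rule norm_suminf_le[OF b s2])
  also have "\<dots> = ?C * exp (- 2 * pi * Im \<tau>)"
    by (rule suminf_mult2[symmetric, OF summable_coeffs[OF assms]])
  finally show "norm (f \<tau>) \<le> ?C * exp (- 2 * pi * Im \<tau>)" .
qed

text \<open>Dirichlet's approximation theorem replaces the fundamental domain.\<close>

lemma modular_reduction:
  assumes \<tau>: "Im \<tau> > 0" "Im \<tau> < 1"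
  obtains p q r s :: int where "p * s - q * r = 1"
    "Im ((of_int p * \<tau> + of_int q) / (of_int r * \<tau> + of_int s)) \<ge> 1/5"
    "of_int r * \<tau> + of_int s \<noteq> 0"
    "Im ((of_int p * \<tau> + of_int q) / (of_int r * \<tau> + of_int s)) = Im \<tau> / (norm (of_int r * \<tau> + of_int s))\<^sup>2"
proof -
  define y where "y = Im \<tau>"
  \<comment> \<open>With this N both parts of \<open>w = r * \<tau> + s\<close> are small: the real
    part is at most \<open>sqrt y\<close>, the imaginary part \<open>r * y\<close> at most
    \<open>sqrt y + y \<le> 2 * sqrt y\<close>. Hence \<open>(norm w)\<^sup>2 \<le> 5 * y\<close>,
    the origin of 1/5.\<close>
  define N where "N = nat \<lceil>1 / sqrt y\<rceil>"
  have y: "y > 0" "y < 1" using \<tau> by (auto simp: y_def)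
  have N: "real N \<ge> 1 / sqrt y" "real N \<le> 1 / sqrt y + 1"
    using y by (auto simp: N_def)
  have "N > 0" using N y by (intro gr0I) auto
  then obtain r t :: int where rt: "coprime r t" "0 < r" "r \<le> int N" "\<bar>of_int r * Re \<tau> - of_int t\<bar> < 1/N"
    using Dirichlet_approx_coprime[of N "Re \<tau>"] by (metis coprime_commute)
  define s where "s = - t"
  obtain u v where uv: "u * r + v * s = 1" using rt(1) bezout_int[of r s] by (auto simp: s_def)
  define w where "w = of_int r * \<tau> + of_int s"
  have Imw: "Im w = of_int r * y" by (simp add: w_def y_def)
  then have w0: "w \<noteq> 0" using rt y by auto
  have det: "v * s - (- u) * r = 1" using uv by (simp add: algebra_simps)
  have "(norm w)\<^sup>2 \<le> 5 * y"
  proof -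
    have "(norm w)\<^sup>2 = (Re w)\<^sup>2 + (Im w)\<^sup>2" by (rule cmod_power2)
    also have "(Re w)\<^sup>2 \<le> (1/N)\<^sup>2" using rt(4) by (intro abs_le_square_iff[THEN iffD1]) (auto simp: w_def s_def)
    also have "(1/N)\<^sup>2 \<le> (sqrt y)\<^sup>2" using N(1) y \<open>N > 0\<close> by (intro power_mono) (auto simp: field_simps)
    also have "(Im w)\<^sup>2 \<le> (2 * sqrt y)\<^sup>2"
    proof (rule power_mono)
      have "of_int r * y \<le> (1 / sqrt y + 1) * y" using rt(3) N(2) y by (intro mult_right_mono) linarith+
      also have "\<dots> = sqrt y + y" using y by (simp add: field_simps)
      finally have "of_int r * y \<le> sqrt y + y" .
      moreover have "y \<le> sqrt y" using y by (simp add: real_le_rsqrt power2_eq_square mult_left_le_one_le)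
      ultimately show "Im w \<le> 2 * sqrt y" by (simp add: Imw)
    qed (use Imw rt y in auto)
    finally show ?thesis using y by (simp add: power_mult_distrib)
  qed
  have Im: "Im ((of_int v * \<tau> + of_int (- u)) / w) = y / (norm w)\<^sup>2"
  proof -
    have "Im ((of_int v * \<tau> + of_int (- u)) / w) = (of_int v * y * Re w - (of_int v * Re \<tau> - of_int u) * Im w) / (norm w)\<^sup>2"
      by (simp add: Im_divide cmod_power2 y_def)
    also have "of_int v * y * Re w - (of_int v * Re \<tau> - of_int u) * Im w = y * of_int (u * r + v * s)"
      by (simp add: w_def y_def algebra_simps)
    finally show ?thesis using uv by simp
  qed
  show thesis
  proof (rule that[OF det])
    have "1/5 \<le> y / (norm w)\<^sup>2" using \<open>(norm w)\<^sup>2 \<le> 5 * y\<close> y w0 by (simp add: field_simps)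
    then show "Im ((of_int v * \<tau> + of_int (- u)) / (of_int r * \<tau> + of_int s)) \<ge> 1/5"
      using Im unfolding w_def by simp
  qed (use w0 Im in \<open>auto simp: w_def y_def\<close>)
qed

text \<open>The quantity is invariant under the modular group, so it suffices to bound it for
  \<open>Im \<tau> \<ge> 1/5\<close>, where the exponential decay of f beats the power.\<close>

lemma hecke_bound:
  obtains C where "C > 0" "\<And>\<tau>. Im \<tau> > 0 \<Longrightarrow> (Im \<tau>) ^ k * (norm (f \<tau>))\<^sup>2 \<le> C"
proof -
  obtain C where C: "C \<ge> 0" "\<And>\<tau>. Im \<tau> \<ge> 1/5 \<Longrightarrow> norm (f \<tau>) \<le> C * exp (- 2 * pi * Im \<tau>)"
    using f_exp_decay[of "1/5"] by auto
  obtain K where K: "K > 0" "\<And>y::real. y \<ge> 0 \<Longrightarrow> y ^ k \<le> K * exp (2 * y)"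
    using power_exp_le[of 2 k] by auto
  define C' where "C' = C\<^sup>2 * K + 1"
  have high: "(Im \<tau>) ^ k * (norm (f \<tau>))\<^sup>2 \<le> C'" if "Im \<tau> \<ge> 1/5" for \<tau>
  proof -
    let ?y = "Im \<tau>"
    have y: "?y > 0" using that by linarith
    have e: "?y ^ k \<le> K * exp (2 * ?y)" using K(2) y by simp
    have "(norm (f \<tau>))\<^sup>2 \<le> (C * exp (- 2 * pi * ?y))\<^sup>2" using C(2)[OF that] by (intro power_mono) auto
    also have "\<dots> = C\<^sup>2 * exp (- (4 * pi) * ?y)" by (simp add: power_mult_distrib power2_eq_square flip: exp_add)
    also have "\<dots> \<le> C\<^sup>2 * exp (- (2 * ?y))"
    proof -
      have "2 * ?y \<le> (4 * pi) * ?y" using y pi_gt3 by (intro mult_right_mono) auto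
      then show ?thesis by (intro mult_left_mono) auto
    qed
    finally have "?y ^ k * (norm (f \<tau>))\<^sup>2 \<le> (K * exp (2 * ?y)) * (C\<^sup>2 * exp (- (2 * ?y)))"
      using e y K(1) by (intro mult_mono) auto
    also have "\<dots> = C\<^sup>2 * K" by (simp add: exp_minus field_simps)
    finally show ?thesis by (simp add: C'_def)
  qed
  show thesis
  proof (rule that[of C'])
    show "C' > 0" using K(1) by (auto simp: C'_def intro: add_nonneg_pos)
    fix \<tau> assume \<tau>: "Im \<tau> > 0"
    show "(Im \<tau>) ^ k * (norm (f \<tau>))\<^sup>2 \<le> C'"
    proof (cases "Im \<tau> < 1")
      case True
      obtain p q r s :: int where g: "p * s - q * r = 1"
        "Im ((of_int p * \<tau> + of_int q) / (of_int r * \<tau> + of_int s)) \<ge> 1/5"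
        "of_int r * \<tau> + of_int s \<noteq> 0"
        "Im ((of_int p * \<tau> + of_int q) / (of_int r * \<tau> + of_int s)) = Im \<tau> / (norm (of_int r * \<tau> + of_int s))\<^sup>2"
        using modular_reduction[OF \<tau> True] by metis
      let ?w = "of_int r * \<tau> + of_int s"
      have "(Im \<tau> / (norm ?w)\<^sup>2) ^ k * (norm (?w ^ k * f \<tau>))\<^sup>2 \<le> C'"
        using high[OF g(2)] unfolding f_transform[OF g(1) \<tau>] g(4) .
      also have "(Im \<tau> / (norm ?w)\<^sup>2) ^ k * (norm (?w ^ k * f \<tau>))\<^sup>2 = (Im \<tau>) ^ k * (norm (f \<tau>))\<^sup>2"
        using g(3) by (simp add: norm_mult norm_power power_divide power_mult_distrib mult.commute[of k 2] flip: power_mult)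
      finally show ?thesis .
    qed (use high[of \<tau>] in auto)
  qed
qed

text \<open>Orthogonality gives the coefficients of the absolutely convergent series; multiplying
  the conjugate series by g and integrating termwise then leaves the squares.\<close>

lemma parseval:
  assumes "y > 0"
  shows "(\<integral>x. (norm (f (of_real (x / (2*pi)) + \<i> * of_real y)))\<^sup>2 \<partial>circ) = (\<Sum>n. (a (Suc n) * exp (- 2 * pi * real (Suc n) * y))\<^sup>2)"
    and "summable (\<lambda>n. (a (Suc n) * exp (- 2 * pi * real (Suc n) * y))\<^sup>2)"
proof -
  define \<alpha> where "\<alpha> = (\<lambda>n. a (Suc n) * exp (- 2 * pi * real (Suc n) * y))"
  define g where "g = (\<lambda>x. f (of_real (x / (2*pi)) + \<i> * of_real y))"
  have "summable (\<lambda>n. (\<bar>a (Suc n)\<bar> * exp (- 2 * pi * real n * y)) * exp (- 2 * pi * y))"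
    by (intro summable_mult2 summable_coeffs assms)
  also have "(\<lambda>n. (\<bar>a (Suc n)\<bar> * exp (- 2 * pi * real n * y)) * exp (- 2 * pi * y)) = (\<lambda>n. \<bar>\<alpha> n\<bar>)"
    by (auto simp: \<alpha>_def abs_mult mult.assoc algebra_simps simp flip: exp_add)
  finally have \<alpha>: "summable (\<lambda>n. \<bar>\<alpha> n\<bar>)" .
  have g_sums: "(\<lambda>n. of_real (\<alpha> n) * cis (real (Suc n) * x)) sums g x" for x
  proof -
    have "of_real (a (Suc n)) * exp (2 * of_real pi * \<i> * of_nat (Suc n) * (of_real (x / (2*pi)) + \<i> * of_real y)) = of_real (\<alpha> n) * cis (real (Suc n) * x)" for n
    proof -
      have "2 * of_real pi * \<i> * of_nat (Suc n) * (of_real (x / (2*pi)) + \<i> * of_real y) = of_real (- 2 * pi * real (Suc n) * y) + \<i> * of_real (real (Suc n) * x)"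
        by (auto simp: complex_eq_iff)
      then have "exp (2 * of_real pi * \<i> * of_nat (Suc n) * (of_real (x / (2*pi)) + \<i> * of_real y)) = of_real (exp (- 2 * pi * real (Suc n) * y)) * cis (real (Suc n) * x)"
        by (simp only: exp_add exp_of_real cis_conv_exp)
      then show ?thesis by (simp only: \<alpha>_def of_real_mult mult.assoc)
    qed
    then show ?thesis using f_sums[of "of_real (x / (2*pi)) + \<i> * of_real y"] assms by (simp add: g_def)
  qed
  have g_cont: "continuous_on UNIV g"
    unfolding g_def using assms
    by (intro continuous_on_compose2[OF holomorphic_on_imp_continuous_on[OF f_holomorphic]] continuous_intros) auto
  have [measurable]: "g \<in> borel_measurable borel" using g_cont by (rule borel_measurable_continuous_onI)
  have g_bound: "norm (g x) \<le> (\<Sum>n. \<bar>\<alpha> n\<bar>)" for x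
  proof -
    have "norm (\<Sum>n. of_real (\<alpha> n) * cis (real (Suc n) * x)) \<le> (\<Sum>n. \<bar>\<alpha> n\<bar>)"
      by (rule norm_suminf_le[OF _ \<alpha>]) (simp add: norm_mult)
    then show ?thesis using g_sums[of x] by (simp add: sums_iff)
  qed
  have coeff: "(\<integral>x. g x * cis (- real (Suc m) * x) \<partial>circ) = of_real (\<alpha> m)" for m
  proof -
    have eq: "of_real (\<alpha> n) * cis (real (Suc n) * x) * cis (- real (Suc m) * x) = of_real (\<alpha> n) * cis (of_int (int n - int m) * x)" for n x
      by (simp add: mult.assoc cis_mult) (simp add: algebra_simps)
    have "(\<lambda>n. \<integral>x. of_real (\<alpha> n) * cis (real (Suc n) * x) * cis (- real (Suc m) * x) \<partial>circ) sums
          (\<integral>x. (\<Sum>n. of_real (\<alpha> n) * cis (real (Suc n) * x) * cis (- real (Suc m) * x)) \<partial>circ)"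
    proof (rule sums_integral)
      fix n show "integrable circ (\<lambda>x. of_real (\<alpha> n) * cis (real (Suc n) * x) * cis (- real (Suc m) * x))"
        by (rule integrable_circ[where B="\<bar>\<alpha> n\<bar>"]) (auto simp: norm_mult)
    qed (use \<alpha> circ.prob_space in \<open>auto simp: norm_mult\<close>)
    also have "(\<lambda>x. \<Sum>n. of_real (\<alpha> n) * cis (real (Suc n) * x) * cis (- real (Suc m) * x)) = (\<lambda>x. g x * cis (- real (Suc m) * x))"
      by (rule ext) (rule sums_unique[OF sums_mult2[OF g_sums], symmetric])
    also have "(\<lambda>n. \<integral>x. of_real (\<alpha> n) * cis (real (Suc n) * x) * cis (- real (Suc m) * x) \<partial>circ) = (\<lambda>n. if n = m then of_real (\<alpha> n) else 0)"
      unfolding eq by (auto simp: integral_circ_cis simp del: of_int_diff)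
    finally show ?thesis using sums_unique2[OF sums_single] by metis
  qed
  have conj_sums: "(\<lambda>m. of_real (\<alpha> m) * (g x * cis (- real (Suc m) * x))) sums (g x * cnj (g x))" for x
  proof -
    have "(\<lambda>n. cnj (of_real (\<alpha> n) * cis (real (Suc n) * x))) sums cnj (g x)" using g_sums by (rule sums_cnj[THEN iffD2])
    then have "(\<lambda>n. g x * (cnj (of_real (\<alpha> n) * cis (real (Suc n) * x)))) sums (g x * cnj (g x))" by (rule sums_mult)
    also have "(\<lambda>n. g x * (cnj (of_real (\<alpha> n) * cis (real (Suc n) * x)))) = (\<lambda>n. of_real (\<alpha> n) * (g x * cis (- real (Suc n) * x)))"
      by (simp only: complex_cnj_mult complex_cnj_complex_of_real cis_cnj mult_minus_left mult_minus_right mult_ac)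
    finally show ?thesis .
  qed
  have "(\<lambda>m. \<integral>x. of_real (\<alpha> m) * (g x * cis (- real (Suc m) * x)) \<partial>circ) sums
          (\<integral>x. (\<Sum>m. of_real (\<alpha> m) * (g x * cis (- real (Suc m) * x))) \<partial>circ)"
  proof (rule sums_integral)
    let ?S = "\<Sum>n. \<bar>\<alpha> n\<bar>"
    have int: "integrable circ (\<lambda>x. of_real (\<alpha> m) * (g x * cis (- real (Suc m) * x)))" for m
      by (rule integrable_circ[where B="\<bar>\<alpha> m\<bar> * ?S"]) (use g_bound in \<open>auto simp: norm_mult intro!: mult_left_mono\<close>)
    then show "integrable circ (\<lambda>x. of_real (\<alpha> m) * (g x * cis (- real (Suc m) * x)))" for m .
    show "AE x in circ. summable (\<lambda>m. norm (of_real (\<alpha> m) * (g x * cis (- real (Suc m) * x))))"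
      using \<alpha> by (auto simp: norm_mult intro!: summable_mult2)
    show "summable (\<lambda>m. \<integral>x. norm (of_real (\<alpha> m) * (g x * cis (- real (Suc m) * x))) \<partial>circ)"
    proof (rule summable_comparison_test')
      show "summable (\<lambda>m. \<bar>\<alpha> m\<bar> * ?S)" using \<alpha> by (intro summable_mult2)
      fix m
      have "(\<integral>x. norm (of_real (\<alpha> m) * (g x * cis (- real (Suc m) * x))) \<partial>circ) \<le> \<bar>\<alpha> m\<bar> * ?S"
        using int[of m, THEN integrable_norm] g_bound by (intro circ.integral_le_const) (auto simp: norm_mult intro!: mult_left_mono)
      then show "norm (\<integral>x. norm (of_real (\<alpha> m) * (g x * cis (- real (Suc m) * x))) \<partial>circ) \<le> \<bar>\<alpha> m\<bar> * ?S"
        by simp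
    qed
  qed
  also have "(\<lambda>m. \<integral>x. of_real (\<alpha> m) * (g x * cis (- real (Suc m) * x)) \<partial>circ) = (\<lambda>m. of_real ((\<alpha> m)\<^sup>2))"
    by (simp only: integral_mult_right_zero coeff) (simp add: power2_eq_square)
  also have "(\<lambda>x. \<Sum>m. of_real (\<alpha> m) * (g x * cis (- real (Suc m) * x))) = (\<lambda>x. complex_of_real ((norm (g x))\<^sup>2))"
    by (simp only: sums_unique[OF conj_sums, symmetric] complex_norm_square)
  also have "(\<integral>x. complex_of_real ((norm (g x))\<^sup>2) \<partial>circ) = of_real (\<integral>x. (norm (g x))\<^sup>2 \<partial>circ)"
    by (rule integral_complex_of_real)
  finally have "(\<lambda>m. (\<alpha> m)\<^sup>2) sums (\<integral>x. (norm (g x))\<^sup>2 \<partial>circ)" by (simp only: sums_of_real_iff)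
  then show "(\<integral>x. (norm (f (of_real (x / (2*pi)) + \<i> * of_real y)))\<^sup>2 \<partial>circ) = (\<Sum>n. (a (Suc n) * exp (- 2 * pi * real (Suc n) * y))\<^sup>2)"
    "summable (\<lambda>n. (a (Suc n) * exp (- 2 * pi * real (Suc n) * y))\<^sup>2)"
    by (auto simp: sums_iff g_def \<alpha>_def)
qed

end

section \<open>The completed L-function\<close>

text \<open>The substitution \<open>t = c * exp x\<close> in Euler's integral. In this coordinate
  Mellin transforms become Fourier integrals over the whole line, to which the inversion and shift
  lemmas apply.\<close>

lemma gamma_integral_exp:
  fixes c :: real
  assumes c: "c > 0" and s: "Re s > 0"
  shows "integrable lborel (\<lambda>x. of_real (exp (- (c * exp x))) * exp (s * of_real x))"
    and "(\<integral>x. of_real (exp (- (c * exp x))) * exp (s * of_real x) \<partial>lborel) = of_real c powr (- s) * Gamma s"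
proof -
  define u where "u = (\<lambda>x. of_real (exp (- (c * exp x))) * exp (s * of_real x))"
  have [measurable]: "u \<in> borel_measurable borel" unfolding u_def
    by (intro borel_measurable_continuous_onI continuous_intros)
  define g where "g = (\<lambda>t. of_real t powr (s - 1) / complex_of_real (exp t))"
  have img: "(\<lambda>x. c * exp x) ` UNIV = {0<..}"
  proof safe
    fix t :: real assume "0 < t"
    then have "t = c * exp (ln (t / c))" using c by simp
    then show "t \<in> (\<lambda>x. c * exp x) ` UNIV" by blast
  qed (use c in auto)
  have "g absolutely_integrable_on (\<lambda>x. c * exp x) ` UNIV \<and> integral ((\<lambda>x. c * exp x) ` UNIV) g = Gamma s"
    unfolding img g_def using absolutely_integrable_Gamma_integral'[OF s] Gamma_integral_complex'[OF s] by blast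
  then have "(\<lambda>x. \<bar>c * exp x\<bar> *\<^sub>R g (c * exp x)) absolutely_integrable_on UNIV \<and>
      integral UNIV (\<lambda>x. \<bar>c * exp x\<bar> *\<^sub>R g (c * exp x)) = Gamma s"
    by (subst has_absolute_integral_change_of_variables_real[where g="\<lambda>x. c * exp x"])
       (use c in \<open>auto intro!: derivative_eq_intros inj_onI\<close>)
  also have "(\<lambda>x. \<bar>c * exp x\<bar> *\<^sub>R g (c * exp x)) = (\<lambda>x. of_real c powr s * u x)"
  proof
    fix x
    have "of_real (c * exp x) powr s = of_real c powr s * exp (s * of_real x)"
      using c by (simp add: powr_def Ln_times_of_real algebra_simps exp_add Ln_of_real flip: exp_of_real)
    moreover have "of_real (c * exp x) * of_real (c * exp x) powr (s - 1) = (of_real (c * exp x) :: complex) powr s"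
      using c by (simp add: powr_diff)
    ultimately show "\<bar>c * exp x\<bar> *\<^sub>R g (c * exp x) = of_real c powr s * u x"
      using c by (simp add: g_def u_def scaleR_conv_of_real exp_minus divide_simps mult_ac)
  qed
  finally have *: "(\<lambda>x. of_real c powr s * u x) absolutely_integrable_on UNIV" "integral UNIV (\<lambda>x. of_real c powr s * u x) = Gamma s"
    by auto
  have "integrable lebesgue (\<lambda>x. of_real c powr s * u x)" using *(1) by (simp add: set_integrable_def)
  then have i1: "integrable lborel (\<lambda>x. of_real c powr s * u x)" by (subst (asm) integrable_completion) auto
  have i2: "of_real c powr s * (\<integral>x. u x \<partial>lborel) = Gamma s"
    using integral_lborel[OF i1] *(2) by (simp only: integral_mult_right_zero)
  have "integrable lborel (\<lambda>x. inverse (of_real c powr s) * (of_real c powr s * u x))"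
    by (rule integrable_mult_right[OF i1])
  with c show "integrable lborel u" by (simp flip: mult.assoc)
  from i2 c show "(\<integral>x. u x \<partial>lborel) = of_real c powr (- s) * Gamma s"
    by (simp add: powr_minus field_simps)
qed

context cusp
begin

lemma square_sum_bound:
  obtains C where "C > 0" "\<And>y N. y > 0 \<Longrightarrow> (\<Sum>n<N. (a (Suc n) * exp (- 2 * pi * real (Suc n) * y))\<^sup>2) \<le> C / y ^ k"
proof -
  obtain C where C: "C > 0" "\<And>\<tau>. Im \<tau> > 0 \<Longrightarrow> (Im \<tau>) ^ k * (norm (f \<tau>))\<^sup>2 \<le> C" using hecke_bound by auto
  show thesis
  proof (rule that[OF C(1)])
    fix y :: real and N assume y: "y > 0"
    let ?g = "\<lambda>x. (norm (f (of_real (x / (2*pi)) + \<i> * of_real y)))\<^sup>2"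
    have b: "?g x \<le> C / y ^ k" for x
      using C(2)[of "of_real (x / (2*pi)) + \<i> * of_real y"] y by (simp add: field_simps)
    have "continuous_on UNIV ?g" using y
      by (intro continuous_intros continuous_on_compose2[OF holomorphic_on_imp_continuous_on[OF f_holomorphic]]) auto
    then have "?g \<in> borel_measurable borel" by (rule borel_measurable_continuous_onI)
    then have i: "integrable circ ?g" using b by (intro circ.integrable_const_bound[where B="C / y ^ k"]) auto
    have "(\<Sum>n<N. (a (Suc n) * exp (- 2 * pi * real (Suc n) * y))\<^sup>2) \<le> (\<integral>x. ?g x \<partial>circ)"
      unfolding parseval(1)[OF y] by (rule sum_le_suminf[OF parseval(2)[OF y]]) auto
    also have "\<dots> \<le> C / y ^ k" using i b by (intro circ.integral_le_const) auto
    finally show "(\<Sum>n<N. (a (Suc n) * exp (- 2 * pi * real (Suc n) * y))\<^sup>2) \<le> C / y ^ k" .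
  qed
qed

text \<open>The Parseval bound is summed over \<open>y = 2\<^bsup>-j\<^esup>\<close>; the half of the exponent gained over Hecke's
  coefficient bound is needed because the series must converge on all of \<open>Re s > (k + 1)/2\<close>.\<close>

lemma summable_dirichlet:
  assumes \<sigma>: "\<sigma> > (real k + 1) / 2"
  shows "summable (\<lambda>n. \<bar>a (Suc n)\<bar> * real (Suc n) powr (- \<sigma>))"
proof -
  define e where "e = \<sigma> - (real k + 1) / 2"
  define b where "b = real k + e"
  have e: "e > 0" using \<sigma> by (simp add: e_def)
  have b0: "b > 0" using e by (simp add: b_def)
  obtain C where C: "C > 0" "\<And>y N. y > 0 \<Longrightarrow> (\<Sum>n<N. (a (Suc n) * exp (- 2 * pi * real (Suc n) * y))\<^sup>2) \<le> C / y ^ k"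
    using square_sum_bound by blast
  define g where "g = (\<lambda>n j. 2 powr (- b * real j) * (a (Suc n) * exp (- 2 * pi * real (Suc n) * (1 / 2 ^ j)))\<^sup>2)"
  define D where "D = 2 powr b * exp (4 * pi)"
  have sq: "summable (\<lambda>n. (a (Suc n))\<^sup>2 * real (Suc n) powr (- b))"
  proof (rule summableI_nonneg_bounded)
    fix N
    have term_le: "(a (Suc n))\<^sup>2 * real (Suc n) powr (- b) \<le> D * (\<Sum>j\<le>2*N. g n j)" if "n < N" for n
    proof -
      \<comment> \<open>The dyadic height matched to n: at \<open>y = 1 / 2 ^ j\<close> the squared
        exponential is at least \<open>exp (- 4 * pi)\<close>, and \<open>2 powr (- b * j)\<close>
        is comparable to \<open>real (Suc n) powr (- b)\<close>.\<close>
      obtain j where j: "Suc n \<le> 2 ^ j" "2 ^ j \<le> 2 * Suc n"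
      proof -
        have ex: "\<exists>j. Suc n \<le> 2 ^ j" by (metis less_exp less_imp_le)
        define j where "j = (LEAST j. Suc n \<le> 2 ^ j)"
        have 1: "Suc n \<le> 2 ^ j" unfolding j_def using ex by (rule LeastI_ex)
        have 2: "2 ^ j \<le> 2 * Suc n"
        proof (cases j)
          case (Suc i)
          then have "\<not> Suc n \<le> 2 ^ i" unfolding j_def by (intro not_less_Least) simp
          then show ?thesis using Suc by simp
        qed auto
        from that[OF 1 2] show thesis .
      qed
      have j': "real (Suc n) \<le> 2 ^ j" "2 ^ j \<le> 2 * real (Suc n)"
        using j[THEN of_nat_mono[where 'a=real]] by auto
      have "j < 2 * Suc n" by (rule less_le_trans[OF less_exp j(2)])
      then have jN: "j \<le> 2 * N" using that by simp
      have p: "real (Suc n) powr (- b) \<le> 2 powr b * 2 powr (- b * real j)"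
      proof -
        have "real (Suc n) powr (- b) \<le> (2 ^ j / 2) powr (- b)"
          using j' b0 by (intro powr_mono2') auto
        also have "\<dots> = (2 powr (real j - 1)) powr (- b)" by (simp add: powr_diff powr_realpow)
        also have "\<dots> = 2 powr b * 2 powr (- b * real j)"
          by (simp add: powr_powr algebra_simps flip: powr_add)
        finally show ?thesis .
      qed
      have q: "(a (Suc n))\<^sup>2 \<le> exp (4*pi) * (a (Suc n) * exp (- 2 * pi * real (Suc n) * (1 / 2 ^ j)))\<^sup>2"
      proof -
        have "real (Suc n) * (1 / 2 ^ j) \<le> 1" using j' by simp
        then have "4 * pi * (real (Suc n) * (1 / 2 ^ j)) \<le> 4 * pi * 1" by (intro mult_left_mono) auto
        then have "(a (Suc n))\<^sup>2 * 1 \<le> (a (Suc n))\<^sup>2 * exp (4*pi - 4 * pi * (real (Suc n) * (1 / 2 ^ j)))"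
          by (intro mult_left_mono) auto
        also have "\<dots> = exp (4*pi) * (a (Suc n) * exp (- 2 * pi * real (Suc n) * (1 / 2 ^ j)))\<^sup>2"
        proof -
          have "exp (4*pi - 4 * pi * (real (Suc n) * (1 / 2 ^ j))) = exp (4*pi) * (exp (- 2 * pi * real (Suc n) * (1 / 2 ^ j)))\<^sup>2"
            by (simp add: power2_eq_square flip: exp_add)
          then show ?thesis by (simp only: power_mult_distrib mult_ac)
        qed
        finally show ?thesis by simp
      qed
      have "(a (Suc n))\<^sup>2 * real (Suc n) powr (- b) \<le> (exp (4*pi) * (a (Suc n) * exp (- 2 * pi * real (Suc n) * (1 / 2 ^ j)))\<^sup>2) * (2 powr b * 2 powr (- b * real j))"
        by (intro mult_mono p q) auto
      also have "\<dots> = D * g n j" by (simp add: D_def g_def)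
      also have "\<dots> \<le> D * (\<Sum>j\<le>2*N. g n j)"
        using jN by (intro mult_left_mono member_le_sum) (auto simp: D_def g_def)
      finally show ?thesis .
    qed
    have "(\<Sum>n<N. (a (Suc n))\<^sup>2 * real (Suc n) powr (- b)) \<le> (\<Sum>n<N. D * (\<Sum>j\<le>2*N. g n j))"
      by (intro sum_mono term_le) auto
    also have "\<dots> = D * (\<Sum>j\<le>2*N. \<Sum>n<N. g n j)"
      by (simp add: sum_distrib_left) (rule sum.swap)
    also have "\<dots> \<le> D * (\<Sum>j\<le>2*N. C * (2 powr (- e)) ^ j)"
    proof (intro mult_left_mono sum_mono)
      fix j
      have "(\<Sum>n<N. g n j) = 2 powr (- b * real j) * (\<Sum>n<N. (a (Suc n) * exp (- 2 * pi * real (Suc n) * (1 / 2 ^ j)))\<^sup>2)"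
        by (simp add: g_def sum_distrib_left)
      also have "\<dots> \<le> 2 powr (- b * real j) * (C / (1 / 2 ^ j) ^ k)" by (intro mult_left_mono C(2)) auto
      also have "\<dots> = C * (2 powr (- b * real j) * 2 powr (real k * real j))"
        by (simp add: powr_realpow[symmetric] power_divide powr_powr mult.commute[of "real j"] flip: power_mult)
      also have "2 powr (- b * real j) * 2 powr (real k * real j) = (2 powr (- e)) ^ j"
        by (simp add: b_def powr_power algebra_simps flip: powr_add)
      finally show "(\<Sum>n<N. g n j) \<le> C * (2 powr (- e)) ^ j" .
    qed (auto simp: D_def)
    also have "\<dots> \<le> D * (C * (\<Sum>j. (2 powr (- e)) ^ j))"
    proof (intro mult_left_mono)
      have "summable (\<lambda>j. (2 powr (- e)) ^ j)" using e by (intro summable_geometric) (auto simp: powr_less_one)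
      then have "(\<Sum>j<Suc (2*N). (2 powr (- e)) ^ j) \<le> (\<Sum>j. (2 powr (- e)) ^ j)" by (intro sum_le_suminf) auto
      then show "(\<Sum>j\<le>2*N. C * (2 powr (- e)) ^ j) \<le> C * (\<Sum>j. (2 powr (- e)) ^ j)"
        using C(1) unfolding sum_distrib_left[symmetric] lessThan_Suc_atMost by (intro mult_left_mono) auto
    qed (auto simp: D_def)
    finally show "(\<Sum>n<N. (a (Suc n))\<^sup>2 * real (Suc n) powr (- b)) \<le> D * (C * (\<Sum>j. (2 powr (- e)) ^ j))" .
  qed auto
  have "summable (\<lambda>n. real n powr (- (1 + e)))" using e by (simp add: summable_real_powr_iff)
  then have "summable (\<lambda>n. real (Suc n) powr (- (1 + e)))" by (rule summable_Suc_iff[THEN iffD2])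
  with sq have s: "summable (\<lambda>n. (a (Suc n))\<^sup>2 * real (Suc n) powr (- b) + real (Suc n) powr (- (1 + e)))" by (rule summable_add)
  have t: "\<bar>a (Suc n)\<bar> * real (Suc n) powr (- \<sigma>) \<le> (a (Suc n))\<^sup>2 * real (Suc n) powr (- b) + real (Suc n) powr (- (1 + e))" for n
  proof -
    \<comment> \<open>Since \<open>\<sigma> = b/2 + (1 + e)/2\<close>, the term is a product
      \<open>u * v\<close>, and \<open>2 * (u * v) \<le> u\<^sup>2 + v\<^sup>2\<close> reduces the
      claim to the two convergent series.\<close>
    define u where "u = \<bar>a (Suc n)\<bar> * real (Suc n) powr (- b/2)"
    define v where "v = real (Suc n) powr (- (1 + e)/2)"
    have uv: "\<bar>a (Suc n)\<bar> * real (Suc n) powr (- \<sigma>) = u * v"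
      by (simp add: u_def v_def mult.assoc e_def b_def field_simps flip: powr_add)
    have u2: "u\<^sup>2 = (a (Suc n))\<^sup>2 * real (Suc n) powr (- b)"
      by (simp add: u_def power_mult_distrib powr_power)
    have v2: "v\<^sup>2 = real (Suc n) powr (- (1 + e))"
    proof -
      have "- (1 + e) / 2 + - (1 + e) / 2 = - (1 + e)" by simp
      then show ?thesis unfolding v_def power2_eq_square powr_add[symmetric] by simp
    qed
    have "0 \<le> u\<^sup>2 + v\<^sup>2 - 2 * (u * v)" using zero_le_power2[of "u - v"] by (simp add: power2_diff)
    moreover have "0 \<le> u * v" by (simp add: u_def v_def)
    ultimately have "u * v \<le> u\<^sup>2 + v\<^sup>2" by linarith
    then show ?thesis unfolding uv u2 v2 .
  qed
  have "norm (\<bar>a (Suc n)\<bar> * real (Suc n) powr (- \<sigma>)) \<le> (a (Suc n))\<^sup>2 * real (Suc n) powr (- b) + real (Suc n) powr (- (1 + e))" for n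
    using t[of n] by (simp only: real_norm_def abs_mult abs_idempotent abs_of_nonneg[OF powr_ge_zero])
  then show ?thesis by (intro summable_comparison_test'[OF s])
qed

text \<open>In the coordinate \<open>\<tau> = \<i> * exp X\<close> the strip
  \<open>\<bar>Im X\<bar> < pi/2\<close> is the upper half-plane and \<open>X \<mapsto> - X\<close>
  is the inversion. For \<open>Re X \<ge> 0\<close> the decay is doubly exponential. The other half
  follows by inversion, whose automorphy factor costs \<open>exp (k * \<bar>Re X\<bar>)\<close>;
  hence the rate \<open>m + k\<close> in the first half.\<close>

lemma f_i_exp_decay:
  assumes \<eta>: "0 \<le> \<eta>" "\<eta> < pi/2" and m: "m \<ge> 0"
  obtains K where "K \<ge> 0" "\<And>X. \<bar>Im X\<bar> \<le> \<eta> \<Longrightarrow> norm (f (\<i> * exp X)) \<le> K * exp (- m * \<bar>Re X\<bar>)"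
proof -
  define c where "c = cos \<eta>"
  have c: "c > 0" unfolding c_def using \<eta> by (intro cos_gt_zero_pi) auto
  have Im: "Im (\<i> * exp X) \<ge> exp (Re X) * c" if "\<bar>Im X\<bar> \<le> \<eta>" for X
  proof -
    have "cos \<eta> \<le> cos \<bar>Im X\<bar>" using that \<eta> by (intro cos_monotone_0_pi_le) auto
    then show ?thesis by (simp add: Re_exp c_def)
  qed
  obtain C where C: "C \<ge> 0" "\<And>\<tau>. Im \<tau> \<ge> c \<Longrightarrow> norm (f \<tau>) \<le> C * exp (- 2 * pi * Im \<tau>)"
    using f_exp_decay[OF c] by auto
  define n where "n = nat \<lceil>m + k\<rceil>"
  have n: "real n \<ge> m + k" unfolding n_def by linarith
  obtain K where K: "K > 0" "\<And>u. u \<ge> 0 \<Longrightarrow> u ^ n \<le> K * exp ((2 * pi * c) * u)"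
    using power_exp_le[of "2 * pi * c" n] c by auto
  have pos: "norm (f (\<i> * exp X)) \<le> C * K * exp (- (m + k) * Re X)" if "\<bar>Im X\<bar> \<le> \<eta>" "Re X \<ge> 0" for X
  proof -
    have e1: "exp (Re X) \<ge> 1" using that by simp
    have "c * 1 \<le> c * exp (Re X)" using c e1 by (intro mult_left_mono) auto
    then have "Im (\<i> * exp X) \<ge> c" using Im[OF that(1)] by (simp add: mult.commute)
    from C(2)[OF this] have "norm (f (\<i> * exp X)) \<le> C * exp (- 2 * pi * Im (\<i> * exp X))" .
    also have "\<dots> \<le> C * exp (- (2 * pi * c) * exp (Re X))"
    proof -
      have "2 * pi * (exp (Re X) * c) \<le> 2 * pi * Im (\<i> * exp X)" using Im[OF that(1)] by (intro mult_left_mono) auto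
      then show ?thesis using C(1) by (intro mult_left_mono) (auto simp: mult_ac)
    qed
    also have "\<dots> \<le> C * (K * exp (- (m + k) * Re X))"
    proof (intro mult_left_mono)
      have "exp (Re X) ^ n \<le> K * exp ((2 * pi * c) * exp (Re X))" using K(2) by simp
      then have "exp (- (2 * pi * c) * exp (Re X)) \<le> K * exp (- (real n * Re X))"
        by (simp add: exp_minus field_simps flip: exp_of_nat_mult)
      also have "\<dots> \<le> K * exp (- (m + k) * Re X)"
      proof -
        have "(m + k) * Re X \<le> real n * Re X" using n that(2) by (intro mult_right_mono) auto
        moreover have "- (m + k) * Re X = - ((m + k) * Re X)" by (simp only: mult_minus_left)
        ultimately have "- (real n * Re X) \<le> - (m + k) * Re X" by linarith
        then show ?thesis using K(1) by (intro mult_left_mono) auto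
      qed
      finally show "exp (- (2 * pi * c) * exp (Re X)) \<le> K * exp (- (m + k) * Re X)" .
    qed (use C in auto)
    finally show ?thesis by simp
  qed
  have CK: "C * K \<ge> 0" using C K by simp
  show thesis
  proof (rule that[OF CK])
    fix X assume X: "\<bar>Im X\<bar> \<le> \<eta>"
    show "norm (f (\<i> * exp X)) \<le> C * K * exp (- m * \<bar>Re X\<bar>)"
    proof (cases "Re X \<ge> 0")
      case True
      have "m * Re X \<le> (m + k) * Re X" using True by (intro mult_right_mono) auto
      then have "exp (- (m + k) * Re X) \<le> exp (- m * \<bar>Re X\<bar>)" using True by (simp add: algebra_simps)
      then show ?thesis using pos[OF X True] CK by (meson mult_left_mono order_trans)
    next
      case False
      have "exp (Re X) * c > 0" using c by simp
      then have I: "Im (\<i> * exp X) > 0" using Im[OF X] by linarith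
      have "- 1 / (\<i> * exp X) = \<i> * exp (- X)" by (simp add: exp_minus field_simps)
      then have "f (\<i> * exp (- X)) = (\<i> * exp X) ^ k * f (\<i> * exp X)" using f_inversion[OF I] by simp
      then have "norm (f (\<i> * exp (- X))) = exp (real k * Re X) * norm (f (\<i> * exp X))"
        by (simp add: norm_mult norm_power power_mult_distrib flip: exp_of_nat_mult)
      then have "norm (f (\<i> * exp X)) = exp (- (real k * Re X)) * norm (f (\<i> * exp (- X)))"
        by (simp add: exp_minus)
      also have "\<dots> \<le> exp (- (real k * Re X)) * (C * K * exp (- (m + k) * Re (- X)))"
        using X False by (intro mult_left_mono pos) auto
      also have "\<dots> = C * K * (exp (- (real k * Re X)) * exp (- (m + k) * Re (- X)))" by simp
      also have "exp (- (real k * Re X)) * exp (- (m + k) * Re (- X)) = exp (- m * \<bar>Re X\<bar>)"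
        using False by (simp add: algebra_simps flip: exp_add)
      finally show ?thesis .
    qed
  qed
qed

lemma f_i_exp_holomorphic: "(\<lambda>X. f (\<i> * exp X)) holomorphic_on {X. \<bar>Im X\<bar> < pi/2}"
proof -
  have "f \<circ> (\<lambda>X. \<i> * exp X) holomorphic_on {X. \<bar>Im X\<bar> < pi/2}"
  proof (rule holomorphic_on_compose_gen[OF _ f_holomorphic])
    show "(\<lambda>X. \<i> * exp X) ` {X. \<bar>Im X\<bar> < pi / 2} \<subseteq> {\<tau>. 0 < Im \<tau>}"
      by (auto simp: Re_exp abs_less_iff intro!: mult_pos_pos cos_gt_zero_pi)
  qed (intro holomorphic_intros)
  then show ?thesis by (simp add: o_def)
qed

lemma f_i_exp_continuous: "continuous_on UNIV (\<lambda>x::real. f (\<i> * exp (of_real x)))"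
  by (rule continuous_on_compose2[OF holomorphic_on_imp_continuous_on[OF f_i_exp_holomorphic]])
     (auto intro!: continuous_intros)

text \<open>The completed L-function, as the Mellin transform of \<open>f (\<i> * y)\<close> with
  \<open>y = exp x\<close>. The integral converges for every s, so it carries the analytic
  continuation.\<close>

definition Lam :: "complex \<Rightarrow> complex" where
  "Lam s = (\<integral>x. f (\<i> * exp (of_real x)) * exp (s * of_real x) \<partial>lborel)"

lemma Lam_integrand_bound:
  obtains K where "K \<ge> 0"
    "\<And>s x. \<bar>Re s\<bar> \<le> R \<Longrightarrow> norm (f (\<i> * exp (of_real x)) * exp (s * of_real x)) \<le> K * exp (- 1 * \<bar>x\<bar>)"
proof -
  obtain K where K: "K \<ge> 0" "\<And>X. \<bar>Im X\<bar> \<le> 0 \<Longrightarrow> norm (f (\<i> * exp X)) \<le> K * exp (- (\<bar>R\<bar> + 1) * \<bar>Re X\<bar>)"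
    using f_i_exp_decay[of 0 "\<bar>R\<bar> + 1"] by auto
  show thesis
  proof (rule that[OF K(1)])
    fix s x assume s: "\<bar>Re s\<bar> \<le> R"
    have "Re s * x \<le> \<bar>Re s\<bar> * \<bar>x\<bar>" by (metis abs_ge_self abs_mult)
    also have "\<dots> \<le> \<bar>R\<bar> * \<bar>x\<bar>" using s by (intro mult_right_mono) auto
    finally have "norm (f (\<i> * exp (of_real x)) * exp (s * of_real x)) \<le> K * exp (- (\<bar>R\<bar> + 1) * \<bar>x\<bar>) * exp (\<bar>R\<bar> * \<bar>x\<bar>)"
      unfolding norm_mult using K(2)[of "of_real x"] K(1) by (intro mult_mono) auto
    also have "\<dots> = K * exp (- 1 * \<bar>x\<bar>)" by (simp add: mult.assoc algebra_simps flip: exp_add)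
    finally show "norm (f (\<i> * exp (of_real x)) * exp (s * of_real x)) \<le> K * exp (- 1 * \<bar>x\<bar>)" .
  qed
qed

lemma Lam_integrable: "integrable lborel (\<lambda>x. f (\<i> * exp (of_real x)) * exp (s * of_real x))"
proof -
  obtain K where K: "K \<ge> 0" "\<And>t x. \<bar>Re t\<bar> \<le> \<bar>Re s\<bar> \<Longrightarrow> norm (f (\<i> * exp (of_real x)) * exp (t * of_real x)) \<le> K * exp (- 1 * \<bar>x\<bar>)"
    using Lam_integrand_bound[of "\<bar>Re s\<bar>"] by metis
  show ?thesis
  proof (rule Bochner_Integration.integrable_bound)
    show "integrable lborel (\<lambda>x. K * exp (- 1 * \<bar>x\<bar>))" by (intro integrable_mult_right integrable_exp_abs) auto
    show "(\<lambda>x. f (\<i> * exp (of_real x)) * exp (s * of_real x)) \<in> borel_measurable lborel"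
      unfolding measurable_lborel2 by (intro borel_measurable_continuous_onI continuous_intros f_i_exp_continuous)
    show "AE x in lborel. norm (f (\<i> * exp (of_real x)) * exp (s * of_real x)) \<le> norm (K * exp (- 1 * \<bar>x\<bar>))"
      by (rule AE_I2) (rule order.trans[OF K(2)[OF order.refl]], simp)
  qed
qed

text \<open>Integrals over \<open>{- real n..real n}\<close> are holomorphic in s by differentiation
  under the integral sign, and they converge uniformly on discs because one exponential bound serves
  all s with bounded real part.\<close>

lemma Lam_holomorphic: "Lam holomorphic_on UNIV"
proof -
  let ?u = "\<lambda>s x. f (\<i> * exp (of_real x)) * exp (s * of_real x)"
  define L where "L = (\<lambda>(n::nat) s. integral (cbox (- real n) (real n)) (\<lambda>x. ?u s x))"
  have hol: "L n holomorphic_on UNIV" for n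
    unfolding L_def
  proof (rule leibniz_rule_holomorphic)
    show "((\<lambda>s. ?u s x) has_field_derivative (?u s x * of_real x)) (at s within UNIV)" for s x
      by (auto intro!: derivative_eq_intros)
    show "?u s integrable_on cbox (- real n) (real n)" for s
      by (intro integrable_continuous continuous_intros continuous_on_subset[OF f_i_exp_continuous]) auto
    show "continuous_on (UNIV \<times> cbox (- real n) (real n)) (\<lambda>(s, x). ?u s x * of_real x)"
      unfolding case_prod_unfold
      by (intro continuous_intros continuous_on_compose2[OF f_i_exp_continuous]) auto
  qed auto
  have lim: "\<exists>d>0. cball s0 d \<subseteq> UNIV \<and> uniform_limit (cball s0 d) L Lam sequentially" for s0
  proof -
    define R where "R = \<bar>Re s0\<bar> + 1"
    obtain K where K: "K \<ge> 0" "\<And>t x. \<bar>Re t\<bar> \<le> R \<Longrightarrow> norm (?u t x) \<le> K * exp (- 1 * \<bar>x\<bar>)"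
      using Lam_integrand_bound[of R] by metis
    define J where "J = (\<integral>x. exp (- (1/2) * \<bar>x::real\<bar>) \<partial>lborel)"
    have close: "norm (L n s - Lam s) \<le> K * exp (- (1/2) * real n) * J" if s: "s \<in> cball s0 1" for s n
    proof -
      have "\<bar>Re s - Re s0\<bar> \<le> 1" using s abs_Re_le_cmod[of "s - s0"] by (simp add: dist_norm norm_minus_commute)
      then have sR: "\<bar>Re s\<bar> \<le> R" by (simp add: R_def)
      have i1: "set_integrable lborel {- real n..real n} (?u s)"
        unfolding set_integrable_def by (rule integrable_mult_indicator[OF _ Lam_integrable]) simp
      have "L n s = (LINT x:{- real n..real n}|lborel. ?u s x)"
        using set_borel_integral_eq_integral(2)[OF i1] by (simp add: L_def cbox_interval)
      then have "L n s - Lam s = (\<integral>x. indicator {- real n..real n} x *\<^sub>R ?u s x - ?u s x \<partial>lborel)"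
        using i1 Lam_integrable[of s] unfolding Lam_def set_lebesgue_integral_def set_integrable_def by simp
      also have "norm \<dots> \<le> (\<integral>x. K * exp (- (1/2) * real n) * exp (- (1/2) * \<bar>x\<bar>) \<partial>lborel)"
      proof (rule Bochner_Integration.integral_norm_bound_integral)
        show "integrable lborel (\<lambda>x. indicator {- real n..real n} x *\<^sub>R ?u s x - ?u s x)"
          using i1 Lam_integrable[of s] unfolding set_integrable_def by (rule Bochner_Integration.integrable_diff)
        show "integrable lborel (\<lambda>x. K * exp (- (1/2) * real n) * exp (- (1/2) * \<bar>x\<bar>))"
          by (rule integrable_mult_right[OF integrable_exp_abs]) simp
        fix x
        show "norm (indicator {- real n..real n} x *\<^sub>R ?u s x - ?u s x) \<le> K * exp (- (1/2) * real n) * exp (- (1/2) * \<bar>x\<bar>)"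
        proof (cases "x \<in> {- real n..real n}")
          case True
          then show ?thesis using K(1) by simp
        next
          case False
          then have "\<bar>x\<bar> \<ge> real n" by auto
          then have "exp (- 1 * \<bar>x\<bar>) \<le> exp (- (1/2) * real n) * exp (- (1/2) * \<bar>x\<bar>)" by (simp flip: exp_add)
          then have "K * exp (- 1 * \<bar>x\<bar>) \<le> K * (exp (- (1/2) * real n) * exp (- (1/2) * \<bar>x\<bar>))" using K(1) by (rule mult_left_mono)
          then show ?thesis using K(2)[OF sR, of x] False by simp
        qed
      qed
      also have "\<dots> = K * exp (- (1/2) * real n) * J" unfolding J_def by (rule integral_mult_right_zero)
      finally show ?thesis .
    qed
    have "uniform_limit (cball s0 1) L Lam sequentially"
    proof (rule uniform_limitI)
      fix e :: real assume "e > 0"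
      have "(\<lambda>n. K * exp (- (1/2) * real n) * J) \<longlonglongrightarrow> 0" by real_asymp
      then have "\<forall>\<^sub>F n in sequentially. K * exp (- (1/2) * real n) * J < e" using \<open>e > 0\<close> by (rule order_tendstoD(2))
      then show "\<forall>\<^sub>F n in sequentially. \<forall>s\<in>cball s0 1. dist (L n s) (Lam s) < e"
        by eventually_elim (unfold dist_norm, intro ballI, rule le_less_trans[OF close], assumption+)
    qed
    then show ?thesis by (intro exI[of _ 1]) auto
  qed
  show ?thesis by (rule holomorphic_uniform_sequence[OF open_UNIV hol lim])
qed

text \<open>Termwise integration of the expansion. The sum of the integrals of absolute values is,
  up to a constant, the absolute Dirichlet series at \<open>Re s\<close>, whose convergence is
  \<open>summable_dirichlet\<close>.\<close>

lemma Lam_sums: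
  assumes s: "Re s > (real k + 1) / 2"
  shows "(\<lambda>n. of_real (a (Suc n)) * (of_real (2 * pi * real (Suc n)) powr (- s) * Gamma s)) sums Lam s"
proof -
  have s0: "Re s > 0" using s by (simp add: field_simps)
  let ?t = "\<lambda>n x. of_real (a (Suc n)) * (of_real (exp (- ((2 * pi * real (Suc n)) * exp x))) * exp (s * of_real x))"
  have c: "2 * pi * real (Suc n) > 0" for n by simp
  have int: "integrable lborel (?t n)" for n by (intro integrable_mult_right gamma_integral_exp(1)[OF c s0])
  have ptw: "(\<lambda>n. ?t n x) sums (f (\<i> * exp (of_real x)) * exp (s * of_real x))" for x
  proof -
    have I: "Im (\<i> * exp (of_real x)) > 0" by (simp add: Re_exp)
    have "exp (2 * of_real pi * \<i> * of_nat (Suc n) * (\<i> * exp (of_real x))) = complex_of_real (exp (- ((2 * pi * real (Suc n)) * exp x)))" for n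
    proof -
      have "2 * of_real pi * \<i> * of_nat (Suc n) * (\<i> * exp (of_real x)) = complex_of_real (- ((2 * pi * real (Suc n)) * exp x))"
        by (simp add: exp_of_real[symmetric] del: of_nat_Suc)
      then show ?thesis by (simp only: exp_of_real)
    qed
    then show ?thesis using sums_mult2[OF f_sums[OF I], of "exp (s * of_real x)"] by (simp add: mult.assoc)
  qed
  have norm_t: "(\<integral>x. norm (?t n x) \<partial>lborel) = \<bar>a (Suc n)\<bar> * real (Suc n) powr (- Re s) * ((2*pi) powr (- Re s) * \<bar>Gamma (Re s)\<bar>)" for n
  proof -
    let ?v = "\<lambda>x. exp (- ((2 * pi * real (Suc n)) * exp x)) * exp (Re s * x)"
    have "(\<integral>x. norm (?t n x) \<partial>lborel) = (\<integral>x. \<bar>a (Suc n)\<bar> * ?v x \<partial>lborel)"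
      by (simp add: norm_mult del: of_nat_Suc)
    also have "\<dots> = \<bar>a (Suc n)\<bar> * (\<integral>x. ?v x \<partial>lborel)" by (rule integral_mult_right_zero)
    also have "(\<integral>x. ?v x \<partial>lborel) = norm (complex_of_real (\<integral>x. ?v x \<partial>lborel))"
      by (simp add: integral_nonneg_AE)
    also have "complex_of_real (\<integral>x. ?v x \<partial>lborel) = (\<integral>x. complex_of_real (?v x) \<partial>lborel)" by (rule integral_complex_of_real[symmetric])
    also have "(\<lambda>x. complex_of_real (?v x)) = (\<lambda>x. of_real (exp (- ((2 * pi * real (Suc n)) * exp x))) * exp (of_real (Re s) * of_real x))"
      by (simp flip: exp_of_real)
    also have "(\<integral>x. complex_of_real (exp (- ((2 * pi * real (Suc n)) * exp x))) * exp (of_real (Re s) * of_real x) \<partial>lborel) = of_real (2 * pi * real (Suc n)) powr (- of_real (Re s)) * Gamma (of_real (Re s))"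
      by (rule gamma_integral_exp(2)[OF c]) (use s0 in simp)
    also have "norm \<dots> = real (Suc n) powr (- Re s) * ((2*pi) powr (- Re s) * \<bar>Gamma (Re s)\<bar>)"
      by (simp add: norm_mult norm_powr_real_powr powr_mult Gamma_complex_of_real mult_ac del: of_nat_Suc of_real_mult)
    finally show ?thesis by simp
  qed
  have "(\<lambda>n. integral\<^sup>L lborel (?t n)) sums (\<integral>x. (\<Sum>n. ?t n x) \<partial>lborel)"
  proof (rule sums_integral[OF int])
    show "summable (\<lambda>n. \<integral>x. norm (?t n x) \<partial>lborel)"
      unfolding norm_t using summable_dirichlet[OF s] by (intro summable_mult2) 
    show "AE x in lborel. summable (\<lambda>n. norm (?t n x))"
    proof (rule AE_I2)
      fix x
      have "summable (\<lambda>n. (\<bar>a (Suc n)\<bar> * exp (- 2 * pi * real n * exp x)) * (exp (- 2 * pi * exp x) * norm (exp (s * of_real x))))"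
        by (intro summable_mult2 summable_coeffs) auto
      also have "(\<lambda>n. (\<bar>a (Suc n)\<bar> * exp (- 2 * pi * real n * exp x)) * (exp (- 2 * pi * exp x) * norm (exp (s * of_real x)))) = (\<lambda>n. norm (?t n x))"
      proof
        fix n
        have "exp (- 2 * pi * real n * exp x) * exp (- 2 * pi * exp x) = exp (- ((2 * pi * real (Suc n)) * exp x))"
          by (simp add: algebra_simps flip: exp_add)
        then show "(\<bar>a (Suc n)\<bar> * exp (- 2 * pi * real n * exp x)) * (exp (- 2 * pi * exp x) * norm (exp (s * of_real x))) = norm (?t n x)"
          by (simp only: norm_mult norm_of_real abs_exp_cancel mult.assoc[symmetric]) 
             (simp only: mult.assoc)
      qed
      finally show "summable (\<lambda>n. norm (?t n x))" .
    qed
  qed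
  also have "(\<lambda>x. \<Sum>n. ?t n x) = (\<lambda>x. f (\<i> * exp (of_real x)) * exp (s * of_real x))"
    by (rule ext) (rule sums_unique[OF ptw, symmetric])
  also have "(\<lambda>n. integral\<^sup>L lborel (?t n)) = (\<lambda>n. of_real (a (Suc n)) * (of_real (2 * pi * real (Suc n)) powr (- s) * Gamma s))"
    by (simp only: integral_mult_right_zero gamma_integral_exp(2)[OF c s0])
  finally show ?thesis by (simp only: Lam_def)
qed

text \<open>\<open>rGamma\<close> is entire, so removing the Gamma factor creates no poles. The
  product has the defining property of the continuation, and the identity theorem supplies the
  uniqueness behind the definite description.\<close>

lemma cusp_L_eq: "cusp_L k (\<lambda>n. complex_of_real (a n)) s = of_real (2 * pi) powr s * Lam s * rGamma s"
proof -
  define L where "L = (\<lambda>s. of_real (2 * pi) powr s * Lam s * rGamma s)"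
  let ?P = "\<lambda>L. L holomorphic_on UNIV \<and>
     (\<forall>s. Re s > (real k + 1) / 2 \<longrightarrow> (\<lambda>n. complex_of_real (a (Suc n)) * of_nat (Suc n) powr (- s)) sums L s)"
  have PL: "?P L"
  proof (intro conjI allI impI)
    show "L holomorphic_on UNIV" unfolding L_def
      by (intro holomorphic_intros Lam_holomorphic)
    fix s assume s: "Re s > (real k + 1) / 2"
    have "Gamma s * rGamma s = 1"
    proof -
      have "Re s > 0" using s by (simp add: field_simps)
      then have "s \<notin> \<int>\<^sub>\<le>\<^sub>0" by (auto elim!: nonpos_Ints_cases)
      then show ?thesis by (simp add: rGamma_inverse_Gamma Gamma_eq_zero_iff)
    qed
    then have "of_real (a (Suc n)) * (of_real (2 * pi * real (Suc n)) powr (- s) * Gamma s) * (of_real (2 * pi) powr s * rGamma s)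
       = complex_of_real (a (Suc n)) * of_nat (Suc n) powr (- s)" for n
    proof -
      have "complex_of_real (2 * pi * real (Suc n)) powr (- s) = of_real (2 * pi) powr (- s) * of_nat (Suc n) powr (- s)"
        by (simp add: powr_times_real del: of_nat_Suc)
      moreover have "complex_of_real (2 * pi) powr (- s) * of_real (2 * pi) powr s = 1" by (simp flip: powr_add)
      ultimately have "of_real (a (Suc n)) * (of_real (2 * pi * real (Suc n)) powr (- s) * Gamma s) * (of_real (2 * pi) powr s * rGamma s)
        = complex_of_real (a (Suc n)) * of_nat (Suc n) powr (- s) * (complex_of_real (2 * pi) powr (- s) * of_real (2 * pi) powr s) * (Gamma s * rGamma s)"
        by (simp only: mult_ac)
      then show ?thesis
        unfolding \<open>Gamma s * rGamma s = 1\<close> \<open>complex_of_real (2 * pi) powr (- s) * of_real (2 * pi) powr s = 1\<close> by simp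
    qed
    with sums_mult2[OF Lam_sums[OF s], of "of_real (2 * pi) powr s * rGamma s"]
    show "(\<lambda>n. complex_of_real (a (Suc n)) * of_nat (Suc n) powr (- s)) sums L s"
      by (simp only: L_def mult_ac)
  qed
  have "cusp_L k (\<lambda>n. complex_of_real (a n)) = L"
    unfolding cusp_L_def
  proof (rule the_equality[where P="?P" and a=L])
    show "?P L" by (rule PL)
    fix L' assume L': "?P L'"
    show "L' = L"
    proof
      fix s
      show "L' s = L s"
      proof (rule analytic_continuation_open[of "{s. Re s > (real k + 1) / 2}" UNIV L' L])
        show "open {s. Re s > (real k + 1) / 2}" by (rule open_halfspace_Re_gt)
        show "{s. Re s > (real k + 1) / 2} \<noteq> {}" by (auto intro!: exI[of _ "of_real (real k + 2)"] simp: field_simps)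
        show "L' s = L s" if "s \<in> {s. Re s > (real k + 1) / 2}" for s
          using that L' PL sums_unique2 by blast
      qed (use L' PL in auto)
    qed
  qed
  then show ?thesis by (simp add: L_def)
qed

end

section \<open>Kummer's function as a circle integral\<close>

lemma fact_eq_pochhammer: "fact (m + n) = (fact m * pochhammer (of_nat (Suc m)) n :: complex)"
proof (induction n)
  case (Suc n)
  have "fact (m + Suc n) = (of_nat (Suc m) + of_nat n) * (fact (m + n) :: complex)" by (simp add: algebra_simps)
  then show ?case using Suc by (simp add: pochhammer_rec' algebra_simps)
qed auto

text \<open>Expand \<open>(1 - w / v) powr (- a)\<close> binomially on the circle
  \<open>norm v = R\<close>. Averaging against \<open>exp v / v ^ (k - 1)\<close> turns
  \<open>1 / v ^ n\<close> into \<open>1 / fact (k - 1 + n)\<close>, which is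
  \<open>1 / (fact (k - 1) * pochhammer k n)\<close>. The parameter a then occurs only in an
  exponent, and the radius R remains free.\<close>

lemma kummer_1F1_circle:
  fixes a w :: complex
  assumes k: "k > 0" and w: "norm w < R"
  defines "T \<equiv> (\<lambda>n. pochhammer a n / pochhammer (of_nat k) n * (w ^ n / fact n))"
  shows "summable T"
    and "kummer_1F1 a (of_nat k) w = fact (k - 1) *
      (\<integral>x. exp (of_real R * cis x) / (of_real R * cis x) ^ (k - 1) * (1 - w / (of_real R * cis x)) powr (- a) \<partial>circ)"
proof -
  have R: "R > 0" using w norm_ge_zero[of w] by linarith
  define v where "v = (\<lambda>x. of_real R * cis x)"
  have nv: "norm (v x) = R" "v x \<noteq> 0" for x using R by (auto simp: v_def norm_mult)
  have [measurable]: "v \<in> borel_measurable borel" unfolding v_def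
    by (intro borel_measurable_continuous_onI continuous_intros)
  define B where "B = (\<lambda>n x. (- a gchoose n) * (- w) ^ n * (exp (v x) / v x ^ (k - 1 + n)))"
  have B_sums: "(\<lambda>n. B n x) sums (exp (v x) / v x ^ (k - 1) * (1 - w / v x) powr (- a))" for x
  proof -
    have "norm (- w / v x) < 1" using w R nv by (simp add: norm_divide)
    then have "(\<lambda>n. (- a gchoose n) * (- w / v x) ^ n) sums (1 + (- w / v x)) powr (- a)" by (rule gen_binomial_complex)
    then have "(\<lambda>n. exp (v x) / v x ^ (k - 1) * ((- a gchoose n) * (- w / v x) ^ n)) sums (exp (v x) / v x ^ (k - 1) * (1 + (- w / v x)) powr (- a))"
      by (rule sums_mult)
    also have "(\<lambda>n. exp (v x) / v x ^ (k - 1) * ((- a gchoose n) * (- w / v x) ^ n)) = (\<lambda>n. B n x)"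
      by (rule ext, unfold B_def power_add power_divide) (simp only: times_divide_eq_left times_divide_eq_right divide_divide_eq_left mult_ac)
    finally show ?thesis by simp
  qed
  define N where "N = (\<lambda>n. norm ((- a gchoose n) * (of_real (norm w / R)) ^ n) * (exp R / R ^ (k - 1)))"
  have normB: "norm (B n x) \<le> N n" for n x
  proof -
    have "norm (exp (v x)) \<le> exp R" using nv(1)[of x] by (metis norm_exp)
    then have "norm (B n x) \<le> norm (- a gchoose n) * norm w ^ n * (exp R / R ^ (k - 1 + n))"
      using R by (auto simp: B_def norm_mult norm_divide norm_power nv intro!: mult_left_mono divide_right_mono)
    also have "\<dots> = N n" using R by (simp add: N_def norm_mult norm_power norm_divide power_divide power_add)
    finally show ?thesis .
  qed
  have N_summable: "summable N"
  proof -
    define r where "r = (norm w / R + 1) / 2"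
    have r: "norm w / R < r" "r < 1" using w R by (auto simp: r_def field_simps)
    have r0: "r > 0" using r R by (meson divide_nonneg_pos le_less_trans norm_ge_zero)
    have "summable (\<lambda>n. (- a gchoose n) * (of_real r) ^ n)"
      using gen_binomial_complex[of "of_real r" "- a"] r r0 by (auto simp: sums_iff)
    then have "summable (\<lambda>n. norm ((- a gchoose n) * (of_real (norm w / R)) ^ n))"
      by (rule powser_insidea) (use r r0 R in \<open>simp add: norm_divide\<close>)
    then show ?thesis unfolding N_def by (rule summable_mult2)
  qed
  have B_meas: "B n \<in> borel_measurable borel" for n unfolding B_def by measurable
  have B_int: "(\<integral>x. B n x \<partial>circ) = T n / fact (k - 1)" for n
  proof -
    have m: "exp (v x) / v x ^ (k - 1 + n) = of_real (1 / R ^ (k - 1 + n)) * (exp (of_real R * cis x) * cis (- of_nat (k - 1 + n) * x))" for x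
    proof -
      have "inverse (cis x ^ (k - 1 + n)) = cis (- of_nat (k - 1 + n) * x)"
        by (simp only: Complex.DeMoivre cis_inverse mult_minus_left)
      then show ?thesis unfolding v_def power_mult_distrib divide_inverse inverse_mult_distrib
        by (simp add: of_real_inverse power_inverse mult_ac)
    qed
    have "(\<integral>x. B n x \<partial>circ) = ((- a gchoose n) * (- w) ^ n * of_real (1 / R ^ (k - 1 + n))) * (\<integral>x. exp (of_real R * cis x) * cis (- of_nat (k - 1 + n) * x) \<partial>circ)"
      unfolding B_def m by (simp only: mult.assoc[symmetric] integral_mult_right_zero)
        (simp only: mult.assoc integral_mult_right_zero)
    also have "\<dots> = (- a gchoose n) * (- w) ^ n / fact (k - 1 + n)"
      unfolding integral_circ_exp using R by simp
    also have "(- a gchoose n) = (- 1) ^ n * pochhammer a n / fact n" by (simp add: gbinomial_pochhammer)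
    also have "fact (k - 1 + n) = (fact (k - 1) * pochhammer (of_nat k) n :: complex)"
      using fact_eq_pochhammer[of "k - 1" n] k by simp
    also have "(- 1) ^ n * pochhammer a n / fact n * (- w) ^ n = pochhammer a n / fact n * w ^ n"
      by (simp add: mult_ac flip: power_mult_distrib)
    finally show ?thesis by (simp add: T_def mult_ac)
  qed
  have "(\<lambda>n. integral\<^sup>L circ (B n)) sums (\<integral>x. (\<Sum>n. B n x) \<partial>circ)"
  proof (rule sums_integral)
    show i: "integrable circ (B n)" for n by (rule integrable_circ[OF B_meas normB])
    show "AE x in circ. summable (\<lambda>n. norm (B n x))"
      by (rule AE_I2) (rule summable_comparison_test'[OF N_summable], simp add: normB)
    show "summable (\<lambda>n. \<integral>x. norm (B n x) \<partial>circ)"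
    proof (rule summable_comparison_test'[OF N_summable])
      fix n
      have "(\<integral>x. norm (B n x) \<partial>circ) \<le> N n"
        using integrable_norm[OF i[of n]] normB by (intro circ.integral_le_const) auto
      then show "norm (\<integral>x. norm (B n x) \<partial>circ) \<le> N n" by simp
    qed
  qed
  also have "(\<lambda>x. \<Sum>n. B n x) = (\<lambda>x. exp (v x) / v x ^ (k - 1) * (1 - w / v x) powr (- a))"
    by (rule ext) (rule sums_unique[OF B_sums, symmetric])
  finally have s: "(\<lambda>n. T n / fact (k - 1)) sums (\<integral>x. exp (v x) / v x ^ (k - 1) * (1 - w / v x) powr (- a) \<partial>circ)"
    unfolding B_int .
  have "(\<lambda>n. fact (k - 1) * (T n / fact (k - 1))) sums (fact (k - 1) * (\<integral>x. exp (v x) / v x ^ (k - 1) * (1 - w / v x) powr (- a) \<partial>circ))"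
    using s by (rule sums_mult)
  then have "T sums (fact (k - 1) * (\<integral>x. exp (v x) / v x ^ (k - 1) * (1 - w / v x) powr (- a) \<partial>circ))" by simp
  then show "summable T" "kummer_1F1 a (of_nat k) w = fact (k - 1) *
      (\<integral>x. exp (of_real R * cis x) / (of_real R * cis x) ^ (k - 1) * (1 - w / (of_real R * cis x)) powr (- a) \<partial>circ)"
    by (simp_all add: sums_iff kummer_1F1_def T_def v_def)
qed

lemma cnj_kummer_1F1:
  assumes "k > 0"
  shows "cnj (kummer_1F1 a (of_nat k) (of_real w)) = kummer_1F1 (cnj a) (of_nat k) (of_real w)"
proof -
  have s: "summable (\<lambda>n. pochhammer a n / pochhammer (of_nat k) n * (complex_of_real w ^ n / fact n))"
    by (rule kummer_1F1_circle(1)[OF assms, where R="\<bar>w\<bar> + 1"]) simp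
  have p: "cnj (pochhammer b n) = pochhammer (cnj b) n" for b n
    by (induction n) (auto simp: pochhammer_rec')
  show ?thesis unfolding kummer_1F1_def
    using bounded_linear.suminf[OF bounded_linear_cnj s] by (simp add: p)
qed

section \<open>The transform on the critical line\<close>

context cusp
begin

text \<open>Moving the line of integration to height \<open>\<eta>\<close> rotates the ray in the
  upper half-plane. The factor \<open>exp (\<i> * s * \<eta>)\<close> that it brings is the source
  of the decay in \<open>Im s\<close>.\<close>

lemma Lam_shift:
  assumes \<eta>: "\<bar>\<eta>\<bar> < pi/2"
  shows "integrable lborel (\<lambda>x. f (\<i> * exp (of_real x + \<i> * of_real \<eta>)) * exp (s * (of_real x + \<i> * of_real \<eta>)))"
    and "(\<integral>x. f (\<i> * exp (of_real x + \<i> * of_real \<eta>)) * exp (s * (of_real x + \<i> * of_real \<eta>)) \<partial>lborel) = Lam s"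
proof -
  define q where "q = (\<lambda>X. f (\<i> * exp X) * exp (s * X))"
  have hol: "q holomorphic_on {X. \<bar>Im X\<bar> < pi/2}" unfolding q_def
    by (intro holomorphic_intros f_i_exp_holomorphic)
  obtain K where K: "K \<ge> 0" "\<And>X. \<bar>Im X\<bar> \<le> \<bar>\<eta>\<bar> \<Longrightarrow> norm (f (\<i> * exp X)) \<le> K * exp (- (\<bar>Re s\<bar> + 1) * \<bar>Re X\<bar>)"
    using f_i_exp_decay[of "\<bar>\<eta>\<bar>" "\<bar>Re s\<bar> + 1"] \<eta> by auto
  have b: "norm (q X) \<le> (K * exp (\<bar>Im s\<bar> * \<bar>\<eta>\<bar>)) * exp (- \<bar>Re X\<bar>)" if X: "\<bar>Im X\<bar> \<le> \<bar>\<eta>\<bar>" for X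
  proof -
    have "Re s * Re X \<le> \<bar>Re s\<bar> * \<bar>Re X\<bar>" by (metis abs_ge_self abs_mult)
    moreover have "- (Im s * Im X) \<le> \<bar>Im s\<bar> * \<bar>Im X\<bar>" by (metis abs_ge_minus_self abs_mult)
    moreover have "\<bar>Im s\<bar> * \<bar>Im X\<bar> \<le> \<bar>Im s\<bar> * \<bar>\<eta>\<bar>" using X by (intro mult_left_mono) auto
    ultimately have "Re (s * X) \<le> \<bar>Re s\<bar> * \<bar>Re X\<bar> + \<bar>Im s\<bar> * \<bar>\<eta>\<bar>" by simp
    then have "norm (exp (s * X)) \<le> exp (\<bar>Re s\<bar> * \<bar>Re X\<bar> + \<bar>Im s\<bar> * \<bar>\<eta>\<bar>)" by simp
    then have "norm (q X) \<le> (K * exp (- (\<bar>Re s\<bar> + 1) * \<bar>Re X\<bar>)) * exp (\<bar>Re s\<bar> * \<bar>Re X\<bar> + \<bar>Im s\<bar> * \<bar>\<eta>\<bar>)"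
      unfolding q_def norm_mult using K(1) K(2)[OF X] by (intro mult_mono) auto
    also have "\<dots> = K * (exp (- (\<bar>Re s\<bar> + 1) * \<bar>Re X\<bar>) * exp (\<bar>Re s\<bar> * \<bar>Re X\<bar> + \<bar>Im s\<bar> * \<bar>\<eta>\<bar>))" by simp
    also have "exp (- (\<bar>Re s\<bar> + 1) * \<bar>Re X\<bar>) * exp (\<bar>Re s\<bar> * \<bar>Re X\<bar> + \<bar>Im s\<bar> * \<bar>\<eta>\<bar>) = exp (\<bar>Im s\<bar> * \<bar>\<eta>\<bar>) * exp (- \<bar>Re X\<bar>)"
      by (simp add: algebra_simps flip: exp_add)
    finally show ?thesis by simp
  qed
  show "integrable lborel (\<lambda>x. f (\<i> * exp (of_real x + \<i> * of_real \<eta>)) * exp (s * (of_real x + \<i> * of_real \<eta>)))"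
    using integral_shift_strip(1)[OF hol \<eta> b] unfolding q_def .
  show "(\<integral>x. f (\<i> * exp (of_real x + \<i> * of_real \<eta>)) * exp (s * (of_real x + \<i> * of_real \<eta>)) \<partial>lborel) = Lam s"
    using integral_shift_strip(2)[OF hol \<eta> b] unfolding q_def Lam_def .
qed

definition Xi :: "real \<Rightarrow> complex" where
  "Xi t = Lam (of_nat k / 2 + \<i> * of_real t)"

lemma Xi_continuous: "continuous_on UNIV Xi"
  unfolding Xi_def
  by (rule continuous_on_compose2[OF holomorphic_on_imp_continuous_on[OF Lam_holomorphic]]) (auto intro!: continuous_intros)

lemma Xi_decay:
  assumes \<eta>: "0 \<le> \<eta>" "\<eta> < pi/2"
  obtains C where "C \<ge> 0" "\<And>t. norm (Xi t) \<le> C * exp (- \<eta> * \<bar>t\<bar>)"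
proof -
  obtain K where K: "K \<ge> 0" "\<And>X. \<bar>Im X\<bar> \<le> \<eta> \<Longrightarrow> norm (f (\<i> * exp X)) \<le> K * exp (- (real k / 2 + 1) * \<bar>Re X\<bar>)"
    using f_i_exp_decay[OF \<eta>, of "real k / 2 + 1"] by auto
  define C where "C = (\<integral>x. K * exp (- 1 * \<bar>x::real\<bar>) \<partial>lborel)"
  have C: "C \<ge> 0" unfolding C_def using K(1) by (intro integral_nonneg_AE) auto
  show thesis
  proof (rule that[OF C])
    fix t :: real
    \<comment> \<open>The line is moved to the side on which \<open>exp (- y * t)\<close> is
      small.\<close>
    define y where "y = (if t \<ge> 0 then \<eta> else - \<eta>)"
    have y: "\<bar>y\<bar> \<le> \<eta>" "\<bar>y\<bar> < pi/2" "y * t = \<eta> * \<bar>t\<bar>" using \<eta> by (auto simp: y_def)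
    define s where "s = of_nat k / 2 + \<i> * complex_of_real t"
    let ?u = "\<lambda>x. f (\<i> * exp (of_real x + \<i> * of_real y)) * exp (s * (of_real x + \<i> * of_real y))"
    have "norm (Xi t) = norm (\<integral>x. ?u x \<partial>lborel)" using Lam_shift(2)[OF y(2), of s] by (simp add: Xi_def s_def)
    also have "\<dots> \<le> (\<integral>x. exp (- \<eta> * \<bar>t\<bar>) * (K * exp (- 1 * \<bar>x\<bar>)) \<partial>lborel)"
    proof (rule Bochner_Integration.integral_norm_bound_integral[OF Lam_shift(1)[OF y(2)]])
      show "integrable lborel (\<lambda>x::real. exp (- \<eta> * \<bar>t\<bar>) * (K * exp (- 1 * \<bar>x\<bar>)))"
        by (intro integrable_mult_right integrable_exp_abs) simp
      fix x :: real
      have "Re (s * (of_real x + \<i> * of_real y)) = real k / 2 * x - y * t" by (simp add: s_def)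
      then have e: "norm (exp (s * (of_real x + \<i> * of_real y))) = exp (real k / 2 * x - \<eta> * \<bar>t\<bar>)" using y(3) by simp
      have "norm (?u x) \<le> K * exp (- (real k / 2 + 1) * \<bar>x\<bar>) * exp (real k / 2 * x - \<eta> * \<bar>t\<bar>)"
        unfolding norm_mult e using K(2)[of "of_real x + \<i> * of_real y"] y(1) by (intro mult_right_mono) auto
      also have "\<dots> \<le> K * exp (- (real k / 2 + 1) * \<bar>x\<bar>) * exp (real k / 2 * \<bar>x\<bar> - \<eta> * \<bar>t\<bar>)"
      proof (rule mult_left_mono)
        have "real k / 2 * x \<le> real k / 2 * \<bar>x\<bar>" by (intro mult_left_mono) auto
        then show "exp (real k / 2 * x - \<eta> * \<bar>t\<bar>) \<le> exp (real k / 2 * \<bar>x\<bar> - \<eta> * \<bar>t\<bar>)" by simp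
      qed (use K(1) in simp)
      also have "\<dots> = K * (exp (- (real k / 2 + 1) * \<bar>x\<bar>) * exp (real k / 2 * \<bar>x\<bar> - \<eta> * \<bar>t\<bar>))" by simp
      also have "exp (- (real k / 2 + 1) * \<bar>x\<bar>) * exp (real k / 2 * \<bar>x\<bar> - \<eta> * \<bar>t\<bar>) = exp (- \<eta> * \<bar>t\<bar>) * exp (- 1 * \<bar>x\<bar>)"
        by (simp add: algebra_simps flip: exp_add)
      finally show "norm (?u x) \<le> exp (- \<eta> * \<bar>t\<bar>) * (K * exp (- 1 * \<bar>x\<bar>))" by (simp only: mult_ac)
    qed
    also have "\<dots> = C * exp (- \<eta> * \<bar>t\<bar>)" unfolding C_def integral_mult_right_zero by (rule mult.commute)
    finally show "norm (Xi t) \<le> C * exp (- \<eta> * \<bar>t\<bar>)" .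
  qed
qed

lemma Xi_exp_integrable:
  assumes X: "\<bar>Re \<zeta>\<bar> < pi/2"
  shows "integrable lborel (\<lambda>t. Xi t * exp (\<zeta> * of_real t))"
proof -
  obtain \<eta> where \<eta>: "\<bar>Re \<zeta>\<bar> < \<eta>" "\<eta> < pi/2" using dense[OF X] by blast
  have "0 \<le> \<eta>" using \<eta>(1) by linarith
  from Xi_decay[OF this \<eta>(2)] obtain C where C: "C \<ge> 0" "\<And>t. norm (Xi t) \<le> C * exp (- \<eta> * \<bar>t\<bar>)" by blast
  show ?thesis
    using integrable_power_exp[OF borel_measurable_continuous_onI[OF Xi_continuous] C(2) \<eta>(1), of 0] by simp
qed

text \<open>A contour shift by \<open>Im X\<close> and a translation by \<open>Re X\<close> show
  that \<open>Xi t * exp (- \<i> * X * t)\<close> is the Fourier transform of \<open>h\<close>, the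
  function \<open>Y \<mapsto> exp (k / 2 * Y) * f (\<i> * exp Y)\<close> along the line through X.
  Inversion at the single point 0 therefore covers every X in the strip.\<close>

lemma Xi_inversion:
  assumes X: "\<bar>Im X\<bar> < pi/2"
  shows "(\<integral>t. Xi t * exp (- \<i> * X * of_real t) \<partial>lborel) = of_real (2 * pi) * (exp (of_nat k / 2 * X) * f (\<i> * exp X))"
proof -
  define h where "h = (\<lambda>x. f (\<i> * exp (of_real x + X)) * exp (of_nat k / 2 * (of_real x + X)))"
  have cont: "continuous_on UNIV h"
    unfolding h_def using X
    by (intro continuous_intros continuous_on_compose2[OF holomorphic_on_imp_continuous_on[OF f_i_exp_holomorphic]]) auto
  have F: "(\<integral>x. h x * exp (\<i> * of_real (t * x)) \<partial>lborel) = Xi t * exp (- \<i> * X * of_real t)" for t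
  proof -
    define s where "s = of_nat k / 2 + \<i> * complex_of_real t"
    let ?u = "\<lambda>x. f (\<i> * exp (of_real x + \<i> * of_real (Im X))) * exp (s * (of_real x + \<i> * of_real (Im X)))"
    have "Xi t = (\<integral>x. ?u x \<partial>lborel)" using Lam_shift(2)[OF X, of s] by (simp add: Xi_def s_def)
    also have "\<dots> = (\<integral>x. ?u (Re X + 1 * x) \<partial>lborel)" by (subst lborel_integral_real_affine[of 1 _ "Re X"]) auto
    also have "(\<lambda>x. ?u (Re X + 1 * x)) = (\<lambda>x. exp (\<i> * X * of_real t) * (h x * exp (\<i> * of_real (t * x))))"
    proof
      fix x :: real
      have 1: "of_real (Re X + 1 * x) + \<i> * of_real (Im X) = of_real x + X" by (simp add: complex_eq_iff)
      have "s * (of_real x + X) = \<i> * X * of_real t + (of_nat k / 2 * (of_real x + X) + \<i> * of_real (t * x))"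
        by (simp add: s_def algebra_simps)
      then show "?u (Re X + 1 * x) = exp (\<i> * X * of_real t) * (h x * exp (\<i> * of_real (t * x)))"
        unfolding 1 h_def by (simp only: exp_add mult_ac)
    qed
    also have "(\<integral>x. exp (\<i> * X * of_real t) * (h x * exp (\<i> * of_real (t * x))) \<partial>lborel) = exp (\<i> * X * of_real t) * (\<integral>x. h x * exp (\<i> * of_real (t * x)) \<partial>lborel)"
      by (rule integral_mult_right_zero)
    finally show ?thesis by (simp add: exp_minus field_simps)
  qed
  have "\<exists>M. \<forall>x. norm (h x) \<le> M * exp (- 1 * \<bar>x\<bar>)"
  proof -
    obtain K where K: "K \<ge> 0" "\<And>Y. \<bar>Im Y\<bar> \<le> \<bar>Im X\<bar> \<Longrightarrow> norm (f (\<i> * exp Y)) \<le> K * exp (- (real k / 2 + 1) * \<bar>Re Y\<bar>)"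
      using f_i_exp_decay[of "\<bar>Im X\<bar>" "real k / 2 + 1"] X by auto
    have "norm (h x) \<le> K * exp \<bar>Re X\<bar> * exp (- 1 * \<bar>x\<bar>)" for x
    proof -
      let ?y = "x + Re X"
      have "norm (h x) \<le> K * exp (- (real k / 2 + 1) * \<bar>?y\<bar>) * exp (real k / 2 * ?y)"
        unfolding h_def norm_mult using K(2)[of "of_real x + X"] by (intro mult_mono) (auto simp: K(1))
      also have "\<dots> \<le> K * exp (- (real k / 2 + 1) * \<bar>?y\<bar>) * exp (real k / 2 * \<bar>?y\<bar>)"
      proof (rule mult_left_mono)
        have "real k / 2 * ?y \<le> real k / 2 * \<bar>?y\<bar>" by (intro mult_left_mono) auto
        then show "exp (real k / 2 * ?y) \<le> exp (real k / 2 * \<bar>?y\<bar>)" by simp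
      qed (use K(1) in simp)
      also have "\<dots> = K * (exp (- (real k / 2 + 1) * \<bar>?y\<bar>) * exp (real k / 2 * \<bar>?y\<bar>))" by simp
      also have "exp (- (real k / 2 + 1) * \<bar>?y\<bar>) * exp (real k / 2 * \<bar>?y\<bar>) = exp (- \<bar>?y\<bar>)"
        by (simp add: algebra_simps flip: exp_add)
      also have "K * exp (- \<bar>?y\<bar>) \<le> K * (exp \<bar>Re X\<bar> * exp (- 1 * \<bar>x\<bar>))"
        using K(1) by (intro mult_left_mono) (auto simp flip: exp_add)
      finally show ?thesis by simp
    qed
    then show ?thesis by blast
  qed
  then obtain M where M: "\<And>x. norm (h x) \<le> M * exp (- 1 * \<bar>x\<bar>)" by blast
  have M0: "M \<ge> 0" using order.trans[OF norm_ge_zero M[of 0]] by simp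
  have "(\<integral>t. (\<integral>x. h x * exp (\<i> * of_real (t * x)) \<partial>lborel) \<partial>lborel) = of_real (2 * pi) * h 0"
  proof (rule fourier_inversion_at_0[OF cont])
    show "norm (h x) \<le> M" for x
      by (rule order.trans[OF M]) (use M0 in \<open>simp add: mult_left_le\<close>)
    show "integrable lborel h"
    proof (rule Bochner_Integration.integrable_bound)
      show "integrable lborel (\<lambda>x::real. M * exp (- 1 * \<bar>x\<bar>))" by (intro integrable_mult_right integrable_exp_abs) simp
      show "h \<in> borel_measurable lborel" unfolding measurable_lborel2 by (rule borel_measurable_continuous_onI[OF cont])
      show "AE x in lborel. norm (h x) \<le> norm (M * exp (- 1 * \<bar>x\<bar>))"
        by (rule AE_I2) (rule order.trans[OF M], simp)
    qed
    show "integrable lborel (\<lambda>t. \<integral>x. h x * exp (\<i> * of_real (t * x)) \<partial>lborel)"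
      unfolding F using Xi_exp_integrable[of "- \<i> * X"] X by simp
  qed
  then show ?thesis unfolding F by (simp add: h_def mult_ac)
qed

text \<open>The functional equation: \<open>x \<mapsto> - x\<close> is the inversion
  \<open>\<tau> \<mapsto> - 1 / \<tau>\<close>, which contributes \<open>\<i> ^ k\<close>.\<close>

lemma Xi_reflect: "Xi (- t) = \<i> ^ k * Xi t"
proof -
  define s where "s = of_nat k / 2 + \<i> * complex_of_real t"
  have "Xi (- t) = (\<integral>x. f (\<i> * exp (of_real x)) * exp ((of_nat k - s) * of_real x) \<partial>lborel)"
    by (simp add: Xi_def Lam_def s_def)
  also have "\<dots> = (\<integral>x. f (\<i> * exp (of_real (0 + - 1 * x))) * exp ((of_nat k - s) * of_real (0 + - 1 * x)) \<partial>lborel)"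
    by (subst lborel_integral_real_affine[of "-1" _ 0]) auto
  also have "(\<lambda>x. f (\<i> * exp (of_real (0 + - 1 * x))) * exp ((of_nat k - s) * of_real (0 + - 1 * x))) = (\<lambda>x. \<i> ^ k * (f (\<i> * exp (of_real x)) * exp (s * of_real x)))"
  proof
    fix x :: real
    have I: "Im (\<i> * exp (of_real x)) > 0" by (simp add: Re_exp)
    have "- 1 / (\<i> * exp (of_real x)) = \<i> * exp (of_real (0 + - 1 * x))" by (simp add: exp_minus field_simps)
    then have "f (\<i> * exp (of_real (0 + - 1 * x))) = (\<i> * exp (of_real x)) ^ k * f (\<i> * exp (of_real x))" using f_inversion[OF I] by simp
    moreover have "(\<i> * exp (of_real x)) ^ k = \<i> ^ k * exp (of_nat k * of_real x)" by (simp add: power_mult_distrib exp_of_nat_mult)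
    ultimately have "f (\<i> * exp (of_real (0 + - 1 * x))) * exp ((of_nat k - s) * of_real (0 + - 1 * x)) =
       \<i> ^ k * (f (\<i> * exp (of_real x)) * (exp (of_nat k * of_real x) * exp ((of_nat k - s) * of_real (0 + - 1 * x))))"
      by (simp only: mult_ac)
    also have "exp (of_nat k * of_real x) * exp ((of_nat k - s) * of_real (0 + - 1 * x)) = exp (s * of_real x)"
      by (simp add: algebra_simps flip: exp_add)
    finally show "f (\<i> * exp (of_real (0 + - 1 * x))) * exp ((of_nat k - s) * of_real (0 + - 1 * x)) = \<i> ^ k * (f (\<i> * exp (of_real x)) * exp (s * of_real x))" .
  qed
  also have "(\<integral>x. \<i> ^ k * (f (\<i> * exp (of_real x)) * exp (s * of_real x)) \<partial>lborel) = \<i> ^ k * Xi t"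
    unfolding integral_mult_right_zero by (simp add: Xi_def Lam_def s_def)
  finally show ?thesis .
qed

text \<open>Real coefficients make f real on the imaginary axis, so conjugation only reverses
  t.\<close>

lemma cnj_Xi: "cnj (Xi t) = Xi (- t)"
proof -
  have real: "cnj (f (\<i> * exp (of_real x))) = f (\<i> * exp (of_real x))" for x
  proof -
    have I: "Im (\<i> * exp (of_real x)) > 0" by (simp add: Re_exp)
    have "(\<lambda>n. cnj (of_real (a (Suc n)) * exp (2 * of_real pi * \<i> * of_nat (Suc n) * (\<i> * exp (of_real x))))) sums cnj (f (\<i> * exp (of_real x)))"
      using f_sums[OF I] by (rule sums_cnj[THEN iffD2])
    also have "(\<lambda>n. cnj (of_real (a (Suc n)) * exp (2 * of_real pi * \<i> * of_nat (Suc n) * (\<i> * exp (of_real x))))) = (\<lambda>n. of_real (a (Suc n)) * exp (2 * of_real pi * \<i> * of_nat (Suc n) * (\<i> * exp (of_real x))))"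
      by (simp add: exp_cnj del: of_nat_Suc)
    finally show ?thesis using f_sums[OF I] sums_unique2 by blast
  qed
  have "cnj (Xi t) = (\<integral>x. cnj (f (\<i> * exp (of_real x)) * exp ((of_nat k / 2 + \<i> * complex_of_real t) * of_real x)) \<partial>lborel)"
    unfolding Xi_def Lam_def by (rule Bochner_Integration.integral_cnj[symmetric])
  also have "\<dots> = Xi (- t)"
    unfolding Xi_def Lam_def by (simp add: real exp_cnj)
  finally show ?thesis .
qed

end

section \<open>Growth of Kummer's function on the critical line\<close>

locale circle_kernel =
  fixes k :: nat and w R :: real
  assumes k: "k > 0" and w: "w \<ge> 0" and R: "R > 0" and wR: "w / R \<le> 1/4"
begin

text \<open>\<open>cpt\<close> runs over the circle, \<open>bet\<close> is the base of the power and
  \<open>ker\<close> the remaining weight in the circle integral. The condition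
  \<open>w / R \<le> 1/4\<close> keeps \<open>bet\<close> near 1, where its principal logarithm has
  norm at most \<open>2 * (w / R)\<close>.\<close>

definition cpt :: "real \<Rightarrow> complex" where "cpt x = of_real R * cis x"

definition bet :: "real \<Rightarrow> complex" where "bet x = 1 - of_real w / cpt x"

definition ker :: "real \<Rightarrow> complex" where "ker x = exp (cpt x) / cpt x ^ (k - 1)"

lemma norm_cpt [simp]: "norm (cpt x) = R" using R by (simp add: cpt_def norm_mult)

lemma cpt_nonzero [simp]: "cpt x \<noteq> 0" using R by (simp add: cpt_def)

lemma cpt_measurable [measurable]: "cpt \<in> borel_measurable borel"
  unfolding cpt_def by (intro borel_measurable_continuous_onI continuous_intros)

lemma bet_measurable [measurable]: "bet \<in> borel_measurable borel" unfolding bet_def by measurable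

lemma ker_measurable [measurable]: "ker \<in> borel_measurable borel" unfolding ker_def by measurable

lemma norm_one_minus_bet: "norm (1 - bet x) = w / R"
  using w by (simp add: bet_def norm_divide)

lemma bet_nonzero: "bet x \<noteq> 0"
  using norm_one_minus_bet[of x] wR by auto

lemma norm_Ln_bet: "norm (Ln (bet x)) \<le> 2 * (w / R)"
proof -
  have "norm (Ln (1 + (bet x - 1))) \<le> 2 * norm (bet x - 1)"
    using norm_one_minus_bet[of x] wR by (intro norm_Ln_le) (simp add: norm_minus_commute)
  then show ?thesis using norm_one_minus_bet[of x] by (simp add: norm_minus_commute)
qed

lemma norm_ker: "norm (ker x) \<le> exp R / R ^ (k - 1)"
proof -
  have "norm (exp (cpt x)) \<le> exp R" using norm_exp[of "cpt x"] by simp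
  then show ?thesis using R by (auto simp: ker_def norm_divide norm_power intro!: divide_right_mono)
qed

text \<open>The rate in t is \<open>2 * (w / R)\<close>: a larger circle slows the growth in t at
  the price \<open>exp R\<close> in the weight. The trade-off is used twice, with a fixed large R
  for the decay of \<open>H1\<close> and with R of size \<open>1/\<delta>\<close> for its
  transform.\<close>

lemma norm_bet_powr: "norm (bet x powr (- (of_nat k / 2 + \<i> * of_real t))) \<le> exp (real k * (w / R)) * exp (2 * (w / R) * \<bar>t\<bar>)"
proof -
  let ?a = "of_nat k / 2 + \<i> * complex_of_real t"
  have "norm (bet x powr (- ?a)) = norm (exp (- ?a * Ln (bet x)))" by (simp add: powr_def bet_nonzero)
  also have "\<dots> \<le> exp (norm (- ?a * Ln (bet x)))" by (rule norm_exp)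
  also have "\<dots> \<le> exp ((real k / 2 + \<bar>t\<bar>) * (2 * (w / R)))"
  proof -
    have "norm ?a \<le> norm (of_nat k / 2 :: complex) + norm (\<i> * complex_of_real t)" by (rule norm_triangle_ineq)
    then have "norm ?a \<le> real k / 2 + \<bar>t\<bar>" by (simp add: norm_mult norm_divide)
    then have "norm ?a * norm (Ln (bet x)) \<le> (real k / 2 + \<bar>t\<bar>) * (2 * (w / R))"
      using norm_Ln_bet by (intro mult_mono) auto
    then show ?thesis by (simp only: exp_le_cancel_iff norm_mult norm_minus_cancel)
  qed
  also have "\<dots> = exp (real k * (w / R)) * exp (2 * (w / R) * \<bar>t\<bar>)" by (simp add: algebra_simps flip: exp_add)
  finally show ?thesis .
qed

lemma kummer_eq: "kummer_1F1 a (of_nat k) (of_real w) = fact (k - 1) * (\<integral>x. ker x * bet x powr (- a) \<partial>circ)"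
proof -
  have "norm (complex_of_real w) < R" using w R wR by (simp add: field_simps)
  from kummer_1F1_circle(2)[OF k this, of a] show ?thesis unfolding ker_def bet_def cpt_def .
qed

lemma norm_integrand: "norm (ker x * bet x powr (- (of_nat k / 2 + \<i> * of_real t))) \<le> exp R / R ^ (k - 1) * exp (real k * (w / R)) * exp (2 * (w / R) * \<bar>t\<bar>)"
proof -
  have "norm (ker x) * norm (bet x powr (- (of_nat k / 2 + \<i> * of_real t))) \<le> exp R / R ^ (k - 1) * (exp (real k * (w / R)) * exp (2 * (w / R) * \<bar>t\<bar>))"
    using R by (intro mult_mono norm_ker norm_bet_powr) auto
  then show ?thesis by (simp only: norm_mult mult.assoc)
qed

lemma kummer_bound: "norm (kummer_1F1 (of_nat k / 2 + \<i> * of_real t) (of_nat k) (of_real w)) \<le> (fact (k - 1) * (exp R / R ^ (k - 1) * exp (real k * (w / R)))) * exp (2 * (w / R) * \<bar>t\<bar>)"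
proof -
  have "norm (\<integral>x. ker x * bet x powr (- (of_nat k / 2 + \<i> * of_real t)) \<partial>circ) \<le> exp R / R ^ (k - 1) * exp (real k * (w / R)) * exp (2 * (w / R) * \<bar>t\<bar>)"
    by (rule norm_integral_circ_le[OF _ norm_integrand]) measurable
  then have "fact (k - 1) * norm (\<integral>x. ker x * bet x powr (- (of_nat k / 2 + \<i> * of_real t)) \<partial>circ) \<le> fact (k - 1) * (exp R / R ^ (k - 1) * exp (real k * (w / R)) * exp (2 * (w / R) * \<bar>t\<bar>))"
    by (rule mult_left_mono) simp
  then show ?thesis by (simp only: kummer_eq norm_mult norm_fact mult.assoc)
qed

lemma kummer_continuous: "continuous_on UNIV (\<lambda>t. kummer_1F1 (of_nat k / 2 + \<i> * of_real t) (of_nat k) (of_real w))"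
proof -
  have "isCont (\<lambda>t. kummer_1F1 (of_nat k / 2 + \<i> * of_real t) (of_nat k) (of_real w)) t" for t
  proof -
    let ?S = "{- (\<bar>t\<bar> + 1)<..<\<bar>t\<bar> + 1}"
    have "continuous_on ?S (\<lambda>t. \<integral>x. ker x * bet x powr (- (of_nat k / 2 + \<i> * of_real t)) \<partial>circ)"
    proof (rule continuous_on_integral_dominated)
      show "(\<lambda>x. ker x * bet x powr (- (of_nat k / 2 + \<i> * of_real t))) \<in> borel_measurable circ" for t by measurable
      show "integrable circ (\<lambda>_. exp R / R ^ (k - 1) * exp (real k * (w / R)) * exp (2 * (w / R) * (\<bar>t\<bar> + 1)))" by simp
      fix u x :: real assume "u \<in> ?S"
      then have u: "\<bar>u\<bar> \<le> \<bar>t\<bar> + 1" by auto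
      have "exp (2 * (w / R) * \<bar>u\<bar>) \<le> exp (2 * (w / R) * (\<bar>t\<bar> + 1))"
        unfolding exp_le_cancel_iff using u w R by (intro mult_left_mono) auto
      then show "norm (ker x * bet x powr (- (of_nat k / 2 + \<i> * of_real u))) \<le> exp R / R ^ (k - 1) * exp (real k * (w / R)) * exp (2 * (w / R) * (\<bar>t\<bar> + 1))"
        using R by (intro order.trans[OF norm_integrand] mult_left_mono) auto
    next
      show "continuous_on ?S (\<lambda>u. ker x * bet x powr (- (of_nat k / 2 + \<i> * of_real u)))" for x
        unfolding powr_def using bet_nonzero[of x] by (auto intro!: continuous_intros)
    qed
    then have "continuous_on ?S (\<lambda>t. kummer_1F1 (of_nat k / 2 + \<i> * of_real t) (of_nat k) (of_real w))"
      unfolding kummer_eq by (intro continuous_intros)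
    then show ?thesis by (rule continuous_on_interior) (auto simp: interior_open)
  qed
  then show ?thesis by (simp add: continuous_on_eq_continuous_at)
qed

end

text \<open>A large radius makes the rate as small as desired, so Kummer's factor takes nothing away
  from the range of decay rates below \<open>pi/2\<close> inherited from \<open>Xi\<close>.\<close>

lemma kummer_continuous_growth:
  assumes k: "k > 0" and w: "w \<ge> 0"
  shows "continuous_on UNIV (\<lambda>t. kummer_1F1 (of_nat k / 2 + \<i> * of_real t) (of_nat k) (of_real w))"
    and "e > 0 \<Longrightarrow> \<exists>C\<ge>0. \<forall>t. norm (kummer_1F1 (of_nat k / 2 + \<i> * of_real t) (of_nat k) (of_real w)) \<le> C * exp (e * \<bar>t\<bar>)"
proof -
  interpret circle_kernel k w "4 * w + 1"
    using assms by unfold_locales (auto simp: divide_simps)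
  show "continuous_on UNIV (\<lambda>t. kummer_1F1 (of_nat k / 2 + \<i> * of_real t) (of_nat k) (of_real w))"
    by (rule kummer_continuous)
next
  assume e: "e > 0"
  define R where "R = max (4 * w + 1) (2 * w / e)"
  have Rb: "R > 0" "R \<ge> 4 * w" "R \<ge> 2 * w / e" using w by (auto simp: R_def)
  interpret circle_kernel k w R
    using assms Rb by unfold_locales (auto simp: divide_simps)
  have "2 * (w / R) \<le> e" using Rb(1,3) e by (simp add: field_simps)
  then have "exp (2 * (w / R) * \<bar>t\<bar>) \<le> exp (e * \<bar>t\<bar>)" for t
    using mult_right_mono[OF _ abs_ge_zero[of t]] by (simp only: exp_le_cancel_iff)
  then show "\<exists>C\<ge>0. \<forall>t. norm (kummer_1F1 (of_nat k / 2 + \<i> * of_real t) (of_nat k) (of_real w)) \<le> C * exp (e * \<bar>t\<bar>)"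
    using Rb(1) by (intro exI[of _ "fact (k - 1) * (exp R / R ^ (k - 1) * exp (real k * (w / R)))"] conjI allI order.trans[OF kummer_bound] mult_left_mono) auto
qed

section \<open>The transform of the critical-line function with Kummer's factor\<close>

context cusp
begin

text \<open>Only one of the two Kummer terms; in even weight the other one is, up to the sign
  \<open>\<epsilon>\<close>, the complex conjugate of this.\<close>

definition H1 :: "real \<Rightarrow> real \<Rightarrow> complex" where
  "H1 w t = Xi t * kummer_1F1 (of_nat k / 2 + \<i> * of_real t) (of_nat k) (of_real w)"

lemma H1_continuous: "k > 0 \<Longrightarrow> w \<ge> 0 \<Longrightarrow> continuous_on UNIV (H1 w)"
  unfolding H1_def by (intro continuous_intros Xi_continuous kummer_continuous_growth(1))

lemma H1_decay:
  assumes "k > 0" "w \<ge> 0" "0 < \<eta>" "\<eta> < pi/2"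
  shows "\<exists>C\<ge>0. \<forall>t. norm (H1 w t) \<le> C * exp (- \<eta> * \<bar>t\<bar>)"
proof -
  define \<eta>' where "\<eta>' = (\<eta> + pi/2) / 2"
  have \<eta>': "0 \<le> \<eta>'" "\<eta>' < pi/2" "\<eta>' - \<eta> > 0" using assms by (auto simp: \<eta>'_def)
  obtain C where C: "C \<ge> 0" "\<And>t. norm (Xi t) \<le> C * exp (- \<eta>' * \<bar>t\<bar>)" using Xi_decay[OF \<eta>'(1,2)] by blast
  obtain D where D: "D \<ge> 0" "\<And>t. norm (kummer_1F1 (of_nat k / 2 + \<i> * of_real t) (of_nat k) (of_real w)) \<le> D * exp ((\<eta>' - \<eta>) * \<bar>t\<bar>)"
    using kummer_continuous_growth(2)[OF assms(1,2) \<eta>'(3)] by blast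
  have "norm (H1 w t) \<le> (C * D) * exp (- \<eta> * \<bar>t\<bar>)" for t
  proof -
    have "norm (H1 w t) \<le> (C * exp (- \<eta>' * \<bar>t\<bar>)) * (D * exp ((\<eta>' - \<eta>) * \<bar>t\<bar>))"
      unfolding H1_def norm_mult using C D by (intro mult_mono) auto
    also have "\<dots> = (C * D) * (exp (- \<eta>' * \<bar>t\<bar>) * exp ((\<eta>' - \<eta>) * \<bar>t\<bar>))" by simp
    also have "exp (- \<eta>' * \<bar>t\<bar>) * exp ((\<eta>' - \<eta>) * \<bar>t\<bar>) = exp (- \<eta> * \<bar>t\<bar>)" by (simp add: algebra_simps flip: exp_add)
    finally show ?thesis .
  qed
  then show ?thesis using C D by (intro exI[of _ "C * D"]) auto
qed

text \<open>The circle integral for Kummer's function turns the transform into an average of \<open>f\<close> over a small circle.\<close>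

lemma H1_transform:
  assumes "circle_kernel k w R" and \<zeta>: "\<bar>Re \<zeta>\<bar> + 2 * (w / R) < pi/2"
  shows "(\<integral>t. H1 w t * exp (\<zeta> * of_real t) \<partial>lborel) = fact (k - 1) * (of_real (2 * pi) * exp (of_nat k / 2 * (\<i> * \<zeta>))) *
     (\<integral>x. circle_kernel.ker k R x * f (\<i> * exp (\<i> * \<zeta>) * circle_kernel.bet w R x) \<partial>circ)"
proof -
  interpret circle_kernel k w R by fact
  have wR0: "w / R \<ge> 0" using w R by simp
  obtain \<eta> where \<eta>: "\<bar>Re \<zeta>\<bar> + 2 * (w / R) < \<eta>" "\<eta> < pi/2" using dense[OF \<zeta>] by blast
  have "0 \<le> \<eta>" using \<eta>(1) wR0 by linarith
  from Xi_decay[OF this \<eta>(2)] obtain C where C: "C \<ge> 0" "\<And>t. norm (Xi t) \<le> C * exp (- \<eta> * \<bar>t\<bar>)" by blast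
  have [measurable]: "Xi \<in> borel_measurable borel" using Xi_continuous by (rule borel_measurable_continuous_onI)
  define K where "K = (\<lambda>t x. Xi t * exp (\<zeta> * of_real t) * (ker x * bet x powr (- (of_nat k / 2 + \<i> * of_real t))))"
  define D where "D = exp R / R ^ (k - 1) * exp (real k * (w / R))"
  have D: "D \<ge> 0" using R by (simp add: D_def)
  have Kb: "norm (K t x) \<le> (C * D) * exp (- (\<eta> - \<bar>Re \<zeta>\<bar> - 2 * (w / R)) * \<bar>t\<bar>) * 1" for t x
  proof -
    have "Re \<zeta> * t \<le> \<bar>Re \<zeta>\<bar> * \<bar>t\<bar>" by (metis abs_ge_self abs_mult)
    then have e: "norm (exp (\<zeta> * of_real t)) \<le> exp (\<bar>Re \<zeta>\<bar> * \<bar>t\<bar>)" by simp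
    have "norm (K t x) = norm (Xi t) * norm (exp (\<zeta> * of_real t)) * norm (ker x * bet x powr (- (of_nat k / 2 + \<i> * of_real t)))"
      by (simp only: K_def norm_mult)
    also have "\<dots> \<le> (C * exp (- \<eta> * \<bar>t\<bar>)) * exp (\<bar>Re \<zeta>\<bar> * \<bar>t\<bar>) * (D * exp (2 * (w / R) * \<bar>t\<bar>))"
      unfolding D_def using C R by (intro mult_mono e C norm_integrand) auto
    also have "\<dots> = (C * D) * (exp (- \<eta> * \<bar>t\<bar>) * exp (\<bar>Re \<zeta>\<bar> * \<bar>t\<bar>) * exp (2 * (w / R) * \<bar>t\<bar>))" by simp
    also have "exp (- \<eta> * \<bar>t\<bar>) * exp (\<bar>Re \<zeta>\<bar> * \<bar>t\<bar>) * exp (2 * (w / R) * \<bar>t\<bar>) = exp (- (\<eta> - \<bar>Re \<zeta>\<bar> - 2 * (w / R)) * \<bar>t\<bar>)"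
      by (simp add: algebra_simps flip: exp_add)
    finally show ?thesis by simp
  qed
  have "(\<integral>t. H1 w t * exp (\<zeta> * of_real t) \<partial>lborel) = (\<integral>t. fact (k - 1) * (\<integral>x. K t x \<partial>circ) \<partial>lborel)"
  proof (intro Bochner_Integration.integral_cong refl)
    fix t
    have "(\<integral>x. K t x \<partial>circ) = Xi t * exp (\<zeta> * of_real t) * (\<integral>x. ker x * bet x powr (- (of_nat k / 2 + \<i> * of_real t)) \<partial>circ)"
      unfolding K_def by (rule integral_mult_right_zero)
    then show "H1 w t * exp (\<zeta> * of_real t) = fact (k - 1) * (\<integral>x. K t x \<partial>circ)"
      by (simp only: H1_def kummer_eq mult_ac)
  qed
  also have "\<dots> = fact (k - 1) * (\<integral>t. (\<integral>x. K t x \<partial>circ) \<partial>lborel)" by (rule integral_mult_right_zero)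
  also have "(\<integral>t. (\<integral>x. K t x \<partial>circ) \<partial>lborel) = (\<integral>x. (\<integral>t. K t x \<partial>lborel) \<partial>circ)"
  proof (rule integral_product_swap_bounded[OF _ _ _ _ _ _ _ Kb])
    show "(\<lambda>(x, y). K x y) \<in> borel_measurable (borel \<Otimes>\<^sub>M borel)" unfolding K_def by measurable
    show "integrable lborel (\<lambda>t. C * D * exp (- (\<eta> - \<bar>Re \<zeta>\<bar> - 2 * (w / R)) * \<bar>t\<bar>))"
      using \<eta>(1) by (intro integrable_mult_right integrable_exp_abs) linarith
    show "integrable circ (\<lambda>_. 1::real)" by simp
  qed (auto intro: lborel.sigma_finite_measure_axioms circ.sigma_finite_measure_axioms)
  also have "(\<lambda>x. \<integral>t. K t x \<partial>lborel) = (\<lambda>x. of_real (2 * pi) * exp (of_nat k / 2 * (\<i> * \<zeta>)) * (ker x * f (\<i> * exp (\<i> * \<zeta>) * bet x)))"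
  proof
    fix x
    \<comment> \<open>The exponential in \<open>\<zeta> * t\<close> and the power of
      \<open>bet x\<close> merge into \<open>exp (- \<i> * X * t)\<close>, up to a factor free of t,
      so the inner integral is an instance of \<open>Xi_inversion\<close>. The hypothesis on
      \<open>\<zeta>\<close> keeps X inside the strip.\<close>
    define X where "X = \<i> * \<zeta> + Ln (bet x)"
    have expX: "exp X = exp (\<i> * \<zeta>) * bet x" by (simp add: X_def exp_add bet_nonzero)
    have ImX: "\<bar>Im X\<bar> < pi/2"
    proof -
      have "\<bar>Im (Ln (bet x))\<bar> \<le> 2 * (w / R)" by (rule order.trans[OF abs_Im_le_cmod norm_Ln_bet])
      moreover have "Im X = Re \<zeta> + Im (Ln (bet x))" by (simp add: X_def)
      ultimately show ?thesis using \<zeta> abs_triangle_ineq[of "Re \<zeta>" "Im (Ln (bet x))"] by linarith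
    qed
    have "K t x = (ker x * exp (- (of_nat k / 2) * Ln (bet x))) * (Xi t * exp (- \<i> * X * of_real t))" for t
    proof -
      have "exp (\<zeta> * of_real t) * bet x powr (- (of_nat k / 2 + \<i> * of_real t)) = exp (- (of_nat k / 2) * Ln (bet x)) * exp (- \<i> * X * of_real t)"
        by (simp add: powr_def bet_nonzero X_def algebra_simps flip: exp_add)
      moreover have "K t x = (ker x * Xi t) * (exp (\<zeta> * of_real t) * bet x powr (- (of_nat k / 2 + \<i> * of_real t)))"
        by (simp only: K_def mult_ac)
      ultimately show ?thesis by (simp only: mult_ac)
    qed
    then have "(\<integral>t. K t x \<partial>lborel) = (ker x * exp (- (of_nat k / 2) * Ln (bet x))) * (of_real (2 * pi) * (exp (of_nat k / 2 * X) * f (\<i> * exp X)))"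
      by (simp only: integral_mult_right_zero Xi_inversion[OF ImX])
    also have "exp (of_nat k / 2 * X) = exp (of_nat k / 2 * (\<i> * \<zeta>)) * exp (of_nat k / 2 * Ln (bet x))"
      by (simp add: X_def ring_distribs exp_add)
    also have "(ker x * exp (- (of_nat k / 2) * Ln (bet x))) * (of_real (2 * pi) * (exp (of_nat k / 2 * (\<i> * \<zeta>)) * exp (of_nat k / 2 * Ln (bet x)) * f (\<i> * exp X)))
      = (exp (- (of_nat k / 2) * Ln (bet x)) * exp (of_nat k / 2 * Ln (bet x))) * (of_real (2 * pi) * exp (of_nat k / 2 * (\<i> * \<zeta>)) * (ker x * f (\<i> * exp X)))"
      by (simp only: mult_ac)
    also have "exp (- (of_nat k / 2) * Ln (bet x)) * exp (of_nat k / 2 * Ln (bet x)) = 1" by (simp flip: exp_add)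
    finally show "(\<integral>t. K t x \<partial>lborel) = of_real (2 * pi) * exp (of_nat k / 2 * (\<i> * \<zeta>)) * (ker x * f (\<i> * exp (\<i> * \<zeta>) * bet x))"
      by (simp add: expX mult.assoc)
  qed
  also have "(\<integral>x. of_real (2 * pi) * exp (of_nat k / 2 * (\<i> * \<zeta>)) * (ker x * f (\<i> * exp (\<i> * \<zeta>) * bet x)) \<partial>circ) = 
    of_real (2 * pi) * exp (of_nat k / 2 * (\<i> * \<zeta>)) * (\<integral>x. ker x * f (\<i> * exp (\<i> * \<zeta>) * bet x) \<partial>circ)"
    by (rule integral_mult_right_zero)
  finally show ?thesis by (simp only: mult.assoc)
qed

text \<open>With \<open>R = \<pi>/(9\<delta>)\<close> the points \<open>\<tau> = \<i> e\<^bsup>\<i>\<zeta>\<^esup> (1 - w/v) + 1\<close>, \<open>|v| = R\<close>, stay within \<open>\<delta>/2\<close> of \<open>\<i>\<delta>\<close>, hence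
  \<open>Im (-1/\<tau>) \<ge> 2/(9\<delta>)\<close>, and the decay \<open>e\<^bsup>-4\<pi>/(9\<delta>)\<^esup>\<close> of \<open>f\<close> beats the growth \<open>e\<^sup>R\<close> of the kernel.\<close>

lemma H1_transform_small:
  assumes k: "k > 0" and w: "w \<ge> 0" "w \<le> pi/36"
  obtains C where "C \<ge> 0"
    "\<And>\<delta> \<zeta>. 0 < \<delta> \<Longrightarrow> \<delta> < 1/20 \<Longrightarrow> norm (\<zeta> - of_real (pi/2 - \<delta>)) \<le> \<delta>/8 \<Longrightarrow>
       norm (\<integral>t. H1 w t * exp (\<zeta> * of_real t) \<partial>lborel) \<le> C * exp (- 1/\<delta>)"
proof -
  obtain C where C: "C \<ge> 0" "\<And>\<tau>. Im \<tau> \<ge> 1 \<Longrightarrow> norm (f \<tau>) \<le> C * exp (- 2 * pi * Im \<tau>)"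
    using f_exp_decay[of 1] by auto
  \<comment> \<open>The decay \<open>4 * pi / 9\<close> minus the \<open>pi / 9\<close> of
    \<open>exp R\<close> leaves \<open>pi / 3\<close>; its excess over 1 absorbs the power
    \<open>(2/\<delta>) ^ k\<close> coming from the automorphy factor.\<close>
  obtain K where K: "K > 0" "\<And>y. y \<ge> 0 \<Longrightarrow> y ^ k \<le> K * exp ((pi/3 - 1) * y)"
    using power_exp_le[of "pi/3 - 1" k] pi_gt3 by auto
  define E where "E = fact (k - 1) * (2 * pi * exp (real k)) * (2 ^ k * K * C)"
  have E: "E \<ge> 0" using C K by (simp add: E_def)
  show thesis
  proof (rule that[OF E])
    fix \<delta> :: real and \<zeta> :: complex
    assume \<delta>: "0 < \<delta>" "\<delta> < 1/20" and \<zeta>: "norm (\<zeta> - of_real (pi/2 - \<delta>)) \<le> \<delta>/8"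
    define R where "R = pi / (9 * \<delta>)"
    have Rb: "R > 0" "R \<ge> 1" using \<delta> pi_gt3 by (auto simp: R_def field_simps)
    \<comment> \<open>The bound \<open>pi/36\<close> and the radius are tuned to each other:
      \<open>(pi / 36) / R\<close> is exactly \<open>\<delta> / 4\<close>.\<close>
    have wRd: "w / R \<le> \<delta> / 4"
    proof -
      have "w / R \<le> (pi / 36) / R" using w Rb by (intro divide_right_mono) auto
      also have "\<dots> = \<delta> / 4" by (simp add: R_def)
      finally show ?thesis .
    qed
    have ck: "circle_kernel k w R" using k w(1) Rb(1) wRd \<delta> by unfold_locales linarith+
    interpret circle_kernel k w R by (rule ck)
    have Re\<zeta>: "\<bar>Re \<zeta> - (pi/2 - \<delta>)\<bar> \<le> \<delta>/8" using abs_Re_le_cmod[of "\<zeta> - of_real (pi/2 - \<delta>)"] \<zeta> by simp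
    have \<zeta>1: "\<bar>Re \<zeta>\<bar> + 2 * (w / R) < pi/2" using Re\<zeta> wRd \<delta> pi_gt3 by linarith
    have norm\<zeta>: "norm \<zeta> \<le> 2"
    proof -
      have "norm \<zeta> \<le> norm (\<zeta> - of_real (pi/2 - \<delta>)) + norm (complex_of_real (pi/2 - \<delta>))" using norm_triangle_sub[of \<zeta> "of_real (pi/2 - \<delta>)"] by linarith
      also have "norm (complex_of_real (pi/2 - \<delta>)) = pi/2 - \<delta>"
      proof -
        have "0 \<le> pi/2 - \<delta>" using \<delta> pi_gt3 by linarith
        then show ?thesis by (simp only: norm_of_real abs_of_nonneg)
      qed
      finally show ?thesis using \<zeta> \<delta> pi_less_4 by linarith
    qed
    define d where "d = of_real (pi/2) - \<zeta>"
    have d: "norm (d - of_real \<delta>) \<le> \<delta>/8"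
    proof -
      have "d - of_real \<delta> = - (\<zeta> - of_real (pi/2 - \<delta>))" by (simp add: d_def)
      then show ?thesis using \<zeta> by (metis norm_minus_cancel)
    qed
    have nd: "norm d \<le> 9/8 * \<delta>"
      using norm_triangle_sub[of d "of_real \<delta>"] d \<delta> by simp
    have e1: "exp (norm d) \<le> 11/10"
    proof -
      have "exp (- norm d) \<ge> 1 - norm d" using exp_ge_add_one_self[of "- norm d"] by simp
      then have "exp (- norm d) \<ge> 10/11" using nd \<delta> by linarith
      then have "inverse (exp (- norm d)) \<le> inverse (10/11)" by (intro le_imp_inverse_le) auto
      then show ?thesis by (simp add: exp_minus)
    qed
    have exp\<zeta>: "exp (\<i> * \<zeta>) = \<i> * exp (- \<i> * d)"
    proof -
      have "\<i> * \<zeta> = \<i> * of_real (pi/2) + (- \<i> * d)" by (simp add: d_def algebra_simps)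
      then have "exp (\<i> * \<zeta>) = exp (\<i> * of_real (pi/2)) * exp (- \<i> * d)" by (simp only: exp_add)
      also have "exp (\<i> * of_real (pi/2)) = \<i>" by (simp only: cis_conv_exp[symmetric] cis_pi_half)
      finally show ?thesis .
    qed
    have taylor: "norm (exp (- \<i> * d) - (1 - \<i> * d)) \<le> 11/10 * (norm d)\<^sup>2"
    proof -
      have "norm (exp (- \<i> * d) - (\<Sum>i\<le>1. (- \<i> * d) ^ i / fact i)) \<le> exp \<bar>Re (- \<i> * d)\<bar> * norm (- \<i> * d) ^ Suc 1 / fact 1"
        by (rule Taylor_exp)
      also have "(\<Sum>i\<le>1. (- \<i> * d) ^ i / fact i) = 1 - \<i> * d" by simp
      also have "exp \<bar>Re (- \<i> * d)\<bar> * norm (- \<i> * d) ^ Suc 1 / fact 1 = exp \<bar>Im d\<bar> * (norm d)\<^sup>2"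
        by (simp add: norm_mult power2_eq_square)
      also have "\<dots> \<le> 11/10 * (norm d)\<^sup>2"
      proof (rule mult_right_mono)
        have "exp \<bar>Im d\<bar> \<le> exp (norm d)" using abs_Im_le_cmod[of d] by simp
        then show "exp \<bar>Im d\<bar> \<le> 11/10" using e1 by linarith
      qed simp
      finally show ?thesis .
    qed
    have nd2: "(norm d)\<^sup>2 \<le> (81/64) * (\<delta> * (1/20))"
    proof -
      have "(norm d)\<^sup>2 \<le> (9/8 * \<delta>)\<^sup>2" using nd by (intro power_mono) auto
      also have "\<dots> = 81/64 * (\<delta> * \<delta>)" by (simp add: power2_eq_square)
      also have "\<delta> * \<delta> \<le> \<delta> * (1/20)" using \<delta> by (intro mult_left_mono) auto
      finally show ?thesis by simp
    qed
    have fb: "norm (f (\<i> * exp (\<i> * \<zeta>) * bet x)) \<le> (2/\<delta>) ^ k * (C * exp (- (4 * pi / 9) / \<delta>))" for x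
    proof -
      define \<tau> where "\<tau> = \<i> * exp (\<i> * \<zeta>) * bet x + 1"
      \<comment> \<open>Three errors: at most \<open>\<delta>/8\<close> from the position of
        \<open>\<zeta>\<close>, below \<open>0.07 * \<delta>\<close> from the Taylor remainder, and
        \<open>0.275 * \<delta>\<close> from the circle; together they stay below
        \<open>\<delta>/2\<close>.\<close>
      have \<tau>_eq: "\<tau> - \<i> * of_real \<delta> = (\<i> * (d - of_real \<delta>) - (exp (- \<i> * d) - (1 - \<i> * d))) + exp (- \<i> * d) * (1 - bet x)"
        unfolding \<tau>_def exp\<zeta> by (simp add: algebra_simps)
      have "norm (\<tau> - \<i> * of_real \<delta>) \<le> \<delta>/2"
      proof -
        have "norm (\<tau> - \<i> * of_real \<delta>) \<le> norm (\<i> * (d - of_real \<delta>)) + norm (exp (- \<i> * d) - (1 - \<i> * d)) + norm (exp (- \<i> * d) * (1 - bet x))"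
          unfolding \<tau>_eq by (rule order.trans[OF norm_triangle_ineq add_right_mono[OF norm_triangle_ineq4]])
        moreover have "norm (\<i> * (d - of_real \<delta>)) \<le> \<delta>/8" using d by (simp add: norm_mult)
        moreover have "norm (exp (- \<i> * d) * (1 - bet x)) \<le> 11/10 * (\<delta>/4)"
        proof -
          have "norm (exp (- \<i> * d)) = exp (Im d)" by simp
          also have "\<dots> \<le> exp (norm d)"
            unfolding exp_le_cancel_iff by (rule order.trans[OF abs_ge_self abs_Im_le_cmod])
          finally have "norm (exp (- \<i> * d)) \<le> 11/10" using e1 by linarith
          then show ?thesis unfolding norm_mult norm_one_minus_bet using wRd w R by (intro mult_mono) auto
        qed
        ultimately show ?thesis using taylor nd2 \<delta> by linarith
      qed
      note close = this
      have "\<bar>Im \<tau> - \<delta>\<bar> \<le> \<delta>/2" using abs_Im_le_cmod[of "\<tau> - \<i> * of_real \<delta>"] close by simp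
      then have Im\<tau>: "Im \<tau> \<ge> \<delta>/2" by linarith
      then have Im0: "Im \<tau> > 0" using \<delta> by linarith
      have n1: "norm \<tau> \<ge> \<delta>/2" using Im\<tau> abs_Im_le_cmod[of \<tau>] by linarith
      have n2: "norm \<tau> \<le> 3/2 * \<delta>"
        using norm_triangle_sub[of \<tau> "\<i> * of_real \<delta>"] close \<delta> by (simp add: norm_mult)
      have \<tau>0: "\<tau> \<noteq> 0" using Im0 by auto
      have inv: "Im (- 1 / \<tau>) = Im \<tau> / (norm \<tau>)\<^sup>2" by (simp add: Im_divide cmod_power2)
      have "(norm \<tau>)\<^sup>2 \<le> (3/2 * \<delta>)\<^sup>2" using n2 by (intro power_mono) auto
      then have "(\<delta>/2) / (3/2 * \<delta>)\<^sup>2 \<le> Im \<tau> / (norm \<tau>)\<^sup>2" using Im\<tau> \<delta> \<tau>0 by (intro frac_le) auto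
      then have Iminv: "Im (- 1 / \<tau>) \<ge> (2/9) / \<delta>" unfolding inv using \<delta> by (simp add: power2_eq_square field_simps)
      moreover have "(2/9) / \<delta> \<ge> 1" using \<delta> by (simp add: field_simps)
      ultimately have "Im (- 1 / \<tau>) \<ge> 1" by linarith
      from C(2)[OF this] have "norm (f (- 1 / \<tau>)) \<le> C * exp (- 2 * pi * Im (- 1 / \<tau>))" .
      also have "\<dots> \<le> C * exp (- (4 * pi / 9) / \<delta>)"
      proof -
        have "2 * pi * ((2/9) / \<delta>) \<le> 2 * pi * Im (- 1 / \<tau>)" using Iminv by (intro mult_left_mono) auto
        then show ?thesis using C(1) by (intro mult_left_mono) auto
      qed
      finally have f1: "norm (f (- 1 / \<tau>)) \<le> C * exp (- (4 * pi / 9) / \<delta>)" .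
      have "norm (f \<tau>) = inverse (norm \<tau>) ^ k * norm (f (- 1 / \<tau>))"
        unfolding f_inversion[OF Im0] using \<tau>0 by (simp add: norm_mult norm_power power_inverse)
      also have "\<dots> \<le> (2/\<delta>) ^ k * (C * exp (- (4 * pi / 9) / \<delta>))"
      proof (intro mult_mono power_mono f1)
        show "inverse (norm \<tau>) \<le> 2/\<delta>" using le_imp_inverse_le[OF n1] \<delta> by simp
      qed (use \<delta> in auto)
      also have "f \<tau> = f (\<i> * exp (\<i> * \<zeta>) * bet x)"
        using f_minus_1[OF Im0] by (simp add: \<tau>_def)
      finally show ?thesis .
    qed
    have kerb: "norm (ker x) \<le> exp R" for x
    proof -
      have "1 \<le> R ^ (k - 1)" using Rb by (intro one_le_power)
      then have "exp R / R ^ (k - 1) \<le> exp R" using R by (simp add: divide_le_eq)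
      then show ?thesis using norm_ker[of x] by linarith
    qed
    let ?F = "\<lambda>x. ker x * f (\<i> * exp (\<i> * \<zeta>) * bet x)"
    have Fb: "norm (?F x) \<le> exp R * ((2/\<delta>) ^ k * (C * exp (- (4 * pi / 9) / \<delta>)))" for x
      unfolding norm_mult by (intro mult_mono kerb fb) auto
    have avg: "norm (\<integral>x. ?F x \<partial>circ) \<le> exp R * ((2/\<delta>) ^ k * (C * exp (- (4 * pi / 9) / \<delta>)))"
    \<comment> \<open>A non-integrable function has integral 0 by convention, and then the bound is
      trivial.\<close>
    proof (cases "integrable circ ?F")
      case True
      have "norm (\<integral>x. ?F x \<partial>circ) \<le> (\<integral>x. norm (?F x) \<partial>circ)" by (rule integral_norm_bound)
      also have "\<dots> \<le> exp R * ((2/\<delta>) ^ k * (C * exp (- (4 * pi / 9) / \<delta>)))"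
        using integrable_norm[OF True] Fb by (intro circ.integral_le_const) auto
      finally show ?thesis .
    next
      case False
      then show ?thesis using C \<delta> by (simp add: not_integrable_integral_eq)
    qed
    have en: "norm (exp (of_nat k / 2 * (\<i> * \<zeta>))) \<le> exp (real k)"
    proof -
      have "norm (exp (of_nat k / 2 * (\<i> * \<zeta>))) \<le> exp (norm (of_nat k / 2 * (\<i> * \<zeta>)))" by (rule norm_exp)
      also have "norm (of_nat k / 2 * (\<i> * \<zeta>)) = real k / 2 * norm \<zeta>" by (simp add: norm_mult norm_divide)
      also have "exp (real k / 2 * norm \<zeta>) \<le> exp (real k / 2 * 2)"
        unfolding exp_le_cancel_iff using norm\<zeta> by (intro mult_left_mono) auto
      finally show ?thesis by simp
    qed
    have "norm (\<integral>t. H1 w t * exp (\<zeta> * of_real t) \<partial>lborel) = fact (k - 1) * (2 * pi * norm (exp (of_nat k / 2 * (\<i> * \<zeta>)))) * norm (\<integral>x. ?F x \<partial>circ)"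
      unfolding H1_transform[OF ck \<zeta>1] by (simp only: norm_mult norm_fact norm_of_real) simp
    also have "\<dots> \<le> fact (k - 1) * (2 * pi * exp (real k)) * (exp R * ((2/\<delta>) ^ k * (C * exp (- (4 * pi / 9) / \<delta>))))"
      using en avg by (intro mult_mono) auto
    also have "\<dots> \<le> fact (k - 1) * (2 * pi * exp (real k)) * (exp R * ((2 ^ k * (K * exp ((pi/3 - 1) * (1/\<delta>)))) * (C * exp (- (4 * pi / 9) / \<delta>))))"
    proof -
      have "(2/\<delta>) ^ k = 2 ^ k * (1/\<delta>) ^ k" by (simp add: power_divide)
      also have "\<dots> \<le> 2 ^ k * (K * exp ((pi/3 - 1) * (1/\<delta>)))" using K(2)[of "1/\<delta>"] \<delta> by (intro mult_left_mono) auto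
      finally show ?thesis using C(1) by (intro mult_left_mono mult_right_mono) auto
    qed
    also have "\<dots> = E * (exp R * exp ((pi/3 - 1) * (1/\<delta>)) * exp (- (4 * pi / 9) / \<delta>))"
      by (simp add: E_def)
    also have "exp R * exp ((pi/3 - 1) * (1/\<delta>)) * exp (- (4 * pi / 9) / \<delta>) = exp (- 1/\<delta>)"
    proof -
      have "R + (pi/3 - 1) * (1/\<delta>) + - (4 * pi / 9) / \<delta> = - 1/\<delta>" using \<delta>(1) by (simp add: R_def field_simps)
      then show ?thesis by (simp only: exp_add[symmetric])
    qed
    finally show "norm (\<integral>t. H1 w t * exp (\<zeta> * of_real t) \<partial>lborel) \<le> E * exp (- 1/\<delta>)" .
  qed
qed

end

lemma integral_shift_exp:
  fixes H :: "real \<Rightarrow> complex"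
  shows "(\<integral>t. H (t + b) * exp (\<zeta> * of_real t) \<partial>lborel) = exp (- \<zeta> * of_real b) * (\<integral>t. H t * exp (\<zeta> * of_real t) \<partial>lborel)"
proof -
  have "(\<integral>t. H (t + b) * exp (\<zeta> * of_real t) \<partial>lborel) = (\<integral>t. H ((- b + 1 * t) + b) * exp (\<zeta> * of_real (- b + 1 * t)) \<partial>lborel)"
    by (subst lborel_integral_real_affine[of 1 _ "- b"]) auto
  also have "\<dots> = (\<integral>t. exp (- \<zeta> * of_real b) * (H t * exp (\<zeta> * of_real t)) \<partial>lborel)"
  proof (intro Bochner_Integration.integral_cong refl)
    fix t
    have "exp (\<zeta> * of_real (- b + 1 * t)) = exp (- \<zeta> * of_real b) * exp (\<zeta> * of_real t)"
      by (simp add: algebra_simps flip: exp_add)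
    then show "H ((- b + 1 * t) + b) * exp (\<zeta> * of_real (- b + 1 * t)) = exp (- \<zeta> * of_real b) * (H t * exp (\<zeta> * of_real t))"
      by simp
  qed
  also have "\<dots> = exp (- \<zeta> * of_real b) * (\<integral>t. H t * exp (\<zeta> * of_real t) \<partial>lborel)" by (rule integral_mult_right_zero)
  finally show ?thesis .
qed

section \<open>Sums of shifts and zeros on the critical line\<close>

locale shifted_sum =
  fixes H :: "real \<Rightarrow> real" and c l :: "nat \<Rightarrow> real" and L :: real
  assumes cont: "continuous_on UNIV H"
    and decay: "\<And>\<eta>. 0 < \<eta> \<Longrightarrow> \<eta> < pi/2 \<Longrightarrow> \<exists>C\<ge>0. \<forall>t. \<bar>H t\<bar> \<le> C * exp (- \<eta> * \<bar>t\<bar>)"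
    and c: "summable (\<lambda>n. \<bar>c n\<bar>)" and l: "\<And>n. \<bar>l n\<bar> \<le> L"
begin

definition summand :: "nat \<Rightarrow> real \<Rightarrow> real" where
  "summand n t = c n * (H (t + l n) + H (t - l n))"

definition G :: "real \<Rightarrow> real" where "G t = (\<Sum>n. summand n t)"

text \<open>A shift by at most L changes \<open>exp (- \<eta> * \<bar>t\<bar>)\<close> by at most
  the factor \<open>exp (\<eta> * L)\<close>, so one constant serves all summands.\<close>

lemma summand_decay:
  assumes "0 < \<eta>" "\<eta> < pi/2"
  obtains C where "C \<ge> 0" "\<And>n t. \<bar>summand n t\<bar> \<le> \<bar>c n\<bar> * (C * exp (- \<eta> * \<bar>t\<bar>))"
proof -
  obtain C where C: "C \<ge> 0" "\<And>t. \<bar>H t\<bar> \<le> C * exp (- \<eta> * \<bar>t\<bar>)" using decay[OF assms] by blast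
  have s: "\<bar>H (t + b)\<bar> \<le> C * exp (\<eta> * L) * exp (- \<eta> * \<bar>t\<bar>)" if "\<bar>b\<bar> \<le> L" for t b
  proof -
    have "\<bar>t\<bar> - L \<le> \<bar>t + b\<bar>" using that by linarith
    then have "\<eta> * (\<bar>t\<bar> - L) \<le> \<eta> * \<bar>t + b\<bar>" using assms by (intro mult_left_mono) auto
    then have "exp (- \<eta> * \<bar>t + b\<bar>) \<le> exp (\<eta> * L) * exp (- \<eta> * \<bar>t\<bar>)" by (simp add: algebra_simps flip: exp_add)
    then have "C * exp (- \<eta> * \<bar>t + b\<bar>) \<le> C * (exp (\<eta> * L) * exp (- \<eta> * \<bar>t\<bar>))" using C(1) by (rule mult_left_mono)
    with C(2)[of "t + b"] show ?thesis by simp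
  qed
  show thesis
  proof (rule that[of "2 * (C * exp (\<eta> * L))"])
    fix n t
    have "\<bar>H (t + l n) + H (t - l n)\<bar> \<le> 2 * (C * exp (\<eta> * L)) * exp (- \<eta> * \<bar>t\<bar>)"
      using s[OF l[of n], of t] s[of "- l n" t] l[of n] by simp
    then show "\<bar>summand n t\<bar> \<le> \<bar>c n\<bar> * (2 * (C * exp (\<eta> * L)) * exp (- \<eta> * \<bar>t\<bar>))"
      unfolding summand_def abs_mult by (intro mult_left_mono) auto
  qed (use C in auto)
qed

lemma summand_summable: "summable (\<lambda>n. \<bar>summand n t\<bar>)"
proof -
  obtain C where C: "C \<ge> 0" "\<And>n t. \<bar>summand n t\<bar> \<le> \<bar>c n\<bar> * (C * exp (- 1 * \<bar>t\<bar>))"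
    using summand_decay[of 1] pi_gt3 by auto
  have "summable (\<lambda>n. \<bar>c n\<bar> * (C * exp (- 1 * \<bar>t\<bar>)))" using c by (rule summable_mult2)
  then show ?thesis by (rule summable_comparison_test') (use C(2) in auto)
qed

lemma G_decay:
  assumes "0 < \<eta>" "\<eta> < pi/2"
  shows "\<exists>C. \<forall>t. \<bar>G t\<bar> \<le> C * exp (- \<eta> * \<bar>t\<bar>)"
proof -
  obtain C where C: "C \<ge> 0" "\<And>n t. \<bar>summand n t\<bar> \<le> \<bar>c n\<bar> * (C * exp (- \<eta> * \<bar>t\<bar>))"
    using summand_decay[OF assms] by blast
  have "\<bar>G t\<bar> \<le> ((\<Sum>n. \<bar>c n\<bar>) * C) * exp (- \<eta> * \<bar>t\<bar>)" for t
  proof -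
    have "norm (G t) \<le> (\<Sum>n. \<bar>c n\<bar> * (C * exp (- \<eta> * \<bar>t\<bar>)))"
      unfolding G_def using C(2) by (intro norm_suminf_le summable_mult2 c) auto
    also have "\<dots> = (\<Sum>n. \<bar>c n\<bar>) * (C * exp (- \<eta> * \<bar>t\<bar>))" by (rule suminf_mult2[symmetric, OF c])
    finally show ?thesis by (simp add: mult.assoc)
  qed
  then show ?thesis by blast
qed

lemma G_continuous: "continuous_on UNIV G"
proof -
  obtain C where C: "C \<ge> 0" "\<And>n t. \<bar>summand n t\<bar> \<le> \<bar>c n\<bar> * (C * exp (- 1 * \<bar>t\<bar>))"
    using summand_decay[of 1] pi_gt3 by auto
  have lim: "uniform_limit UNIV (\<lambda>n t. \<Sum>i<n. summand i t) G sequentially"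
    unfolding G_def
  proof (rule Weierstrass_m_test)
    show "summable (\<lambda>n. \<bar>c n\<bar> * C)" using c by (rule summable_mult2)
    fix n t
    have "C * exp (- 1 * \<bar>t\<bar>) \<le> C" using C(1) by (simp add: mult_left_le)
    then have "\<bar>c n\<bar> * (C * exp (- 1 * \<bar>t\<bar>)) \<le> \<bar>c n\<bar> * C" by (intro mult_left_mono) auto
    then show "norm (summand n t) \<le> \<bar>c n\<bar> * C" using C(2)[of n t] by simp
  qed
  have "continuous_on UNIV (summand i)" for i unfolding summand_def
    by (intro continuous_intros continuous_on_compose2[OF cont]) auto
  then have "\<forall>\<^sub>F n in sequentially. continuous_on UNIV (\<lambda>t. \<Sum>i<n. summand i t)"
    by (intro always_eventually allI continuous_intros)
  then show ?thesis using lim by (rule uniform_limit_theorem) simp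
qed

lemma G_parity:
  assumes "\<And>t. H (- t) = \<sigma> * H t"
  shows "G (- t) = \<sigma> * G t"
proof -
  have "summand n (- t) = \<sigma> * summand n t" for n
    using assms[of "t - l n"] assms[of "t + l n"] by (simp add: summand_def algebra_simps)
  then show ?thesis unfolding G_def
    using suminf_mult[OF summable_rabs_cancel[OF summand_summable], of \<sigma>] by simp
qed

text \<open>A shift by b multiplies the transform by \<open>exp (- \<zeta> * b)\<close>, of norm at
  most \<open>exp (2 * L)\<close> because \<open>\<bar>Re \<zeta>\<bar> < pi/2 < 2\<close>. Here the
  boundedness of the shifts is essential: the smallness of the transform of H passes to the whole
  sum with a constant independent of \<open>\<zeta>\<close>.\<close>

lemma G_transform:
  assumes \<zeta>: "\<bar>Re \<zeta>\<bar> < pi/2"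
  shows "norm (\<integral>t. complex_of_real (G t) * exp (\<zeta> * of_real t) \<partial>lborel)
    \<le> (\<Sum>n. \<bar>c n\<bar>) * (2 * exp (2 * L)) * norm (\<integral>t. complex_of_real (H t) * exp (\<zeta> * of_real t) \<partial>lborel)"
proof -
  obtain \<eta> where \<eta>: "\<bar>Re \<zeta>\<bar> < \<eta>" "\<eta> < pi/2" using dense[OF \<zeta>] by blast
  then have "0 < \<eta>" by linarith
  then obtain C where C: "C \<ge> 0" "\<And>n t. \<bar>summand n t\<bar> \<le> \<bar>c n\<bar> * (C * exp (- \<eta> * \<bar>t\<bar>))"
    using summand_decay[of \<eta>] \<eta> by blast
  obtain D where D: "D \<ge> 0" "\<And>t. \<bar>H t\<bar> \<le> D * exp (- \<eta> * \<bar>t\<bar>)" using decay[of \<eta>] \<open>0 < \<eta>\<close> \<eta> by blast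
  have H_meas: "(\<lambda>t. complex_of_real (H t)) \<in> borel_measurable borel"
    by (intro borel_measurable_continuous_onI continuous_intros cont)
  have [measurable]: "H \<in> borel_measurable borel" by (rule borel_measurable_continuous_onI[OF cont])
  have summand_meas [measurable]: "summand n \<in> borel_measurable borel" for n unfolding summand_def by measurable
  define F where "F = (\<integral>t. complex_of_real (H t) * exp (\<zeta> * of_real t) \<partial>lborel)"
  define J where "J = (\<integral>t. C * exp (- (\<eta> - \<bar>Re \<zeta>\<bar>) * \<bar>t\<bar>) \<partial>lborel)"
  have eint: "integrable lborel (\<lambda>t. C * exp (- (\<eta> - \<bar>Re \<zeta>\<bar>) * \<bar>t\<bar>))"
    using \<eta> by (intro integrable_mult_right integrable_exp_abs) auto
  have tb: "norm (complex_of_real (summand n t) * exp (\<zeta> * of_real t)) \<le> \<bar>c n\<bar> * (C * exp (- (\<eta> - \<bar>Re \<zeta>\<bar>) * \<bar>t\<bar>))" for n t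
  proof -
    have "Re \<zeta> * t \<le> \<bar>Re \<zeta>\<bar> * \<bar>t\<bar>" by (metis abs_ge_self abs_mult)
    then have e: "norm (exp (\<zeta> * of_real t)) \<le> exp (\<bar>Re \<zeta>\<bar> * \<bar>t\<bar>)" by simp
    have "norm (complex_of_real (summand n t) * exp (\<zeta> * of_real t)) \<le> (\<bar>c n\<bar> * (C * exp (- \<eta> * \<bar>t\<bar>))) * exp (\<bar>Re \<zeta>\<bar> * \<bar>t\<bar>)"
      unfolding norm_mult norm_of_real using C by (intro mult_mono e C(2)) auto
    also have "\<dots> = \<bar>c n\<bar> * (C * (exp (- \<eta> * \<bar>t\<bar>) * exp (\<bar>Re \<zeta>\<bar> * \<bar>t\<bar>)))" by simp
    also have "exp (- \<eta> * \<bar>t\<bar>) * exp (\<bar>Re \<zeta>\<bar> * \<bar>t\<bar>) = exp (- (\<eta> - \<bar>Re \<zeta>\<bar>) * \<bar>t\<bar>)" by (simp add: algebra_simps flip: exp_add)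
    finally show ?thesis .
  qed
  have tint: "integrable lborel (\<lambda>t. complex_of_real (summand n t) * exp (\<zeta> * of_real t))" for n
  proof (rule Bochner_Integration.integrable_bound[OF integrable_mult_right[OF eint, of "\<bar>c n\<bar>"]])
    show "AE t in lborel. norm (complex_of_real (summand n t) * exp (\<zeta> * of_real t)) \<le> norm (\<bar>c n\<bar> * (C * exp (- (\<eta> - \<bar>Re \<zeta>\<bar>) * \<bar>t\<bar>)))"
      by (rule AE_I2) (rule order.trans[OF tb], simp)
  qed measurable
  have "(\<lambda>n. \<integral>t. complex_of_real (summand n t) * exp (\<zeta> * of_real t) \<partial>lborel) sums
     (\<integral>t. (\<Sum>n. complex_of_real (summand n t) * exp (\<zeta> * of_real t)) \<partial>lborel)"
  proof (rule sums_integral[OF tint])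
    show "AE t in lborel. summable (\<lambda>n. norm (complex_of_real (summand n t) * exp (\<zeta> * of_real t)))"
      by (rule AE_I2) (use summand_summable in \<open>auto simp: norm_mult intro!: summable_mult2\<close>)
    show "summable (\<lambda>n. \<integral>t. norm (complex_of_real (summand n t) * exp (\<zeta> * of_real t)) \<partial>lborel)"
    proof (rule summable_comparison_test')
      show "summable (\<lambda>n. \<bar>c n\<bar> * J)" using c by (rule summable_mult2)
      fix n
      have "(\<integral>t. norm (complex_of_real (summand n t) * exp (\<zeta> * of_real t)) \<partial>lborel) \<le> (\<integral>t. \<bar>c n\<bar> * (C * exp (- (\<eta> - \<bar>Re \<zeta>\<bar>) * \<bar>t\<bar>)) \<partial>lborel)"
        by (intro integral_mono integrable_norm tint integrable_mult_right eint tb)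
      also have "\<dots> = \<bar>c n\<bar> * J" unfolding J_def by (rule integral_mult_right_zero)
      finally show "norm (\<integral>t. norm (complex_of_real (summand n t) * exp (\<zeta> * of_real t)) \<partial>lborel) \<le> \<bar>c n\<bar> * J"
        by simp
    qed
  qed
  also have "(\<lambda>t. \<Sum>n. complex_of_real (summand n t) * exp (\<zeta> * of_real t)) = (\<lambda>t. complex_of_real (G t) * exp (\<zeta> * of_real t))"
  proof
    fix t
    have "(\<lambda>n. summand n t) sums G t" unfolding G_def by (rule summable_sums[OF summable_rabs_cancel[OF summand_summable]])
    then have "(\<lambda>n. complex_of_real (summand n t) * exp (\<zeta> * of_real t)) sums (complex_of_real (G t) * exp (\<zeta> * of_real t))"
      by (intro sums_mult2 sums_of_real)
    then show "(\<Sum>n. complex_of_real (summand n t) * exp (\<zeta> * of_real t)) = complex_of_real (G t) * exp (\<zeta> * of_real t)"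
      by (rule sums_unique[symmetric])
  qed
  finally have sums: "(\<lambda>n. \<integral>t. complex_of_real (summand n t) * exp (\<zeta> * of_real t) \<partial>lborel) sums (\<integral>t. complex_of_real (G t) * exp (\<zeta> * of_real t) \<partial>lborel)" .
  have Re2: "\<bar>Re \<zeta>\<bar> \<le> 2" using \<zeta> pi_less_4 by linarith
  have eb: "norm (exp (- \<zeta> * of_real b)) \<le> exp (2 * L)" if "\<bar>b\<bar> \<le> L" for b
  proof -
    have "- (Re \<zeta> * b) \<le> \<bar>Re \<zeta>\<bar> * \<bar>b\<bar>" by (metis abs_ge_minus_self abs_mult)
    also have "\<dots> \<le> 2 * L" using that Re2 by (intro mult_mono) auto
    finally show ?thesis by simp
  qed
  have shint: "integrable lborel (\<lambda>t. complex_of_real (H (t + b)) * exp (\<zeta> * of_real t))" for b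
  proof -
    have "integrable lborel (\<lambda>t. complex_of_real (H t) * of_real (t ^ 0) * exp (\<zeta> * of_real t))"
      by (rule integrable_power_exp[OF H_meas _ \<eta>(1)]) (use D in auto)
    then have "integrable lborel (\<lambda>t. complex_of_real (H t) * exp (\<zeta> * of_real t))" by simp
    then have "integrable lborel (\<lambda>t. complex_of_real (H (b + 1 * t)) * exp (\<zeta> * of_real (b + 1 * t)))"
      by (rule lborel_integrable_real_affine) simp
    then have "integrable lborel (\<lambda>t. exp (- \<zeta> * of_real b) * (complex_of_real (H (b + 1 * t)) * exp (\<zeta> * of_real (b + 1 * t))))"
      by (rule integrable_mult_right)
    also have "(\<lambda>t. exp (- \<zeta> * of_real b) * (complex_of_real (H (b + 1 * t)) * exp (\<zeta> * of_real (b + 1 * t)))) = (\<lambda>t. complex_of_real (H (t + b)) * exp (\<zeta> * of_real t))"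
    proof
      fix t
      have "exp (- \<zeta> * of_real b) * exp (\<zeta> * of_real (b + 1 * t)) = exp (\<zeta> * of_real t)" by (simp add: algebra_simps flip: exp_add)
      then show "exp (- \<zeta> * of_real b) * (complex_of_real (H (b + 1 * t)) * exp (\<zeta> * of_real (b + 1 * t))) = complex_of_real (H (t + b)) * exp (\<zeta> * of_real t)"
        by (metis (no_types, opaque_lifting) add.commute mult.left_commute mult_1)
    qed
    finally show ?thesis .
  qed
  have nb: "norm (\<integral>t. complex_of_real (summand n t) * exp (\<zeta> * of_real t) \<partial>lborel) \<le> \<bar>c n\<bar> * (2 * exp (2 * L) * norm F)" for n
  proof -
    have "(\<integral>t. complex_of_real (summand n t) * exp (\<zeta> * of_real t) \<partial>lborel) =
      (\<integral>t. of_real (c n) * (complex_of_real (H (t + l n)) * exp (\<zeta> * of_real t) + complex_of_real (H (t + - l n)) * exp (\<zeta> * of_real t)) \<partial>lborel)"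
      by (simp add: summand_def algebra_simps)
    also have "\<dots> = of_real (c n) * (exp (- \<zeta> * of_real (l n)) * F + exp (- \<zeta> * of_real (- l n)) * F)"
      unfolding integral_mult_right_zero Bochner_Integration.integral_add[OF shint shint] F_def
      by (simp only: integral_shift_exp[of "\<lambda>t. complex_of_real (H t)"])
    also have "norm \<dots> \<le> \<bar>c n\<bar> * (exp (2 * L) * norm F + exp (2 * L) * norm F)"
    proof -
      have "norm (exp (- \<zeta> * of_real (l n)) * F + exp (- \<zeta> * of_real (- l n)) * F) \<le> exp (2 * L) * norm F + exp (2 * L) * norm F"
        using eb[OF l[of n]] eb[of "- l n"] l[of n]
        by (intro order.trans[OF norm_triangle_ineq] add_mono) (auto simp only: norm_mult abs_minus_cancel intro!: mult_right_mono norm_ge_zero)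
      then show ?thesis unfolding norm_mult norm_of_real by (intro mult_left_mono) auto
    qed
    finally show ?thesis by (simp add: algebra_simps)
  qed
  have "norm (\<integral>t. complex_of_real (G t) * exp (\<zeta> * of_real t) \<partial>lborel) \<le> (\<Sum>n. \<bar>c n\<bar> * (2 * exp (2 * L) * norm F))"
    unfolding sums_unique[OF sums] by (rule norm_suminf_le[OF nb]) (rule summable_mult2[OF c])
  also have "\<dots> = (\<Sum>n. \<bar>c n\<bar>) * (2 * exp (2 * L) * norm F)" by (rule suminf_mult2[symmetric, OF c])
  finally show ?thesis by (simp only: F_def mult.assoc)
qed

end

section \<open>Weights in which the form vanishes, and the completed L-function in the original
  notation\<close>

context cusp
begin

text \<open>Minus the identity matrix acts trivially on the half-plane but multiplies f by
  \<open>(- 1) ^ k\<close>.\<close>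

lemma f_zero_odd:
  assumes "odd k" "Im \<tau> > 0"
  shows "f \<tau> = 0"
proof -
  have "f \<tau> = (- 1) ^ k * f \<tau>" using f_transform[of "-1" "-1" 0 0 \<tau>] assms by simp
  then show ?thesis using assms by simp
qed

text \<open>In weight 0 the function itself is invariant and decays at the cusp, so its modulus
  attains a maximum, found on a compact rectangle. The maximum modulus principle makes f constant,
  which contradicts the decay.\<close>

lemma f_zero_weight_0:
  assumes k: "k = 0" and \<tau>: "Im \<tau> > 0"
  shows "f \<tau> = 0"
proof (rule ccontr)
  assume nz: "f \<tau> \<noteq> 0"
  obtain C where C: "C \<ge> 0" "\<And>\<tau>. Im \<tau> \<ge> 1/5 \<Longrightarrow> norm (f \<tau>) \<le> C * exp (- 2 * pi * Im \<tau>)"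
    using f_exp_decay[of "1/5"] by auto
  have "((\<lambda>y. C * exp (- 2 * pi * y)) \<longlongrightarrow> 0) at_top" by real_asymp
  then have "\<forall>\<^sub>F y in at_top. C * exp (- 2 * pi * y) < norm (f \<tau>)"
    using nz by (intro order_tendstoD(2)) auto
  then have "\<forall>\<^sub>F y in at_top. C * exp (- 2 * pi * y) < norm (f \<tau>) \<and> y \<ge> 1"
    using eventually_ge_at_top[of 1] by eventually_elim auto
  then obtain Y where Y: "C * exp (- 2 * pi * Y) < norm (f \<tau>)" "Y \<ge> 1"
    by (metis (mono_tags, lifting) eventually_happens trivial_limit_at_top_linorder)
  have high: "norm (f \<tau>') < norm (f \<tau>)" if "Im \<tau>' \<ge> Y" for \<tau>'
  proof -
    have "norm (f \<tau>') \<le> C * exp (- 2 * pi * Im \<tau>')" using C(2)[of \<tau>'] that Y(2) by auto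
    also have "\<dots> \<le> C * exp (- 2 * pi * Y)" using C(1) that by (intro mult_left_mono) auto
    finally show ?thesis using Y(1) by linarith
  qed
  define K where "K = cbox (Complex (-1/2) (1/5)) (Complex (1/2) Y)"
  have K: "\<sigma> \<in> K \<longleftrightarrow> \<bar>Re \<sigma>\<bar> \<le> 1/2 \<and> 1/5 \<le> Im \<sigma> \<and> Im \<sigma> \<le> Y" for \<sigma>
    by (auto simp: K_def in_cbox_complex_iff abs_le_iff)
  \<comment> \<open>Only points with modulus at least \<open>norm (f \<tau>)\<close> are moved into
    K: above height Y the modulus is smaller, so after the reduction such a point lies below Y, and
    an integer translation fixes its real part.\<close>
  have reduce: "\<exists>\<sigma>\<in>K. norm (f \<sigma>) = norm (f \<tau>')" if t: "Im \<tau>' > 0" "norm (f \<tau>) \<le> norm (f \<tau>')" for \<tau>'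
  proof -
    obtain \<sigma> where \<sigma>: "Im \<sigma> \<ge> 1/5" "f \<sigma> = f \<tau>'"
    proof (cases "Im \<tau>' < 1")
      case True
      obtain p q r s :: int where g: "p * s - q * r = 1"
        "Im ((of_int p * \<tau>' + of_int q) / (of_int r * \<tau>' + of_int s)) \<ge> 1/5"
        using modular_reduction[OF t(1) True] by metis
      show thesis by (rule that[OF g(2)]) (use f_transform[OF g(1) t(1)] k in simp)
    next
      case False
      then show thesis using that[of \<tau>'] by simp
    qed
    define n where "n = - round (Re \<sigma>)"
    have eq: "f (\<sigma> + of_int n) = f \<sigma>" using f_transform[of 1 1 n 0 \<sigma>] \<sigma>(1) by simp
    have "\<bar>of_int (round (Re \<sigma>)) - Re \<sigma>\<bar> \<le> 1/2" by (rule of_int_round_abs_le)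
    then have "\<bar>Re (\<sigma> + of_int n)\<bar> \<le> 1/2" by (simp add: n_def abs_minus_commute)
    moreover have "Im (\<sigma> + of_int n) < Y" using high[of \<sigma>] \<sigma>(2) t(2) by (cases "Im \<sigma> \<ge> Y") auto
    ultimately have "\<sigma> + of_int n \<in> K" using \<sigma>(1) by (simp add: K)
    then show ?thesis using eq \<sigma>(2) by metis
  qed
  have "compact K" unfolding K_def by (rule compact_cbox)
  moreover have "K \<noteq> {}" using reduce[OF \<tau>] by blast
  moreover have "continuous_on K (\<lambda>\<sigma>. norm (f \<sigma>))"
    by (intro continuous_intros continuous_on_subset[OF holomorphic_on_imp_continuous_on[OF f_holomorphic]]) (auto simp: K)
  ultimately obtain \<sigma> where \<sigma>: "\<sigma> \<in> K" "\<And>\<sigma>'. \<sigma>' \<in> K \<Longrightarrow> norm (f \<sigma>') \<le> norm (f \<sigma>)"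
    using continuous_attains_sup by metis
  have max: "norm (f \<tau>') \<le> norm (f \<sigma>)" if "Im \<tau>' > 0" for \<tau>'
  proof (cases "norm (f \<tau>) \<le> norm (f \<tau>')")
    case True
    then show ?thesis using reduce[OF that] \<sigma>(2) by metis
  next
    case False
    then show ?thesis using reduce[OF \<tau>] \<sigma>(2) by (metis linorder_linear order_trans order_refl)
  qed
  have "f constant_on {\<tau>. Im \<tau> > 0}"
  proof (rule maximum_modulus_principle[OF f_holomorphic])
    show "connected {\<tau>. Im \<tau> > 0}" by (intro convex_connected convex_halfspace_Im_gt)
    show "\<sigma> \<in> {\<tau>. Im \<tau> > 0}" using \<sigma>(1) by (simp add: K)
  qed (use max in \<open>auto intro: open_halfspace_Im_gt\<close>)
  then obtain z where z: "\<And>\<tau>. Im \<tau> > 0 \<Longrightarrow> f \<tau> = z" by (auto simp: constant_on_def)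
  then show False using high[of "\<i> * of_real Y"] \<tau> Y(2) by simp
qed

lemma Lam_completed:
  assumes "Re s > 0"
  shows "of_real (2 * pi) powr (- s) * Gamma s * cusp_L k (\<lambda>n. complex_of_real (a n)) s = Lam s"
proof -
  have "s \<notin> \<int>\<^sub>\<le>\<^sub>0" using assms by (auto elim!: nonpos_Ints_cases)
  then have 1: "Gamma s * rGamma s = 1" by (simp add: rGamma_inverse_Gamma Gamma_eq_zero_iff)
  have 2: "of_real (2 * pi) powr (- s) * of_real (2 * pi) powr s = (1 :: complex)" by (simp flip: powr_add)
  have "of_real (2 * pi) powr (- s) * Gamma s * cusp_L k (\<lambda>n. complex_of_real (a n)) s = (of_real (2 * pi) powr (- s) * of_real (2 * pi) powr s) * (Gamma s * rGamma s) * Lam s"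
    unfolding cusp_L_eq by (simp only: mult_ac)
  then show ?thesis unfolding 1 2 by simp
qed

lemma G_tilde_zero:
  assumes "\<And>\<tau>. Im \<tau> > 0 \<Longrightarrow> f \<tau> = 0"
  shows "G_tilde k (\<lambda>n. complex_of_real (a n)) c l z s = 0"
proof -
  have "Lam s = 0" for s
    unfolding Lam_def by (simp add: assms Re_exp)
  then have "cusp_L k (\<lambda>n. complex_of_real (a n)) s = 0" for s unfolding cusp_L_eq by simp
  then show ?thesis by (simp add: G_tilde_def Let_def)
qed

end

section \<open>Positive even weight: the real function on the critical line and its zeros\<close>

locale even_cusp = cusp +
  fixes w :: real
  assumes k_pos: "k > 0" and k_even: "even k" and w: "w \<ge> 0" "w \<le> pi/36"
begin

text \<open>The sign \<open>\<i> ^ k\<close> of the functional equation, which also becomes the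
  parity of H.\<close>

definition \<epsilon> :: real where "\<epsilon> = (- 1) ^ (k div 2)"

text \<open>The sum of \<open>H1\<close> and \<open>\<epsilon>\<close> times its conjugate is twice
  a real part or \<open>2 * \<i>\<close> times an imaginary part; \<open>unit\<close> takes out this
  \<open>\<i>\<close>, leaving the real function H.\<close>

definition unit :: complex where "unit = (if \<epsilon> = 1 then 1 else \<i>)"

definition H :: "real \<Rightarrow> real" where "H t = (if \<epsilon> = 1 then 2 * Re (H1 w t) else 2 * Im (H1 w t))"

lemma \<epsilon>_cases: "\<epsilon> = 1 \<or> \<epsilon> = - 1"
  unfolding \<epsilon>_def by (cases "even (k div 2)") auto

lemma i_power_k: "\<i> ^ k = of_real \<epsilon>"
proof -
  have "\<i> ^ k = (\<i>\<^sup>2) ^ (k div 2)" using k_even by (simp flip: power_mult)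
  then show ?thesis by (simp add: \<epsilon>_def)
qed

lemma cnj_H1: "cnj (H1 w t) = H1 w (- t)"
  by (simp add: H1_def cnj_Xi cnj_kummer_1F1[OF k_pos])

lemma H_eq: "unit * of_real (H t) = H1 w t + of_real \<epsilon> * cnj (H1 w t)"
  using \<epsilon>_cases by (elim disjE) (simp_all add: unit_def H_def complex_eq_iff)

text \<open>Conjugation reverses t in both factors of \<open>H1\<close>; the functional equation
  returns \<open>Xi (- t)\<close> to \<open>Xi t\<close>, and its sign cancels
  \<open>\<epsilon>\<close>. The right side is the shape of the summands of
  \<open>G_tilde\<close>.\<close>

lemma H_eq': "unit * of_real (H t) = Xi t * (kummer_1F1 (of_nat k / 2 - \<i> * of_real t) (of_nat k) (of_real w)
    + kummer_1F1 (of_nat k / 2 + \<i> * of_real t) (of_nat k) (of_real w))"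
proof -
  have "of_real \<epsilon> * cnj (H1 w t) = Xi t * kummer_1F1 (of_nat k / 2 - \<i> * of_real t) (of_nat k) (of_real w)"
    unfolding cnj_H1 using \<epsilon>_cases by (auto simp: H1_def Xi_reflect i_power_k)
  then show ?thesis unfolding H_eq by (simp add: H1_def algebra_simps)
qed

lemma H_parity: "H (- t) = \<epsilon> * H t"
proof -
  have "H1 w (- t) = cnj (H1 w t)" by (rule cnj_H1[symmetric])
  then show ?thesis using \<epsilon>_cases by (elim disjE) (simp_all add: H_def)
qed

lemma H_continuous: "continuous_on UNIV H"
  unfolding H_def using \<epsilon>_cases
  by (elim disjE) (auto intro!: continuous_intros H1_continuous[OF k_pos w(1)])

lemma H_bound: "\<bar>H t\<bar> \<le> 2 * norm (H1 w t)"
  using abs_Re_le_cmod[of "H1 w t"] abs_Im_le_cmod[of "H1 w t"] by (simp add: H_def abs_mult)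

lemma H_decay:
  assumes "0 < \<eta>" "\<eta> < pi/2"
  shows "\<exists>C\<ge>0. \<forall>t. \<bar>H t\<bar> \<le> C * exp (- \<eta> * \<bar>t\<bar>)"
proof -
  obtain C where "C \<ge> 0" "\<And>t. norm (H1 w t) \<le> C * exp (- \<eta> * \<bar>t\<bar>)"
    using H1_decay[OF k_pos w(1) assms] by blast
  then have "2 * norm (H1 w t) \<le> 2 * (C * exp (- \<eta> * \<bar>t\<bar>))" for t
    by (intro mult_left_mono) auto
  then have "\<bar>H t\<bar> \<le> (2 * C) * exp (- \<eta> * \<bar>t\<bar>)" for t
    using order.trans[OF H_bound] by (simp only: mult.assoc)
  then show ?thesis using \<open>C \<ge> 0\<close> by (intro exI[of _ "2 * C"]) auto
qed

lemma H1_exp_integrable: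
  assumes "\<bar>Re \<zeta>\<bar> < pi/2"
  shows "integrable lborel (\<lambda>t. H1 w t * exp (\<zeta> * of_real t))"
proof -
  obtain \<eta> where \<eta>: "\<bar>Re \<zeta>\<bar> < \<eta>" "\<eta> < pi/2" using dense[OF assms] by blast
  then have "0 < \<eta>" by linarith
  then obtain C where C: "\<And>t. norm (H1 w t) \<le> C * exp (- \<eta> * \<bar>t\<bar>)"
    using H1_decay[OF k_pos w(1)] \<eta> by blast
  have "H1 w \<in> borel_measurable borel" using H1_continuous[OF k_pos w(1)] by (rule borel_measurable_continuous_onI)
  from integrable_power_exp[OF this C \<eta>(1), of 0] show ?thesis by simp
qed

text \<open>The transform of the conjugate of \<open>H1\<close> at \<open>\<zeta>\<close> is the
  conjugate of the transform of \<open>H1\<close> at \<open>cnj \<zeta>\<close>, and the disc is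
  symmetric about the real axis, so the bound for \<open>H1\<close> applies to both halves.\<close>

lemma H_transform_small:
  obtains C where "C \<ge> 0"
    "\<And>\<delta> \<zeta>. 0 < \<delta> \<Longrightarrow> \<delta> < 1/20 \<Longrightarrow> norm (\<zeta> - of_real (pi/2 - \<delta>)) \<le> \<delta>/8 \<Longrightarrow>
       \<bar>Re \<zeta>\<bar> < pi/2 \<and> norm (\<integral>t. complex_of_real (H t) * exp (\<zeta> * of_real t) \<partial>lborel) \<le> C * exp (- 1/\<delta>)"
proof -
  obtain C where C: "C \<ge> 0" "\<And>\<delta> \<zeta>. 0 < \<delta> \<Longrightarrow> \<delta> < 1/20 \<Longrightarrow> norm (\<zeta> - of_real (pi/2 - \<delta>)) \<le> \<delta>/8 \<Longrightarrow>
       norm (\<integral>t. H1 w t * exp (\<zeta> * of_real t) \<partial>lborel) \<le> C * exp (- 1/\<delta>)"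
    using H1_transform_small[OF k_pos w] by blast
  show thesis
  proof (rule that[of "2 * C"])
    fix \<delta> :: real and \<zeta> :: complex
    assume \<delta>: "0 < \<delta>" "\<delta> < 1/20" and \<zeta>: "norm (\<zeta> - of_real (pi/2 - \<delta>)) \<le> \<delta>/8"
    have "\<bar>Re \<zeta> - (pi/2 - \<delta>)\<bar> \<le> \<delta>/8" using abs_Re_le_cmod[of "\<zeta> - of_real (pi/2 - \<delta>)"] \<zeta> by simp
    then have Re: "\<bar>Re \<zeta>\<bar> < pi/2" using \<delta> pi_gt3 by linarith
    have "cnj \<zeta> - of_real (pi/2 - \<delta>) = cnj (\<zeta> - of_real (pi/2 - \<delta>))" by simp
    then have \<zeta>': "norm (cnj \<zeta> - of_real (pi/2 - \<delta>)) \<le> \<delta>/8" using \<zeta> by (simp only: complex_mod_cnj)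
    let ?F = "\<lambda>\<zeta>. \<integral>t. H1 w t * exp (\<zeta> * of_real t) \<partial>lborel"
    have cnj_int: "(\<integral>t. cnj (H1 w t) * exp (\<zeta> * of_real t) \<partial>lborel) = cnj (?F (cnj \<zeta>))"
    proof -
      have "(\<lambda>t. cnj (H1 w t) * exp (\<zeta> * of_real t)) = (\<lambda>t. cnj (H1 w t * exp (cnj \<zeta> * of_real t)))" by (simp add: exp_cnj)
      then show ?thesis by (simp only: Bochner_Integration.integral_cnj)
    qed
    have i1: "integrable lborel (\<lambda>t. H1 w t * exp (\<zeta> * of_real t))" by (rule H1_exp_integrable[OF Re])
    have i2: "integrable lborel (\<lambda>t. of_real \<epsilon> * (cnj (H1 w t) * exp (\<zeta> * of_real t)))"
    proof (rule integrable_mult_right)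
      have "integrable lborel (\<lambda>t. cnj (H1 w t * exp (cnj \<zeta> * of_real t)))"
        by (rule integrable_bounded_linear[OF bounded_linear_cnj H1_exp_integrable]) (use Re in simp)
      then show "integrable lborel (\<lambda>t. cnj (H1 w t) * exp (\<zeta> * of_real t))" by (simp add: exp_cnj)
    qed
    have "norm unit = 1" by (simp add: unit_def)
    have "norm (\<integral>t. complex_of_real (H t) * exp (\<zeta> * of_real t) \<partial>lborel) = norm (unit * (\<integral>t. complex_of_real (H t) * exp (\<zeta> * of_real t) \<partial>lborel))"
      unfolding norm_mult \<open>norm unit = 1\<close> by simp
    also have "unit * (\<integral>t. complex_of_real (H t) * exp (\<zeta> * of_real t) \<partial>lborel) = (\<integral>t. unit * (complex_of_real (H t) * exp (\<zeta> * of_real t)) \<partial>lborel)"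
      by (rule integral_mult_right_zero[symmetric])
    also have "(\<lambda>t. unit * (complex_of_real (H t) * exp (\<zeta> * of_real t))) = (\<lambda>t. H1 w t * exp (\<zeta> * of_real t) + of_real \<epsilon> * (cnj (H1 w t) * exp (\<zeta> * of_real t)))"
      unfolding mult.assoc[symmetric] H_eq by (simp only: ring_distribs mult.assoc)
    also have "(\<integral>t. H1 w t * exp (\<zeta> * of_real t) + of_real \<epsilon> * (cnj (H1 w t) * exp (\<zeta> * of_real t)) \<partial>lborel) = ?F \<zeta> + of_real \<epsilon> * cnj (?F (cnj \<zeta>))"
      unfolding Bochner_Integration.integral_add[OF i1 i2] integral_mult_right_zero cnj_int ..
    also have "norm \<dots> \<le> norm (?F \<zeta>) + norm (of_real \<epsilon> * cnj (?F (cnj \<zeta>)))" by (rule norm_triangle_ineq)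
    also have "norm (of_real \<epsilon> * cnj (?F (cnj \<zeta>))) = norm (?F (cnj \<zeta>))"
      using \<epsilon>_cases by (elim disjE) (simp_all only: norm_mult complex_mod_cnj norm_of_real abs_minus_cancel abs_one mult_1)
    also have "norm (?F \<zeta>) + norm (?F (cnj \<zeta>)) \<le> C * exp (- 1/\<delta>) + C * exp (- 1/\<delta>)"
      by (intro add_mono C(2)[OF \<delta> \<zeta>] C(2)[OF \<delta> \<zeta>'])
    finally show "\<bar>Re \<zeta>\<bar> < pi/2 \<and> norm (\<integral>t. complex_of_real (H t) * exp (\<zeta> * of_real t) \<partial>lborel) \<le> 2 * C * exp (- 1/\<delta>)"
      using Re by simp
  qed (use C in auto)
qed

text \<open>On the critical line \<open>k - cnj s = s\<close>, so with
  \<open>u = t + odd_ext l j\<close> the two Kummer parameters become \<open>k/2 - \<i> * u\<close>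
  and \<open>k/2 + \<i> * u\<close>, and each summand is \<open>unit * even_ext c j * H u\<close>.
  Positive and negative indices are then paired into the shifts by \<open>l\<close> and
  \<open>- l\<close>.\<close>

lemma G_tilde_eq:
  assumes "shifted_sum H (\<lambda>n. c (Suc n)) (\<lambda>n. l (Suc n)) L" and z: "w = z\<^sup>2 / 4"
  shows "G_tilde k (\<lambda>n. complex_of_real (a n)) c l z (of_nat k / 2 + \<i> * of_real t) =
    unit * of_real (shifted_sum.G H (\<lambda>n. c (Suc n)) (\<lambda>n. l (Suc n)) t)"
proof -
  interpret S: shifted_sum H "\<lambda>n. c (Suc n)" "\<lambda>n. l (Suc n)" L by fact
  define g where "g = (\<lambda>j. even_ext c j * H (t + odd_ext l j))"
  define s where "s = of_nat k / 2 + \<i> * complex_of_real t"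
  have summand: "(let \<mu> = \<i> * of_real (odd_ext l j); w = of_real (z\<^sup>2 / 4) in
        of_real (even_ext c j) * of_real (2 * pi) powr (- s - \<mu>) * Gamma (s + \<mu>)
          * cusp_L k (\<lambda>n. complex_of_real (a n)) (s + \<mu>)
          * (kummer_1F1 (of_nat k - s - \<mu>) (of_nat k) w
             + kummer_1F1 (of_nat k - cnj s + \<mu>) (of_nat k) w)) = unit * of_real (g j)" for j
  proof -
    define u where "u = t + odd_ext l j"
    have 1: "s + \<i> * of_real (odd_ext l j) = of_nat k / 2 + \<i> * of_real u"
      "- s - \<i> * of_real (odd_ext l j) = - (of_nat k / 2 + \<i> * of_real u)"
      "of_nat k - s - \<i> * of_real (odd_ext l j) = of_nat k / 2 - \<i> * of_real u"
      "of_nat k - cnj s + \<i> * of_real (odd_ext l j) = of_nat k / 2 + \<i> * of_real u"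
      by (simp_all add: s_def u_def algebra_simps complex_eq_iff)
    have L: "Xi u = of_real (2 * pi) powr (- (of_nat k / 2 + \<i> * of_real u)) * Gamma (of_nat k / 2 + \<i> * of_real u) * cusp_L k (\<lambda>n. complex_of_real (a n)) (of_nat k / 2 + \<i> * of_real u)"
      unfolding Xi_def by (rule Lam_completed[symmetric]) (use k_pos in simp)
    have "unit * of_real (g j) = of_real (even_ext c j) * (unit * of_real (H u))"
      by (simp add: g_def u_def)
    then show ?thesis
      unfolding Let_def 1 z[symmetric] H_eq' L by (simp only: mult.assoc)
  qed
  obtain C where C: "C \<ge> 0" "\<And>t. \<bar>H t\<bar> \<le> C * exp (- 1 * \<bar>t\<bar>)" using H_decay[of 1] pi_gt3 by auto
  have HC: "\<bar>H t\<bar> \<le> C" for t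
    by (rule order.trans[OF C(2)]) (use C(1) in \<open>simp add: mult_left_le\<close>)
  have sub: "summable (\<lambda>n. norm (c (Suc n) * H (t + b n)))" for b
    by (rule summable_comparison_test'[OF summable_mult2[OF S.c, of C]])
       (use HC in \<open>auto simp: abs_mult intro!: mult_left_mono\<close>)
  have hs: "((\<lambda>n. c (Suc n) * H (t + b n)) has_sum (\<Sum>n. c (Suc n) * H (t + b n))) UNIV" for b
    by (intro norm_summable_imp_has_sum sub summable_sums summable_norm_cancel[OF sub])
  \<comment> \<open>The natural index n stands for the integers \<open>n + 1\<close> and
    \<open>- (n + 1)\<close>.\<close>
  let ?p = "\<lambda>n. int (Suc n)" and ?m = "\<lambda>n. - int (Suc n)"
  have "(g \<circ> ?p) = (\<lambda>n. c (Suc n) * H (t + l (Suc n)))"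
    by (auto simp: g_def even_ext_def odd_ext_def simp del: of_nat_Suc)
  then have pos: "(g has_sum (\<Sum>n. c (Suc n) * H (t + l (Suc n)))) (range ?p)"
    using hs[of "\<lambda>n. l (Suc n)"] by (subst has_sum_reindex) (auto simp: inj_on_def)
  have "(g \<circ> ?m) = (\<lambda>n. c (Suc n) * H (t + - l (Suc n)))"
    by (auto simp: g_def even_ext_def odd_ext_def simp del: of_nat_Suc)
  then have neg: "(g has_sum (\<Sum>n. c (Suc n) * H (t + - l (Suc n)))) (range ?m)"
    using hs[of "\<lambda>n. - l (Suc n)"] by (subst has_sum_reindex) (auto simp: inj_on_def)
  have "{j. j \<noteq> 0} = range ?p \<union> range ?m"
  proof safe
    fix j :: int assume "j \<noteq> 0" "j \<notin> range ?m"
    have "j > 0"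
    proof (rule ccontr)
      assume "\<not> j > 0"
      then have "j = - int (Suc (nat (- j) - 1))" using \<open>j \<noteq> 0\<close> by simp
      then show False using \<open>j \<notin> range ?m\<close> by blast
    qed
    then have "j = int (Suc (nat j - 1))" by simp
    then show "j \<in> range ?p" by blast
  qed auto
  moreover have "range ?p \<inter> range ?m = {}" by auto
  ultimately have "(g has_sum ((\<Sum>n. c (Suc n) * H (t + l (Suc n))) + (\<Sum>n. c (Suc n) * H (t + - l (Suc n))))) {j. j \<noteq> 0}"
    using has_sum_Un_disjoint[OF pos neg] by simp
  also have "(\<Sum>n. c (Suc n) * H (t + l (Suc n))) + (\<Sum>n. c (Suc n) * H (t + - l (Suc n))) = S.G t"
    unfolding S.G_def S.summand_def
    by (subst suminf_add[OF summable_norm_cancel[OF sub] summable_norm_cancel[OF sub]]) (simp add: algebra_simps)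
  finally have "((\<lambda>j. unit * of_real (g j)) has_sum (unit * of_real (S.G t))) {j. j \<noteq> 0}"
    by (intro has_sum_cmult_right has_sum_of_real)
  then show ?thesis unfolding G_tilde_def s_def[symmetric] summand by (rule infsumI)
qed

lemma critical_zeros_not_sparse:
  fixes c l :: "nat \<Rightarrow> real"
  assumes c: "summable (\<lambda>j. \<bar>c (Suc j)\<bar>)" and l: "bounded (l ` {1..})" and z: "w = z\<^sup>2 / 4"
  shows "\<exists>T\<ge>T0. \<not> N_zeros k (\<lambda>n. complex_of_real (a n)) c l z T \<le> ereal (1/40 * sqrt T)"
proof (rule ccontr)
  assume neg: "\<not> ?thesis"
  obtain L where L: "\<And>n. \<bar>l (Suc n)\<bar> \<le> L" using l unfolding bounded_iff by force
  interpret S: shifted_sum H "\<lambda>n. c (Suc n)" "\<lambda>n. l (Suc n)" L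
    using c L H_decay by unfold_locales (auto intro: H_continuous)
  have unit0: "unit \<noteq> 0" by (simp add: unit_def)
  let ?h = "\<lambda>t. of_nat k / 2 + \<i> * complex_of_real t"
  have crit: "critical_zeros k (\<lambda>n. complex_of_real (a n)) c l z T = ?h ` {t\<in>{0..T}. S.G t = 0}" for T
  proof -
    have G: "G_tilde k (\<lambda>n. complex_of_real (a n)) c l z (?h t) = unit * of_real (S.G t)" for t
      by (rule G_tilde_eq[OF S.shifted_sum_axioms z])
    have "G_tilde k (\<lambda>n. complex_of_real (a n)) c l z (?h t) = 0 \<longleftrightarrow> S.G t = 0" for t unfolding G using unit0 by simp
    then show ?thesis unfolding critical_zeros_def by auto
  qed
  have inj: "inj_on ?h A" for A by (auto simp: inj_on_def)
  obtain C where C: "C \<ge> 0" "\<And>\<delta> \<zeta>. 0 < \<delta> \<Longrightarrow> \<delta> < 1/20 \<Longrightarrow> norm (\<zeta> - of_real (pi/2 - \<delta>)) \<le> \<delta>/8 \<Longrightarrow>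
       \<bar>Re \<zeta>\<bar> < pi/2 \<and> norm (\<integral>t. complex_of_real (H t) * exp (\<zeta> * of_real t) \<partial>lborel) \<le> C * exp (- 1/\<delta>)"
    using H_transform_small by blast
  define D where "D = (\<Sum>n. \<bar>c (Suc n)\<bar>) * (2 * exp (2 * L))"
  have D: "D \<ge> 0" unfolding D_def by (intro mult_nonneg_nonneg suminf_nonneg c) auto
  show False
  proof (rule zeros_not_sparse[where G=S.G and \<sigma>=\<epsilon> and ?\<delta>1.0="1/20" and ?C1.0="D * C" and ?T0.0=T0])
    show "S.G (- t) = \<epsilon> * S.G t" for t by (rule S.G_parity[OF H_parity])
    fix \<delta> :: real and \<zeta> :: complex
    assume \<delta>: "0 < \<delta>" "\<delta> < 1/20" and \<zeta>: "norm (\<zeta> - of_real (pi/2 - \<delta>)) \<le> \<delta>/8"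
    have "norm (\<integral>t. complex_of_real (S.G t) * exp (\<zeta> * of_real t) \<partial>lborel) \<le> D * norm (\<integral>t. complex_of_real (H t) * exp (\<zeta> * of_real t) \<partial>lborel)"
      unfolding D_def using C(2)[OF \<delta> \<zeta>] by (intro S.G_transform) auto
    also have "\<dots> \<le> D * (C * exp (- 1/\<delta>))" using C(2)[OF \<delta> \<zeta>] D by (intro mult_left_mono) auto
    finally show "norm (\<integral>t. complex_of_real (S.G t) * exp (\<zeta> * of_real t) \<partial>lborel) \<le> D * C * exp (- 1/\<delta>)" by simp
  next
    fix T assume "T \<ge> T0"
    then have N: "N_zeros k (\<lambda>n. complex_of_real (a n)) c l z T \<le> ereal (1/40 * sqrt T)" using neg by blast
    \<comment> \<open>A real upper bound excludes the value \<open>\<infinity>\<close>, so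
      finiteness of the zero set comes with it.\<close>
    then have fin: "finite (?h ` {t\<in>{0..T}. S.G t = 0})"
      unfolding N_zeros_def crit by (auto split: if_splits)
    then have "finite {t\<in>{0..T}. S.G t = 0}" using finite_imageD[OF _ inj] by blast
    moreover have "real (card {t\<in>{0..T}. S.G t = 0}) \<le> 1/40 * sqrt T"
      using N fin unfolding N_zeros_def crit by (simp add: card_image[OF inj])
    ultimately show "finite {t\<in>{0..T}. S.G t = 0} \<and> real (card {t\<in>{0..T}. S.G t = 0}) \<le> 1/40 * sqrt T" ..
  qed (use \<epsilon>_cases S.G_continuous S.G_decay in auto)
qed

end

theorem theorem1p2:
  fixes k :: nat
    and f :: "complex \<Rightarrow> complex"
    and a :: "nat \<Rightarrow> real"
    and c l :: "nat \<Rightarrow> real"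
    and z :: real
  assumes "cusp_form k f"
    and "has_cuspidal_expansion f (\<lambda>n. complex_of_real (a n))"
    and "\<And>j. j \<ge> 1 \<Longrightarrow> c j \<noteq> 0"
    and "summable (\<lambda>j. \<bar>c (Suc j)\<bar>)"
    and "bounded (l ` {1..})"
    and "inj_on l {1..}"
    and "- (sqrt pi / 3) \<le> z" and "z \<le> sqrt pi / 3"
  shows "\<exists>d>0. ereal d \<le>
           Limsup at_top (\<lambda>T. N_zeros k (\<lambda>n. complex_of_real (a n)) c l z T / ereal (sqrt T))"
proof -
  interpret cusp k f a using assms by unfold_locales
  let ?N = "N_zeros k (\<lambda>n. complex_of_real (a n)) c l z"
  show ?thesis
  \<comment> \<open>In odd weight and in weight 0 the form vanishes, every point of the critical
    line is a zero, and the count is infinite for every \<open>T > 0\<close>.\<close>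
  proof (cases "k > 0 \<and> even k")
    case False
    then have "f \<tau> = 0" if "Im \<tau> > 0" for \<tau>
      using f_zero_odd[OF _ that] f_zero_weight_0[OF _ that] by auto
    then have G: "G_tilde k (\<lambda>n. complex_of_real (a n)) c l z s = 0" for s by (rule G_tilde_zero)
    have inf: "?N T / ereal (sqrt T) = \<infinity>" if "T > 0" for T
    proof -
      let ?h = "\<lambda>t. of_nat k / 2 + \<i> * complex_of_real t"
      have "critical_zeros k (\<lambda>n. complex_of_real (a n)) c l z T = ?h ` {0..T}"
        unfolding critical_zeros_def G by auto
      moreover have "inj_on ?h {0..T}" by (auto simp: inj_on_def)
      ultimately have "infinite (critical_zeros k (\<lambda>n. complex_of_real (a n)) c l z T)"
        using that by (simp add: finite_image_iff)
      then show ?thesis using that by (simp add: N_zeros_def)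
    qed
    have "\<forall>\<^sub>F T in at_top. ereal 1 \<le> ?N T / ereal (sqrt T)"
      using eventually_gt_at_top[of "0::real"] by (rule eventually_mono) (subst inf, simp_all)
    then have "ereal 1 \<le> Limsup at_top (\<lambda>T. ?N T / ereal (sqrt T))"
      by (intro le_Limsup) auto
    then show ?thesis by (intro exI[of _ 1]) auto
  next
    case True
    define w where "w = z\<^sup>2 / 4"
    \<comment> \<open>The range of z enters here: it yields the bound \<open>pi/36\<close> to which
      the radius of the circle is tuned.\<close>
    have "z\<^sup>2 \<le> (sqrt pi / 3)\<^sup>2" using assms(7,8) by (intro power2_le_iff_abs_le[THEN iffD2]) auto
    then have "w \<le> pi/36" by (simp add: w_def power_divide)
    then interpret even_cusp k f a w using True by unfold_locales (auto simp: w_def)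
    have "ereal (1/40) \<le> Limsup at_top (\<lambda>T. ?N T / ereal (sqrt T))"
    proof (rule ccontr)
      \<comment> \<open>An upper limit below 1/40 would give the sparse counting bound for all large
        T.\<close>
      assume "\<not> ?thesis"
      then have "\<forall>\<^sub>F T in at_top. ?N T / ereal (sqrt T) < ereal (1/40)"
        by (intro Limsup_lessD) (simp add: not_le)
      then have "\<forall>\<^sub>F T in at_top. ?N T \<le> ereal (1/40 * sqrt T)"
        using eventually_gt_at_top[of 0]
      proof eventually_elim
        case (elim T)
        then show ?case by (cases "?N T") (auto simp: field_simps)
      qed
      then obtain T0 where "\<And>T. T \<ge> T0 \<Longrightarrow> ?N T \<le> ereal (1/40 * sqrt T)"
        by (auto simp: eventually_at_top_linorder)
      then show False using critical_zeros_not_sparse[OF assms(4,5) w_def, of T0] by blast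
    qed
    then show ?thesis by (intro exI[of _ "1/40"]) auto
  qed
qed

end
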